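(* Let $G=\star_{i\in I}G_i$ be a free product of a finite family of nontrivial finite groups, $|I|\ge 2$, with $\Sigma=\bigsqcup_{i\in I}\Sigma_i$, $\Sigma_i=G_i\setminus\{1_{G_i}\}$, and let $\mu$ be a probability measure on $\Sigma$ such that $\bigcup_{n\ge 1}\mathrm{supp}\,\mu^{*n}=G$ and the random walk $(G,\mu)$ is transient. Let $\mu^\infty$ be its harmonic measure, and let $r\in\mathring{\mathcal B}$. Then $\mu^\infty$ is the Markovian multiplicative measure associated with $r$ and is moreover stationary and ergodic with respect to the shift $\tau:\Sigma^{\mathbb N}\to\Sigma^{\mathbb N}$, $(x_n)_n\mapsto(x_{n+1})_n$, if and only if $r$ is a solution of the Stationary Traffic Equations, i.e. for all $a\in\Sigma$, $$r(a)=\mu(a)\frac{|I|-1}{|I|}+\sum_{(u,v)\in\Sigma^2,\ u\ast v=a}\mu(u)r(v)+r(a)\frac{|I|}{|I|-1}\sum_{u\in\Sigma\setminus\Sigma_a}\mu(u^{-1})r(u).$$ In particular, $\mu^\infty$ is Markovian multiplicative (associated with some element of $\mathring{\mathcal B}$) and stationary ergodic with respect to $\tau$ if and only if the Stationary Traffic Equations admit a solution in $\mathring{\mathcal B}$.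
   Context: For $a\in\Sigma$ write $\Sigma_a=\Sigma_i$ where $i$ is the index with $a\in\Sigma_i$. Elements of $G$ are identified with the set $L$ of finite words $u_1\cdots u_k$ over $\Sigma$ whose consecutive letters lie in different $\Sigma_i$'s (empty word $=1$). $L^\infty\subset\Sigma^{\mathbb N}$ is the set of infinite words all of whose finite prefixes lie in $L$. $u\Sigma^{\mathbb N}$ denotes the cylinder of infinite words with prefix $u$. For a vector $x\in\mathbb R^\Sigma$ and $S\subset\Sigma$, $x(S)=\sum_{u\in S}x(u)$. $\mathring{\mathcal B}=\{x\in\mathbb R^\Sigma: x(u)>0\ \forall u,\ \sum_u x(u)=1\}$. Random walk $(G,\mu)$: $X_0=1$, $X_{n+1}=X_n\ast x_n$ with $(x_n)$ i.i.d. of law $\mu$. Under the assumptions, there is a.s. a random $X_\infty\in L^\infty$ such that the length of the common prefix of $X_n$ and $X_\infty$ tends to infinity; the harmonic measure $\mu^\infty$ is the law of $X_\infty$. For $r\in\mathring{\mathcal B}$, the Markovian multiplicative measure associated with $r$ is the probability measure $\nu^\infty$ on $L^\infty$ (seen as a measure on $\Sigma^{\mathbb N}$) with, for every nonempty $u_1\cdots u_k\in L$, $$\nu^\infty(u_1\cdots u_k\Sigma^{\mathbb N})=\frac{r(u_1)}{r(\Sigma\setminus\Sigma_{u_1})}\cdots\frac{r(u_{k-1})}{r(\Sigma\setminus\Sigma_{u_{k-1}})}\,r(u_k).$$ *)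

theory Defs
  imports "HOL-Probability.Probability" "HOL-Algebra.Group"
begin

text \<open>
  The letter \<open>(i, g)\<close> stands for the element \<open>g\<close> of the factor \<open>G i\<close>, so that the
  alphabets of different factors are disjoint by construction.
\<close>

definition letters_of :: "('i \<Rightarrow> ('a, 'b) monoid_scheme) \<Rightarrow> 'i \<Rightarrow> ('i \<times> 'a) set" where
  "letters_of G i = {i} \<times> (carrier (G i) - {\<one>\<^bsub>G i\<^esub>})"

definition letters :: "'i set \<Rightarrow> ('i \<Rightarrow> ('a, 'b) monoid_scheme) \<Rightarrow> ('i \<times> 'a) set" where
  "letters I G = (\<Union>i\<in>I. letters_of G i)"

definition reduced_words :: "'i set \<Rightarrow> ('i \<Rightarrow> ('a, 'b) monoid_scheme) \<Rightarrow> ('i \<times> 'a) list set" where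
  "reduced_words I G = {w. set w \<subseteq> letters I G \<and> successively (\<lambda>u v. fst u \<noteq> fst v) w}"

definition infinite_reduced_words ::
    "'i set \<Rightarrow> ('i \<Rightarrow> ('a, 'b) monoid_scheme) \<Rightarrow> ('i \<times> 'a) stream set" where
  "infinite_reduced_words I G = {\<xi>. \<forall>n. stake n \<xi> \<in> reduced_words I G}"

fun letter_times ::
    "('i \<Rightarrow> ('a, 'b) monoid_scheme) \<Rightarrow> 'i \<times> 'a \<Rightarrow> ('i \<times> 'a) list \<Rightarrow> ('i \<times> 'a) list" where
  "letter_times G (i, g) [] = [(i, g)]"
| "letter_times G (i, g) ((j, h) # w) =
     (if i \<noteq> j then (i, g) # (j, h) # w
      else if g \<otimes>\<^bsub>G i\<^esub> h = \<one>\<^bsub>G i\<^esub> then w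
      else (i, g \<otimes>\<^bsub>G i\<^esub> h) # w)"

text \<open>
  Elements of the free product are identified with reduced words; the product multiplies the
  letters of the first word, from right to left, onto the second word.
\<close>

definition free_product ::
    "'i set \<Rightarrow> ('i \<Rightarrow> ('a, 'b) monoid_scheme) \<Rightarrow> ('i \<times> 'a) list monoid" where
  "free_product I G =
     \<lparr>carrier = reduced_words I G, mult = foldr (letter_times G), one = []\<rparr>"

definition letter_inv :: "('i \<Rightarrow> ('a, 'b) monoid_scheme) \<Rightarrow> 'i \<times> 'a \<Rightarrow> 'i \<times> 'a" where
  "letter_inv G u = (fst u, inv\<^bsub>G (fst u)\<^esub> snd u)"

lemma letters_iff:
  "(i, g) \<in> letters I G \<longleftrightarrow> i \<in> I \<and> g \<in> carrier (G i) \<and> g \<noteq> \<one>\<^bsub>G i\<^esub>"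
  by (auto simp: letters_def letters_of_def)

lemma reduced_Nil [simp]: "[] \<in> reduced_words I G"
  by (simp add: reduced_words_def)

lemma reduced_Cons:
  "u # w \<in> reduced_words I G \<longleftrightarrow>
     u \<in> letters I G \<and> w \<in> reduced_words I G \<and> (w \<noteq> [] \<longrightarrow> fst u \<noteq> fst (hd w))"
  by (cases w) (auto simp: reduced_words_def)

lemma letter_times_reduced:
  assumes "\<forall>i\<in>I. group (G i)" "u \<in> letters I G" "w \<in> reduced_words I G"
  shows "letter_times G u w \<in> reduced_words I G"
proof (cases u)
  case (Pair i g)
  show ?thesis
  proof (cases w)
    case Nil
    then show ?thesis using assms Pair by (simp add: reduced_Cons)
  next
    case (Cons v w')
    obtain j h where v: "v = (j, h)" by (cases v)
    interpret group "G i" using assms Pair by (auto simp: letters_iff)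
    show ?thesis
      using assms Pair Cons v by (auto simp: reduced_Cons letters_iff group_def intro!: monoid.m_closed)
  qed
qed

lemma foldr_reduced:
  assumes "\<forall>i\<in>I. group (G i)" "set u \<subseteq> letters I G" "w \<in> reduced_words I G"
  shows "foldr (letter_times G) u w \<in> reduced_words I G"
  using assms(2) by (induction u) (use assms in \<open>auto intro: letter_times_reduced\<close>)

lemma letter_times_twice:
  assumes grp: "\<forall>i\<in>I. group (G i)" and w: "w \<in> reduced_words I G"
    and "(i, g) \<in> letters I G" "(i, h) \<in> letters I G"
  shows "letter_times G (i, g) (letter_times G (i, h) w) =
         (if g \<otimes>\<^bsub>G i\<^esub> h = \<one>\<^bsub>G i\<^esub> then w
          else letter_times G (i, g \<otimes>\<^bsub>G i\<^esub> h) w)"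
proof -
  interpret group "G i" using assms by (auto simp: letters_iff)
  have g: "g \<in> carrier (G i)" "h \<in> carrier (G i)" "g \<noteq> \<one>\<^bsub>G i\<^esub>"
    using assms by (auto simp: letters_iff)
  show ?thesis
  proof (cases w)
    case Nil
    then show ?thesis using g by simp
  next
    case (Cons v w')
    obtain j k where v: "v = (j, k)" by (cases v)
    show ?thesis
    proof (cases "j = i")
      case False
      then show ?thesis using g Cons v by simp
    next
      case True
      have k: "k \<in> carrier (G i)" "k \<noteq> \<one>\<^bsub>G i\<^esub>"
        using w Cons v True by (auto simp: reduced_Cons letters_iff)
      have assoc: "g \<otimes>\<^bsub>G i\<^esub> h \<otimes>\<^bsub>G i\<^esub> k = g \<otimes>\<^bsub>G i\<^esub> (h \<otimes>\<^bsub>G i\<^esub> k)"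
        using g k by (simp add: m_assoc)
      have hd: "w' \<noteq> [] \<Longrightarrow> fst (hd w') \<noteq> i"
        using w Cons v True by (auto simp: reduced_Cons)
      have w': "letter_times G (i, g) w' = (i, g) # w'"
        using hd by (cases w') auto
      show ?thesis
      proof (cases "h \<otimes>\<^bsub>G i\<^esub> k = \<one>\<^bsub>G i\<^esub>")
        case hk: True
        have "g \<otimes>\<^bsub>G i\<^esub> h \<otimes>\<^bsub>G i\<^esub> k = g" using assoc hk g by simp
        moreover have "g = k" if "g \<otimes>\<^bsub>G i\<^esub> h = \<one>\<^bsub>G i\<^esub>"
          using calculation that k by simp
        ultimately show ?thesis using True Cons v hk w' g by auto
      next
        case hk: False
        then show ?thesis
          using True Cons v assoc g k by (auto simp: m_assoc[symmetric])
      qed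
    qed
  qed
qed

lemma foldr_letter_times:
  assumes grp: "\<forall>i\<in>I. group (G i)" and "u \<in> letters I G"
    and "v \<in> reduced_words I G" "w \<in> reduced_words I G"
  shows "foldr (letter_times G) (letter_times G u v) w =
         letter_times G u (foldr (letter_times G) v w)"
proof (cases u)
  case (Pair i g)
  show ?thesis
  proof (cases v)
    case Nil
    then show ?thesis using Pair by simp
  next
    case (Cons x v')
    obtain j h where x: "x = (j, h)" by (cases x)
    have v': "set v' \<subseteq> letters I G" using assms Cons by (auto simp: reduced_words_def)
    have xl: "(j, h) \<in> letters I G" using assms Cons x by (auto simp: reduced_Cons)
    show ?thesis
    proof (cases "i = j")
      case True
      then show ?thesis
        using letter_times_twice[OF grp foldr_reduced[OF grp v' \<open>w \<in> reduced_words I G\<close>], of i g h]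
          assms Pair Cons x xl by simp
    next
      case False
      then show ?thesis using Pair Cons x by simp
    qed
  qed
qed

lemma foldr_assoc:
  assumes grp: "\<forall>i\<in>I. group (G i)" and u: "set u \<subseteq> letters I G"
    and v: "v \<in> reduced_words I G" and w: "w \<in> reduced_words I G"
  shows "foldr (letter_times G) (foldr (letter_times G) u v) w =
         foldr (letter_times G) u (foldr (letter_times G) v w)"
  using u
proof (induction u)
  case (Cons x u)
  then show ?case
    using foldr_letter_times[OF grp _ foldr_reduced[OF grp _ v] w, of x u] by simp
qed simp

lemma foldr_reduced_Nil:
  "u \<in> reduced_words I G \<Longrightarrow> foldr (letter_times G) u [] = u"
proof (induction u)
  case (Cons x u)
  then show ?case by (cases x; cases u) (auto simp: reduced_Cons)
qed simp

lemma letter_inv_in: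
  assumes "\<forall>i\<in>I. group (G i)" "u \<in> letters I G"
  shows "letter_inv G u \<in> letters I G"
proof (cases u)
  case (Pair i g)
  interpret group "G i" using assms Pair by (auto simp: letters_iff)
  show ?thesis using assms Pair by (auto simp: letters_iff letter_inv_def inv_eq_1_iff)
qed

lemma letter_inv_times:
  assumes grp: "\<forall>i\<in>I. group (G i)" and u: "u \<in> letters I G" and w: "w \<in> reduced_words I G"
  shows "letter_times G (letter_inv G u) (letter_times G u w) = w"
proof (cases u)
  case (Pair i g)
  interpret group "G i" using assms Pair by (auto simp: letters_iff)
  show ?thesis
    using letter_times_twice[OF grp w, of i "inv\<^bsub>G i\<^esub> g" g] letter_inv_in[OF grp u] u Pair
    by (auto simp: letter_inv_def letters_iff)
qed

theorem group_free_product: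
  assumes grp: "\<forall>i\<in>I. group (G i)"
  shows "group (free_product I G)"
proof (rule groupI)
  have sub: "set u \<subseteq> letters I G" if "u \<in> reduced_words I G" for u
    using that by (simp add: reduced_words_def)
  fix x y z
  assume "x \<in> carrier (free_product I G)" "y \<in> carrier (free_product I G)"
  then show "x \<otimes>\<^bsub>free_product I G\<^esub> y \<in> carrier (free_product I G)"
    using foldr_reduced[OF grp] sub by (simp add: free_product_def)
next
  fix x y z
  assume "x \<in> carrier (free_product I G)" "y \<in> carrier (free_product I G)"
    "z \<in> carrier (free_product I G)"
  then show "x \<otimes>\<^bsub>free_product I G\<^esub> y \<otimes>\<^bsub>free_product I G\<^esub> z =
      x \<otimes>\<^bsub>free_product I G\<^esub> (y \<otimes>\<^bsub>free_product I G\<^esub> z)"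
    using foldr_assoc[OF grp] by (simp add: free_product_def reduced_words_def)
next
  fix x
  assume "x \<in> carrier (free_product I G)"
  then have "x \<in> reduced_words I G" by (simp add: free_product_def)
  then have "\<exists>y\<in>reduced_words I G. foldr (letter_times G) y x = []"
  proof (induction x)
    case (Cons u x)
    then obtain y where y: "y \<in> reduced_words I G" "foldr (letter_times G) y x = []"
      by (auto simp: reduced_Cons)
    have u: "u \<in> letters I G" "x \<in> reduced_words I G" "letter_times G u x = u # x"
      using Cons.prems by (cases u; cases x; auto simp: reduced_Cons)+
    define u' where "u' = letter_inv G u"
    have u': "u' \<in> letters I G" using letter_inv_in[OF grp u(1)] by (simp add: u'_def)
    have 1: "[u'] \<in> reduced_words I G" using u' by (simp add: reduced_Cons)
    have "foldr (letter_times G) (foldr (letter_times G) y [u']) (u # x) =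
          foldr (letter_times G) y (foldr (letter_times G) [u'] (u # x))"
      using foldr_assoc[OF grp _ 1 Cons.prems, of y] y(1) by (simp add: reduced_words_def)
    also have "foldr (letter_times G) [u'] (u # x) = x"
      using letter_inv_times[OF grp u(1,2)] u(3) by (simp add: u'_def)
    finally have "foldr (letter_times G) (foldr (letter_times G) y [u']) (u # x) = []"
      using y(2) by simp
    moreover have "foldr (letter_times G) y [u'] \<in> reduced_words I G"
      using foldr_reduced[OF grp _ 1, of y] y(1) by (simp add: reduced_words_def)
    ultimately show ?case by blast
  qed (auto intro: bexI[of _ "[]"])
  then show "\<exists>y\<in>carrier (free_product I G). y \<otimes>\<^bsub>free_product I G\<^esub> x = \<one>\<^bsub>free_product I G\<^esub>"
    by (simp add: free_product_def)
qed (auto simp: free_product_def)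

lemma inv_letter:
  assumes grp: "\<forall>i\<in>I. group (G i)" and u: "u \<in> letters I G"
  shows "inv\<^bsub>free_product I G\<^esub> [u] = [letter_inv G u]"
proof -
  interpret F: group "free_product I G" by (rule group_free_product[OF grp])
  have "letter_times G u [] = [u]" by (cases u) simp
  then have "[letter_inv G u] \<otimes>\<^bsub>free_product I G\<^esub> [u] = \<one>\<^bsub>free_product I G\<^esub>"
    using letter_inv_times[OF grp u, of "[]"] by (simp add: free_product_def)
  then show ?thesis
    using F.inv_equality[of "[letter_inv G u]" "[u]"] u letter_inv_in[OF grp u]
    by (simp add: free_product_def reduced_Cons)
qed

definition group_convolution :: "('g, 'c) monoid_scheme \<Rightarrow> 'g pmf \<Rightarrow> 'g pmf \<Rightarrow> 'g pmf" where
  "group_convolution H p q = map_pmf (\<lambda>(x, y). x \<otimes>\<^bsub>H\<^esub> y) (pair_pmf p q)"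

primrec group_convolution_power :: "('g, 'c) monoid_scheme \<Rightarrow> 'g pmf \<Rightarrow> nat \<Rightarrow> 'g pmf" where
  "group_convolution_power H p 0 = return_pmf \<one>\<^bsub>H\<^esub>"
| "group_convolution_power H p (Suc n) = group_convolution H (group_convolution_power H p n) p"

text \<open>
  The increments are taken in the alphabet itself rather than in the whole type of letters,
  so that every function of finitely many increments is measurable even if that type is
  uncountable.
\<close>

definition increments ::
    "'i set \<Rightarrow> ('i \<Rightarrow> ('a, 'b) monoid_scheme) \<Rightarrow> ('i \<times> 'a) pmf \<Rightarrow> ('i \<times> 'a) stream measure" where
  "increments I G \<mu> = stream_space (restrict_space (measure_pmf \<mu>) (letters I G))"

primrec walk ::
    "'i set \<Rightarrow> ('i \<Rightarrow> ('a, 'b) monoid_scheme) \<Rightarrow> nat \<Rightarrow> ('i \<times> 'a) stream \<Rightarrow> ('i \<times> 'a) list" where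
  "walk I G 0 \<omega> = \<one>\<^bsub>free_product I G\<^esub>"
| "walk I G (Suc n) \<omega> = walk I G n \<omega> \<otimes>\<^bsub>free_product I G\<^esub> [\<omega> !! n]"

definition transient ::
    "'i set \<Rightarrow> ('i \<Rightarrow> ('a, 'b) monoid_scheme) \<Rightarrow> ('i \<times> 'a) pmf \<Rightarrow> bool" where
  "transient I G \<mu> \<longleftrightarrow>
     measure (increments I G \<mu>)
       {\<omega> \<in> space (increments I G \<mu>). \<exists>n\<ge>1. walk I G n \<omega> = \<one>\<^bsub>free_product I G\<^esub>} < 1"

definition common_prefix_length :: "'c list \<Rightarrow> 'c stream \<Rightarrow> nat" where
  "common_prefix_length w \<xi> = Max {k. k \<le> length w \<and> take k w = stake k \<xi>}"

definition walk_converges ::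
    "'i set \<Rightarrow> ('i \<Rightarrow> ('a, 'b) monoid_scheme) \<Rightarrow> ('i \<times> 'a) stream \<Rightarrow> ('i \<times> 'a) stream \<Rightarrow> bool" where
  "walk_converges I G \<omega> \<xi> \<longleftrightarrow>
     \<xi> \<in> infinite_reduced_words I G \<and>
     filterlim (\<lambda>n. common_prefix_length (walk I G n \<omega>) \<xi>) at_top sequentially"

text \<open>
  The limit word is unique where it exists, which for a transient walk is almost everywhere;
  elsewhere an arbitrary constant word is used.
\<close>

definition walk_limit ::
    "'i set \<Rightarrow> ('i \<Rightarrow> ('a, 'b) monoid_scheme) \<Rightarrow> ('i \<times> 'a) stream \<Rightarrow> ('i \<times> 'a) stream" where
  "walk_limit I G \<omega> =
     (if \<exists>\<xi>. walk_converges I G \<omega> \<xi> then THE \<xi>. walk_converges I G \<omega> \<xi>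
      else SOME \<xi>. \<xi> \<in> infinite_reduced_words I G)"

definition harmonic_measure ::
    "'i set \<Rightarrow> ('i \<Rightarrow> ('a, 'b) monoid_scheme) \<Rightarrow> ('i \<times> 'a) pmf \<Rightarrow> ('i \<times> 'a) stream measure" where
  "harmonic_measure I G \<mu> =
     distr (increments I G \<mu>) (stream_space (count_space (letters I G))) (walk_limit I G)"

definition open_simplex :: "'c set \<Rightarrow> ('c \<Rightarrow> real) set" where
  "open_simplex S = {x. (\<forall>u\<in>S. x u > 0) \<and> sum x S = 1}"

text \<open>
  \<^term>\<open>sstart S u\<close> is the cylinder of the infinite words over \<^term>\<open>S\<close> that have prefix \<^term>\<open>u\<close>.
\<close>

definition markovian_multiplicative ::
    "'i set \<Rightarrow> ('i \<Rightarrow> ('a, 'b) monoid_scheme) \<Rightarrow> ('i \<times> 'a \<Rightarrow> real) \<Rightarrow>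
     ('i \<times> 'a) stream measure \<Rightarrow> bool" where
  "markovian_multiplicative I G r \<nu> \<longleftrightarrow>
     sets \<nu> = sets (stream_space (count_space (letters I G))) \<and>
     prob_space \<nu> \<and>
     (AE \<xi> in \<nu>. \<xi> \<in> infinite_reduced_words I G) \<and>
     (\<forall>u\<in>reduced_words I G. u \<noteq> [] \<longrightarrow>
        measure \<nu> (sstart (letters I G) u) =
          (\<Prod>j<length u - 1. r (u ! j) / sum r (letters I G - letters_of G (fst (u ! j))))
            * r (last u))"

definition shift_stationary :: "'c stream measure \<Rightarrow> bool" where
  "shift_stationary \<nu> \<longleftrightarrow> distr \<nu> \<nu> stl = \<nu>"

definition shift_ergodic :: "'c stream measure \<Rightarrow> bool" where
  "shift_ergodic \<nu> \<longleftrightarrow>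
     (\<forall>A\<in>sets \<nu>. stl -` A \<inter> space \<nu> = A \<longrightarrow> measure \<nu> A = 0 \<or> measure \<nu> A = 1)"

definition stationary_traffic_equations ::
    "'i set \<Rightarrow> ('i \<Rightarrow> ('a, 'b) monoid_scheme) \<Rightarrow> ('i \<times> 'a) pmf \<Rightarrow> ('i \<times> 'a \<Rightarrow> real) \<Rightarrow> bool" where
  "stationary_traffic_equations I G \<mu> r \<longleftrightarrow>
     (\<forall>a\<in>letters I G.
        r a = pmf \<mu> a * ((real (card I) - 1) / real (card I))
          + (\<Sum>(u, v) \<in> {(u, v). u \<in> letters I G \<and> v \<in> letters I G \<and>
                                 [u] \<otimes>\<^bsub>free_product I G\<^esub> [v] = [a]}. pmf \<mu> u * r v)
          + r a * (real (card I) / (real (card I) - 1))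
              * (\<Sum>u \<in> letters I G - letters_of G (fst a). pmf \<mu> (letter_inv G u) * r u))"

end

theory Submission
  imports Defs
begin

text \<open>
  By transience the walk converges to an infinite word, and the limit of the walk is the first
  increment applied to the limit of the shifted walk, so the harmonic measure is stationary under
  the action of the group on infinite words. If it is Markovian multiplicative and invariant under
  the shift, the masses \<open>R\<^sub>i\<close> of the factors satisfy \<open>\<Sum>j\<noteq>i. R\<^sub>j / (1 - R\<^sub>j) = 1\<close> for every
  \<open>i\<close>, hence are all equal to \<open>1/|I|\<close>, and stationarity on the cylinder of a letter \<open>a\<close> is then the
  equation at \<open>a\<close>. Conversely, a solution of the equations has equal factor masses by a convexity
  argument, so the Markov measure \<open>\<nu>\<^sub>0\<close> it defines is shift-invariant, ergodic, and stationary under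
  the group. For a word \<open>w\<close> the function \<open>g \<mapsto> \<nu>\<^sub>0 {\<xi>. g \<xi> starts with w}\<close> is harmonic and
  converges along the walk to the indicator of the limit starting with \<open>w\<close>, because long cylinders
  are small; integrating, \<open>\<nu>\<^sub>0\<close> is the harmonic measure.
\<close>

section \<open>The action of words on infinite words\<close>

text \<open>Equal factor masses are the pivot of both directions. They turn every normalisation 1 -
  R_i into the same number (k-1)/k, with k = |I|, which is where the constants of the equations come
  from, and they make the law of what follows a letter depend only on the factor of that letter.
  Stationarity on the cylinder of \<open>a # w\<close> is then stationarity at \<open>a\<close>
  times a common factor, so finitely many equations on letters control all cylinders. That the walk
  generates the group enters through a letter of positive \<open>\<mu>\<close>-mass in every factor.
  The limit along the walk can be computed path by path: cancellation in g \<xi> reaches the first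
  letters of a long g only if \<xi> begins with the inverse of a long suffix of g. Dominated
  convergence then does the work of martingale convergence. The obstacle is the smallness of long
  cylinders. A single step of the Markov chain may have probability one, so decay is measured over
  two consecutive letters. It fails only if two letters of different factors both have conditional
  probability one; this forces a two-letter alphabet, which is settled by direct
  computation.\<close>

definition stream_times ::
    "('i \<Rightarrow> ('a, 'b) monoid_scheme) \<Rightarrow> 'i \<times> 'a \<Rightarrow> ('i \<times> 'a) stream \<Rightarrow> ('i \<times> 'a) stream" where
  "stream_times G u \<xi> =
     (if fst u \<noteq> fst (shd \<xi>) then u ## \<xi>
      else if snd u \<otimes>\<^bsub>G (fst u)\<^esub> snd (shd \<xi>) = \<one>\<^bsub>G (fst u)\<^esub> then stl \<xi>
      else (fst u, snd u \<otimes>\<^bsub>G (fst u)\<^esub> snd (shd \<xi>)) ## stl \<xi>)"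

text \<open>Being reduced is a condition on neighbouring letters, so prepending a letter adds one
  condition, at the junction.\<close>

lemma infinite_reduced_Stream:
  "u ## \<xi> \<in> infinite_reduced_words I G \<longleftrightarrow>
     u \<in> letters I G \<and> \<xi> \<in> infinite_reduced_words I G \<and> fst u \<noteq> fst (shd \<xi>)"
proof -
  \<comment> \<open>Prefixes of length at least two suffice, since shorter ones are prefixes of
    them, and from that length on both \<open>u\<close> and the head of \<open>\<xi>\<close> are
    visible.\<close>
  have "(\<forall>n. stake n (u ## \<xi>) \<in> reduced_words I G) \<longleftrightarrow>
        (\<forall>n. stake (Suc (Suc n)) (u ## \<xi>) \<in> reduced_words I G)"
  proof (intro iffI allI)
    fix n assume "\<forall>n. stake n (u ## \<xi>) \<in> reduced_words I G"
    then show "stake (Suc (Suc n)) (u ## \<xi>) \<in> reduced_words I G" by blast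
  next
    fix n assume *: "\<forall>n. stake (Suc (Suc n)) (u ## \<xi>) \<in> reduced_words I G"
    have "stake n (u ## \<xi>) = take n (stake (Suc (Suc n)) (u ## \<xi>))"
      by (simp add: take_stake min_def del: stake.simps)
    moreover have "take n w \<in> reduced_words I G" if "w \<in> reduced_words I G" for w
      using that successively_append_iff[of _ "take n w" "drop n w"]
      by (auto simp: reduced_words_def dest: in_set_takeD)
    ultimately show "stake n (u ## \<xi>) \<in> reduced_words I G" using * by metis
  qed
  also have "\<dots> \<longleftrightarrow> u \<in> letters I G \<and> fst u \<noteq> fst (shd \<xi>) \<and>
      (\<forall>n. stake (Suc n) \<xi> \<in> reduced_words I G)"
    by (auto simp: reduced_Cons)
  also have "(\<forall>n. stake (Suc n) \<xi> \<in> reduced_words I G) \<longleftrightarrow>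
      (\<forall>n. stake n \<xi> \<in> reduced_words I G)"
    by (metis not0_implies_Suc reduced_Nil stake.simps(1))
  finally show ?thesis by (auto simp: infinite_reduced_words_def)
qed

lemma infinite_reduced_iff:
  "\<xi> \<in> infinite_reduced_words I G \<longleftrightarrow>
     shd \<xi> \<in> letters I G \<and> stl \<xi> \<in> infinite_reduced_words I G \<and> fst (shd \<xi>) \<noteq> fst (shd (stl \<xi>))"
  using infinite_reduced_Stream[of "shd \<xi>" "stl \<xi>"] by simp

lemma infinite_reduced_in_streams:
  assumes "\<xi> \<in> infinite_reduced_words I G" shows "\<xi> \<in> streams (letters I G)"
  using assms
proof (coinduction arbitrary: \<xi>)
  case streams
  then show ?case
    using infinite_reduced_iff[of \<xi> I G] by (intro exI[of _ "shd \<xi>"] exI[of _ "stl \<xi>"]) simp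
qed

lemma sdrop_infinite_reduced:
  "\<xi> \<in> infinite_reduced_words I G \<Longrightarrow> sdrop n \<xi> \<in> infinite_reduced_words I G"
  by (induction n arbitrary: \<xi>) (auto dest: infinite_reduced_iff[THEN iffD1])

lemma in_sstart_iff_stake:
  "\<xi> \<in> streams S \<Longrightarrow> \<xi> \<in> sstart S w \<longleftrightarrow> stake (length w) \<xi> = w"
  by (induction w arbitrary: \<xi>) (auto simp: streams_stl)

lemma stream_times_reduced:
  assumes grp: "\<forall>i\<in>I. group (G i)" and u: "u \<in> letters I G"
    and x: "\<xi> \<in> infinite_reduced_words I G"
  shows "stream_times G u \<xi> \<in> infinite_reduced_words I G"
proof -
  have x': "shd \<xi> \<in> letters I G" "stl \<xi> \<in> infinite_reduced_words I G"
    "fst (shd \<xi>) \<noteq> fst (shd (stl \<xi>))"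
    using x infinite_reduced_iff[of \<xi> I G] by auto
  obtain i g j h where e: "u = (i, g)" "shd \<xi> = (j, h)" by (metis surj_pair)
  interpret group "G i" using assms e by (auto simp: letters_iff)
  show ?thesis
    using x x' e u m_closed[of g h]
    by (cases "i = j") (auto simp: stream_times_def infinite_reduced_Stream letters_iff)
qed

lemma foldr_stream_times_reduced:
  assumes grp: "\<forall>i\<in>I. group (G i)" and "set g \<subseteq> letters I G"
    and "\<xi> \<in> infinite_reduced_words I G"
  shows "foldr (stream_times G) g \<xi> \<in> infinite_reduced_words I G"
  using assms(2) by (induction g) (auto intro: stream_times_reduced[OF grp] assms(3))

text \<open>Associativity inside one factor. The delicate case is \<open>h\<close> cancelling the
  head \<open>k\<close>: then \<open>g\<close> is prepended, in agreement with
  \<open>g h k = g\<close>; if also \<open>g h = 1\<close>, then \<open>g = k\<close> and the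
  original word is restored.\<close>

lemma stream_times_twice:
  assumes grp: "\<forall>i\<in>I. group (G i)" and x: "\<xi> \<in> infinite_reduced_words I G"
    and gl: "(i, g) \<in> letters I G" and hl: "(i, h) \<in> letters I G"
  shows "stream_times G (i, g) (stream_times G (i, h) \<xi>) =
         (if g \<otimes>\<^bsub>G i\<^esub> h = \<one>\<^bsub>G i\<^esub> then \<xi>
          else stream_times G (i, g \<otimes>\<^bsub>G i\<^esub> h) \<xi>)"
proof -
  interpret group "G i" using assms by (auto simp: letters_iff)
  have g: "g \<in> carrier (G i)" "h \<in> carrier (G i)" "g \<noteq> \<one>\<^bsub>G i\<^esub>"
    using gl hl by (auto simp: letters_iff)
  obtain j k \<eta> where \<xi>: "\<xi> = (j, k) ## \<eta>" by (metis stream.exhaust surj_pair)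
  show ?thesis
  proof (cases "j = i")
    case False
    then show ?thesis using \<xi> g by (simp add: stream_times_def)
  next
    case True
    have k: "k \<in> carrier (G i)" "k \<noteq> \<one>\<^bsub>G i\<^esub>" "fst (shd \<eta>) \<noteq> i"
      using x \<xi> True by (auto simp: infinite_reduced_Stream letters_iff)
    have assoc: "g \<otimes>\<^bsub>G i\<^esub> h \<otimes>\<^bsub>G i\<^esub> k = g \<otimes>\<^bsub>G i\<^esub> (h \<otimes>\<^bsub>G i\<^esub> k)"
      using g k by (simp add: m_assoc)
    show ?thesis
    proof (cases "h \<otimes>\<^bsub>G i\<^esub> k = \<one>\<^bsub>G i\<^esub>")
      case hk: True
      have "g \<otimes>\<^bsub>G i\<^esub> h \<otimes>\<^bsub>G i\<^esub> k = g" using assoc hk g by simp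
      moreover have "g = k" if "g \<otimes>\<^bsub>G i\<^esub> h = \<one>\<^bsub>G i\<^esub>"
        using calculation that k by simp
      ultimately show ?thesis using True \<xi> hk g k by (auto simp: stream_times_def)
    next
      case hk: False
      then show ?thesis
        using True \<xi> assoc g k by (auto simp: stream_times_def)
    qed
  qed
qed

lemma foldr_stream_times:
  assumes grp: "\<forall>i\<in>I. group (G i)" and u: "u \<in> letters I G"
    and v: "v \<in> reduced_words I G" and x: "\<xi> \<in> infinite_reduced_words I G"
  shows "foldr (stream_times G) (letter_times G u v) \<xi> =
         stream_times G u (foldr (stream_times G) v \<xi>)"
proof (cases v)
  case Nil
  then show ?thesis by (cases u) simp
next
  case (Cons y v')
  obtain i g j h where e: "u = (i, g)" "y = (j, h)" by (metis surj_pair)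
  have v': "set v' \<subseteq> letters I G" using v Cons by (auto simp: reduced_words_def)
  have yl: "(j, h) \<in> letters I G" using v Cons e by (auto simp: reduced_Cons)
  show ?thesis
    using stream_times_twice[OF grp foldr_stream_times_reduced[OF grp v' x], of i g h] u yl e Cons
    by (cases "i = j") auto
qed

text \<open>The walk grows on the right, so this is the form of the action law in which one more
  increment acts first on the infinite word.\<close>

lemma foldr_stream_times_snoc:
  assumes grp: "\<forall>i\<in>I. group (G i)" and u: "u \<in> letters I G"
    and "set g \<subseteq> letters I G" and x: "\<xi> \<in> infinite_reduced_words I G"
  shows "foldr (stream_times G) (foldr (letter_times G) g [u]) \<xi> =
         foldr (stream_times G) g (stream_times G u \<xi>)"
  using assms(3)
proof (induction g)
  case (Cons y g)
  then have "foldr (letter_times G) g [u] \<in> reduced_words I G"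
    by (intro foldr_reduced[OF grp]) (auto simp: reduced_Cons u)
  with Cons show ?case by (simp add: foldr_stream_times[OF grp _ _ x])
qed simp

text \<open>Left multiplication by a letter alters the head only and shifts the rest by at most one
  place, so agreement on \<open>m + 2\<close> letters leaves agreement on at least
  \<open>m\<close>.\<close>

lemma take_letter_times:
  assumes "length w \<ge> m + 2" and "take (m + 2) w = stake (m + 2) \<xi>"
  shows "take m (letter_times G u w) = stake m (stream_times G u \<xi>) \<and>
    length (letter_times G u w) \<ge> m"
proof -
  obtain i g where u: "u = (i, g)" by (metis surj_pair)
  obtain j h y w' where w: "w = (j, h) # y # w'"
    using assms(1) by (cases w; cases "tl w") auto
  obtain k z \<eta> where x: "\<xi> = k ## z ## \<eta>" by (metis stream.collapse)
  have k: "k = (j, h)" "z = y" and t: "take m w' = stake m \<eta>"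
    using assms(2) w x by auto
  have 1: "take (m - n) w' = stake (m - n) \<eta>" for n
    using t by (metis diff_le_self min.absorb1 take_stake take_take)
  have 3: "stake n (x ## \<zeta>) = (if n = 0 then [] else x # stake (n - 1) \<zeta>)" for n and x :: "'a \<times> 'b" and \<zeta>
    by (cases n) auto
  show ?thesis
    using assms(1) 1 u w x k by (auto simp: stream_times_def 3 take_Cons')
qed

lemma foldr_stream_times_cancel:
  assumes grp: "\<forall>i\<in>I. group (G i)" and "set h \<subseteq> letters I G"
    and "stake (length h) \<xi> = rev (map (letter_inv G) h)"
  shows "foldr (stream_times G) h \<xi> = sdrop (length h) \<xi>"
  using assms(2,3)
proof (induction h)
  case (Cons y h)
  obtain i g where y: "y = (i, g)" by (metis surj_pair)
  interpret group "G i" using Cons grp y by (auto simp: letters_iff)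
  have "stake (length h) \<xi> @ [\<xi> !! length h] = rev (map (letter_inv G) h) @ [letter_inv G y]"
    using Cons.prems(2) by (simp add: stake_Suc del: stake.simps)
  then have 1: "stake (length h) \<xi> = rev (map (letter_inv G) h)" "\<xi> !! length h = letter_inv G y"
    by auto
  have "shd (sdrop (length h) \<xi>) = letter_inv G y" using 1 by simp
  then show ?case
    using Cons 1 y
    by (simp add: stream_times_def letter_inv_def letters_iff sdrop_stl flip: sdrop_simps(2))
qed simp

text \<open>Cancellation consumes \<open>h\<close> from its last letter, and eats the first one only
  if \<open>\<xi>\<close> starts with the whole inverse of \<open>h\<close>. In the induction,
  either the rest of \<open>h\<close> cancels completely and the first letter survives, possibly
  merged, or the rest leaves a head in its own factor and the first letter is simply
  prepended.\<close>

lemma shd_foldr_stream_times: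
  assumes grp: "\<forall>i\<in>I. group (G i)" and "h \<in> reduced_words I G" "h \<noteq> []"
    and x: "\<xi> \<in> infinite_reduced_words I G"
    and "stake (length h) \<xi> \<noteq> rev (map (letter_inv G) h)"
  shows "fst (shd (foldr (stream_times G) h \<xi>)) = fst (hd h)"
  using assms(2,3,5)
proof (induction h)
  case (Cons y h)
  obtain i g where y: "y = (i, g)" by (metis surj_pair)
  interpret group "G i" using Cons grp y by (auto simp: letters_iff reduced_Cons)
  define \<eta> where "\<eta> = foldr (stream_times G) h \<xi>"
  have h: "set h \<subseteq> letters I G" "h \<in> reduced_words I G"
    using Cons.prems by (auto simp: reduced_words_def reduced_Cons successively_Cons)
  have \<eta>': "foldr (stream_times G) (y # h) \<xi> = stream_times G y \<eta>" by (simp add: \<eta>_def)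
  show ?case
  proof (cases "stake (length h) \<xi> = rev (map (letter_inv G) h)")
    case False
    then have "h \<noteq> []" by auto
    then have "fst (shd \<eta>) = fst (hd h)" using Cons.IH h False by (simp add: \<eta>_def)
    then show ?thesis
      using Cons.prems \<open>h \<noteq> []\<close> unfolding \<eta>' by (simp add: stream_times_def reduced_Cons)
  next
    case True
    then have \<eta>: "\<eta> = sdrop (length h) \<xi>"
      using foldr_stream_times_cancel[OF grp h(1)] by (simp add: \<eta>_def)
    have "\<eta> \<in> infinite_reduced_words I G"
      unfolding \<eta> by (rule sdrop_infinite_reduced[OF x])
    then have s: "shd \<eta> = \<xi> !! length h" "shd \<eta> \<in> letters I G"
      by (simp add: \<eta>, blast dest: infinite_reduced_iff[THEN iffD1])
    have "\<xi> !! length h \<noteq> letter_inv G y"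
      using Cons.prems(3) True by (simp add: stake_Suc del: stake.simps)
    moreover have "shd \<eta> = letter_inv G y"
      if "fst (shd \<eta>) = i" "g \<otimes>\<^bsub>G i\<^esub> snd (shd \<eta>) = \<one>\<^bsub>G i\<^esub>"
    proof -
      have "snd (shd \<eta>) \<in> carrier (G i)" "g \<in> carrier (G i)"
        using that(1) s(2) Cons.prems(1) y
          letters_iff[of "fst (shd \<eta>)" "snd (shd \<eta>)" I G] letters_iff[of i g I G]
        by (auto simp: reduced_Cons simp flip: that(1))
      then have "inv\<^bsub>G i\<^esub> g = snd (shd \<eta>)"
        using inv_equality inv_comm[OF that(2)] by simp
      then show ?thesis using that(1) y by (simp add: letter_inv_def prod_eq_iff)
    qed
    ultimately show ?thesis
      using s y unfolding \<eta>' by (auto simp: stream_times_def)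
  qed
qed simp

text \<open>The head of \<open>\<eta>\<close> may differ from the head of \<open>h\<close> but lies
  in the same factor. As \<open>g @ h\<close> is reduced, no letter of \<open>g\<close> meets its
  own factor.\<close>

lemma foldr_stream_times_prefix:
  assumes "g @ h \<in> reduced_words I G" "h \<noteq> []" "fst (shd \<eta>) = fst (hd h)"
  shows "foldr (stream_times G) g \<eta> = g @- \<eta>"
  using assms(1)
proof (induction g)
  case (Cons y g)
  have "fst y \<noteq> fst (hd (g @ h))" using Cons.prems assms(2) by (auto simp: reduced_Cons)
  moreover have "fst (shd (g @- \<eta>)) = fst (hd (g @ h))" using assms(3) by (cases g) auto
  ultimately show ?case using Cons by (simp add: reduced_Cons stream_times_def)
qed simp

text \<open>Outside the cylinder of the inverse of \<^term>\<open>h\<close>, at most \<^term>\<open>h\<close> is affected by cancellation.\<close>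

lemma stake_foldr_stream_times:
  assumes grp: "\<forall>i\<in>I. group (G i)" and gh: "g @ h \<in> reduced_words I G" "h \<noteq> []"
    and x: "\<xi> \<in> infinite_reduced_words I G"
    and "stake (length h) \<xi> \<noteq> rev (map (letter_inv G) h)"
  shows "stake (length g) (foldr (stream_times G) (g @ h) \<xi>) = g"
proof -
  have "h \<in> reduced_words I G"
    using gh by (auto simp: reduced_words_def successively_append_iff)
  then have "fst (shd (foldr (stream_times G) h \<xi>)) = fst (hd h)"
    using assms by (intro shd_foldr_stream_times) auto
  then show ?thesis
    using foldr_stream_times_prefix[OF gh] by (simp add: stake_shift)
qed

section \<open>Convergence of the walk\<close>

lemma set_stake_subset: "set (stake n \<omega>) \<subseteq> sset \<omega>"
  by (auto simp: in_set_conv_nth)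

lemma sdrop_in_streams: "\<omega> \<in> streams S \<Longrightarrow> sdrop n \<omega> \<in> streams S"
  by (simp add: streams_iff_snth sdrop_snth)

lemma sstart_in_sets:
  assumes "countable S" "w \<in> lists S"
  shows "sstart S w \<in> sets (stream_space (count_space S))"
proof -
  have "sstart S ` lists S \<union> {{}} \<subseteq> Pow (streams S)"
    using sstart_in_streams by fast
  then show ?thesis
    using assms(2) by (simp add: sets_stream_space_sstart[OF assms(1)] sets_measure_of)
qed

text \<open>The event is a union of cylinders of words of length \<open>n\<close>, of which there
  are countably many, so \<open>Q\<close> may be arbitrary. All measurability of the walk comes from
  here.\<close>

lemma measurable_pred_stake:
  assumes "countable S" and "sets M = sets (stream_space (count_space S))"
  shows "Measurable.pred M (\<lambda>\<omega>. Q (stake n \<omega>))"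
proof -
  have sp: "space M = streams S"
    using sets_eq_imp_space_eq[OF assms(2)] by (simp add: space_stream_space)
  have "{\<omega> \<in> space M. Q (stake n \<omega>)} = (\<Union>w\<in>{w\<in>lists S. length w = n \<and> Q w}. sstart S w)"
  proof safe
    fix \<omega> assume "\<omega> \<in> space M" "Q (stake n \<omega>)"
    moreover have "stake n \<omega> \<in> lists S"
      using \<open>\<omega> \<in> space M\<close> set_stake_subset[of n \<omega>] by (auto simp: sp streams_iff_sset)
    ultimately show "\<omega> \<in> (\<Union>w\<in>{w\<in>lists S. length w = n \<and> Q w}. sstart S w)"
      by (auto intro!: bexI[of _ "stake n \<omega>"] simp: in_sstart_iff_stake sp)
  next
    fix \<omega> w assume "\<omega> \<in> sstart S w" "\<forall>x\<in>set w. x \<in> S" "Q w"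
    moreover from this have "\<omega> \<in> streams S" using sstart_in_streams[of w S] by auto
    ultimately show "\<omega> \<in> space M" "Q (stake (length w) \<omega>)"
      by (simp_all add: sp in_sstart_iff_stake)
  qed
  also have "\<dots> \<in> sets M"
    unfolding assms(2)
    by (intro sets.countable_UN'[OF countable_subset[OF _ countable_lists[OF assms(1)]]])
       (auto intro!: sstart_in_sets[OF assms(1)])
  finally show ?thesis by (simp add: pred_def)
qed

text \<open>The set under the maximum is finite and downward closed, hence an initial segment of the
  naturals.\<close>

lemma common_prefix_length_ge_iff:
  "m \<le> common_prefix_length w \<xi> \<longleftrightarrow> m \<le> length w \<and> take m w = stake m \<xi>"
proof -
  let ?K = "{k. k \<le> length w \<and> take k w = stake k \<xi>}"
  have fin: "finite ?K" "?K \<noteq> {}" by (auto intro: finite_subset[of _ "{..length w}"] exI[of _ 0])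
  have "m \<in> ?K" if "k \<in> ?K" "m \<le> k" for k
  proof -
    have "take m (take k w) = take m (stake k \<xi>)" using that by simp
    then show ?thesis using that by (simp add: take_stake min_def)
  qed
  then show ?thesis
    unfolding common_prefix_length_def using Max_ge_iff[OF fin] by blast
qed

lemma stream_eqI_stake: "(\<And>n. stake n \<xi> = stake n \<eta>) \<Longrightarrow> \<xi> = \<eta>"
  by (metis stake_nth lessI stream_smap_nats ext)

lemma walk_converges_iff:
  "walk_converges I G \<omega> \<xi> \<longleftrightarrow> \<xi> \<in> infinite_reduced_words I G \<and>
     (\<forall>m. \<forall>\<^sub>F n in sequentially. m \<le> length (walk I G n \<omega>) \<and> take m (walk I G n \<omega>) = stake m \<xi>)"
  by (simp add: walk_converges_def filterlim_at_top common_prefix_length_ge_iff)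

lemma walk_converges_unique:
  assumes "walk_converges I G \<omega> \<xi>" "walk_converges I G \<omega> \<eta>" shows "\<xi> = \<eta>"
proof (rule stream_eqI_stake)
  fix m
  have "\<forall>\<^sub>F n in sequentially. take m (walk I G n \<omega>) = stake m \<xi>"
    "\<forall>\<^sub>F n in sequentially. take m (walk I G n \<omega>) = stake m \<eta>"
    using assms unfolding walk_converges_iff by (auto elim: eventually_mono)
  then have "\<forall>\<^sub>F n in sequentially. stake m \<xi> = stake m \<eta>"
    by eventually_elim simp
  then show "stake m \<xi> = stake m \<eta>" by simp
qed

lemma walk_limit_eq: "walk_converges I G \<omega> \<xi> \<Longrightarrow> walk_limit I G \<omega> = \<xi>"
  unfolding walk_limit_def by (auto intro: walk_converges_unique)

lemma foldr_letter_times_append: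
  assumes "g @ v \<in> reduced_words I G" shows "foldr (letter_times G) g v = g @ v"
proof -
  have "v \<in> reduced_words I G"
    using assms by (auto simp: reduced_words_def successively_append_iff)
  then show ?thesis using foldr_reduced_Nil[OF assms] foldr_reduced_Nil[of v I G] by simp
qed

text \<open>Right multiplication by a letter disturbs at most the last letter of \<open>w\<close>.
  Hence a prefix of the walk stays frozen as long as the walk is longer than it, and a walk whose
  length tends to infinity converges.\<close>

lemma take_foldr_letter_times_snoc:
  assumes grp: "\<forall>i\<in>I. group (G i)" and w: "w \<in> reduced_words I G" and u: "u \<in> letters I G"
    and k: "k < length w"
  shows "take k (foldr (letter_times G) w [u]) = take k w"
proof -
  obtain g x where gx: "w = g @ [x]" using k by (cases w rule: rev_cases) auto
  have x: "x \<in> letters I G" using w gx by (auto simp: reduced_words_def)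
  \<comment> \<open>The product of the last letter with \<open>u\<close> is empty or starts in the
    factor of \<open>x\<close>, so it still fits behind \<open>g\<close>.\<close>
  define v where "v = letter_times G x [u]"
  have "v \<in> reduced_words I G"
    unfolding v_def using x u by (intro letter_times_reduced[OF grp]) (auto simp: reduced_Cons)
  moreover have "v \<noteq> [] \<Longrightarrow> fst (hd v) = fst x"
    unfolding v_def by (cases x; cases u) auto
  ultimately have "g @ v \<in> reduced_words I G"
    using w gx by (auto simp: reduced_words_def successively_append_iff)
  then have "foldr (letter_times G) w [u] = g @ v"
    using foldr_letter_times_append gx v_def by simp
  then show ?thesis using gx k by simp
qed

section \<open>Free products of finite groups: pathwise convergence of the walk\<close>

locale finite_free_product =
  fixes I :: "'i set" and G :: "'i \<Rightarrow> ('a, 'b) monoid_scheme"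
  assumes finite_index: "finite I" and card_index: "card I \<ge> 2"
    and group_factor: "\<forall>i\<in>I. group (G i)"
    and finite_factor: "\<And>i. i \<in> I \<Longrightarrow> finite (carrier (G i))"
    and nontrivial_factor: "\<And>i. i \<in> I \<Longrightarrow> carrier (G i) \<noteq> {\<one>\<^bsub>G i\<^esub>}"
begin

abbreviation "L \<equiv> letters I G"

lemma finite_letters: "finite L"
  unfolding letters_def letters_of_def using finite_index finite_factor by auto

lemma countable_letters: "countable L"
  using finite_letters by (rule countable_finite)

lemma letters_of_subset: "i \<in> I \<Longrightarrow> letters_of G i \<subseteq> L"
  by (auto simp: letters_def)

lemma letters_of_nonempty: "i \<in> I \<Longrightarrow> letters_of G i \<noteq> {}"
  using nontrivial_factor[of i] group_factor
  by (auto simp: letters_of_def dest!: bspec[of _ _ i] group.is_monoid monoid.one_closed)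

lemma mem_letters_of_iff: "u \<in> L \<Longrightarrow> u \<in> letters_of G i \<longleftrightarrow> fst u = i"
  by (auto simp: letters_def letters_of_def)

text \<open>Makes the default value of \<open>walk_limit\<close> a reduced word, so that
  \<open>walk_limit\<close> is reduced everywhere and not just almost everywhere. The witness
  alternates letters of two different factors.\<close>

lemma infinite_reduced_nonempty: "infinite_reduced_words I G \<noteq> {}"
proof -
  obtain i j where ij: "i \<in> I" "j \<in> I" "i \<noteq> j"
    using card_index card_le_Suc0_iff_eq[OF finite_index] by (metis One_nat_def Suc_1 not_less_eq_eq)
  obtain a b where ab: "a \<in> letters_of G i" "b \<in> letters_of G j"
    using letters_of_nonempty ij by blast
  then have ab': "a \<in> L" "b \<in> L" "fst a \<noteq> fst b"
    using ij letters_of_subset by (auto simp: letters_of_def subset_iff)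
  define x where "x = cycle [a, b]"
  define y where "y = b ## x"
  have x: "x = a ## y" unfolding x_def y_def by (subst cycle_decomp) simp_all
  have "stake n x \<in> reduced_words I G \<and> stake n y \<in> reduced_words I G" for n
  proof (induction n)
    case (Suc n)
    have "stake (Suc n) x = a # stake n y" "stake (Suc n) y = b # stake n x"
      by (simp add: x) (simp add: y_def)
    moreover have "n \<noteq> 0 \<Longrightarrow> hd (stake n y) = b" "n \<noteq> 0 \<Longrightarrow> hd (stake n x) = a"
      by (cases n; simp add: y_def) (cases n; simp add: x)
    ultimately show ?case using Suc ab' by (cases n) (auto simp: reduced_Cons)
  qed simp
  then show ?thesis unfolding infinite_reduced_words_def by blast
qed

text \<open>Rebracketing exhibits the walk as a function of the finite word of increments; this
  gives its measurability and lets increments be split off on the left.\<close>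

lemma walk_eq_foldr:
  assumes "\<omega> \<in> streams L"
  shows "walk I G n \<omega> = foldr (letter_times G) (stake n \<omega>) []"
proof (induction n)
  case (Suc n)
  have l: "set (stake n \<omega>) \<subseteq> L"
    using assms set_stake_subset[of n \<omega>] by (auto simp: streams_iff_sset)
  have u: "\<omega> !! n \<in> L" using assms by (rule snth_in)
  then show ?case
    using Suc foldr_assoc[OF group_factor l, of "[]" "[\<omega> !! n]"]
    by (cases "\<omega> !! n") (simp add: stake_Suc free_product_def reduced_Cons del: stake.simps)
qed (simp add: free_product_def)

lemma walk_reduced: "\<omega> \<in> streams L \<Longrightarrow> walk I G n \<omega> \<in> reduced_words I G"
  using foldr_reduced[OF group_factor, of "stake n \<omega>" "[]"] set_stake_subset[of n \<omega>]
  by (auto simp: walk_eq_foldr streams_iff_sset)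

lemma walk_Stream:
  assumes "u \<in> L" "\<omega> \<in> streams L"
  shows "walk I G (Suc n) (u ## \<omega>) = letter_times G u (walk I G n \<omega>)"
  using assms by (simp add: walk_eq_foldr streams_Stream del: walk.simps)

lemma walk_add:
  assumes "\<omega> \<in> streams L"
  shows "walk I G (m + n) \<omega> = foldr (letter_times G) (stake m \<omega>) (walk I G n (sdrop m \<omega>))"
  using assms
  by (simp add: walk_eq_foldr sdrop_in_streams stake_add[symmetric] del: walk.simps stake_add)

lemma foldr_letter_times_inj:
  assumes "set g \<subseteq> L" "v \<in> reduced_words I G" "w \<in> reduced_words I G"
    and "foldr (letter_times G) g v = foldr (letter_times G) g w"
  shows "v = w"
  using assms(1,4)
proof (induction g)
  case (Cons x g)
  have inv: "letter_times G (letter_inv G x) (letter_times G x (foldr (letter_times G) g u)) =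
      foldr (letter_times G) g u" if "u \<in> reduced_words I G" for u
    using Cons.prems that
    by (intro letter_inv_times[OF group_factor] foldr_reduced[OF group_factor]) auto
  have "letter_times G x (foldr (letter_times G) g v) = letter_times G x (foldr (letter_times G) g w)"
    using Cons.prems(2) by simp
  from inv[OF assms(2), unfolded this] inv[OF assms(3)]
  have "foldr (letter_times G) g v = foldr (letter_times G) g w"
    by (rule trans[OF sym])
  with Cons show ?case by simp
qed simp

lemma walk_converges_ex:
  assumes \<omega>: "\<omega> \<in> streams L"
    and lim: "filterlim (\<lambda>n. length (walk I G n \<omega>)) at_top sequentially"
  shows "\<exists>\<xi>. walk_converges I G \<omega> \<xi>"
proof -
  let ?X = "\<lambda>n. walk I G n \<omega>"
  have "\<forall>m. \<exists>N. \<forall>n\<ge>N. m < length (?X n)"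
    using lim unfolding filterlim_at_top eventually_sequentially by (meson Suc_le_lessD)
  then obtain N where N: "\<And>m n. n \<ge> N m \<Longrightarrow> m < length (?X n)" by metis
  have const: "take m (?X n) = take m (?X (N m))" if "n \<ge> N m" for m n
    using that
  proof (induction n rule: dec_induct)
    case (step n)
    have "take m (?X (Suc n)) = take m (foldr (letter_times G) (?X n) [\<omega> !! n])"
      by (simp add: free_product_def)
    also have "\<dots> = take m (?X n)"
      using N[of m n] step(1) \<omega>
      by (intro take_foldr_letter_times_snoc[OF group_factor]) (auto intro: walk_reduced snth_in)
    finally show ?case using step by simp
  qed simp
  \<comment> \<open>From time \<open>N (Suc m)\<close> on, the prefix of length \<open>Suc m\<close>
    no longer changes, and it contains the letter at index \<open>m\<close>.\<close>
  define \<xi> where "\<xi> = to_stream (\<lambda>m. ?X (N (Suc m)) ! m)"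
  have st: "stake m \<xi> = take m (?X n)" if n: "n \<ge> N m" for m n
  proof (rule nth_equalityI)
    show "length (stake m \<xi>) = length (take m (?X n))" using N[OF n] by simp
    fix j assume "j < length (stake m \<xi>)"
    then have j: "j < m" by simp
    define n' where "n' = max n (N (Suc j))"
    have "take m (?X n) ! j = take m (?X n') ! j"
      using const[of m n] const[of m n'] n by (simp add: n'_def)
    also have "\<dots> = take (Suc j) (?X n') ! j" using j by simp
    also have "\<dots> = take (Suc j) (?X (N (Suc j))) ! j"
      using const[of "Suc j" n'] by (simp add: n'_def)
    finally show "stake m \<xi> ! j = take m (?X n) ! j"
      using j by (simp add: \<xi>_def to_stream_def)
  qed
  have "take m w \<in> reduced_words I G" if "w \<in> reduced_words I G" for m w
    using that successively_append_iff[of _ "take m w" "drop m w"]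
    by (auto simp: reduced_words_def dest: in_set_takeD)
  then have "\<xi> \<in> infinite_reduced_words I G"
    using st[OF order_refl] walk_reduced[OF \<omega>] by (auto simp: infinite_reduced_words_def)
  moreover have "\<forall>\<^sub>F n in sequentially. m \<le> length (?X n) \<and> take m (?X n) = stake m \<xi>" for m
    using st N by (auto simp: eventually_sequentially intro!: exI[of _ "N m"] less_imp_le)
  ultimately show ?thesis by (auto simp: walk_converges_iff)
qed

text \<open>Trades the existence of a limit, a quantifier over uncountably many words, for a
  condition on lengths that only involves countable quantifiers.\<close>

lemma walk_converges_ex_iff:
  assumes "\<omega> \<in> streams L"
  shows "(\<exists>\<xi>. walk_converges I G \<omega> \<xi>) \<longleftrightarrow>
    filterlim (\<lambda>n. length (walk I G n \<omega>)) at_top sequentially"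
proof
  assume "\<exists>\<xi>. walk_converges I G \<omega> \<xi>"
  then show "filterlim (\<lambda>n. length (walk I G n \<omega>)) at_top sequentially"
    unfolding walk_converges_iff filterlim_at_top by (auto elim: eventually_mono)
qed (rule walk_converges_ex[OF assms])

lemma walk_limit_reduced: "walk_limit I G \<omega> \<in> infinite_reduced_words I G"
proof (cases "\<exists>\<xi>. walk_converges I G \<omega> \<xi>")
  case True
  then show ?thesis using walk_limit_eq by (fastforce simp: walk_converges_def)
next
  case False
  then show ?thesis using infinite_reduced_nonempty by (simp add: walk_limit_def some_in_eq)
qed

text \<open>Equivariance of the limit: an extra initial increment multiplies the whole path on the
  left, and left multiplication by a letter is continuous on prefixes by
  \<open>take_letter_times\<close>.\<close>

lemma walk_converges_Stream:
  assumes u: "u \<in> L" and \<omega>: "\<omega> \<in> streams L" and c: "walk_converges I G \<omega> \<xi>"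
  shows "walk_converges I G (u ## \<omega>) (stream_times G u \<xi>)"
  unfolding walk_converges_iff
proof (intro conjI allI)
  show "stream_times G u \<xi> \<in> infinite_reduced_words I G"
    using c u by (auto simp: walk_converges_def intro: stream_times_reduced[OF group_factor])
  fix m
  have "\<forall>\<^sub>F n in sequentially. m + 2 \<le> length (walk I G n \<omega>) \<and>
      take (m + 2) (walk I G n \<omega>) = stake (m + 2) \<xi>"
    using c unfolding walk_converges_iff by blast
  then have "\<forall>\<^sub>F n in sequentially. m \<le> length (walk I G (Suc n) (u ## \<omega>)) \<and>
      take m (walk I G (Suc n) (u ## \<omega>)) = stake m (stream_times G u \<xi>)"
  proof eventually_elim
    case (elim n)
    then show ?case
      using take_letter_times[of m "walk I G n \<omega>" \<xi> G u] unfolding walk_Stream[OF u \<omega>] by blast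
  qed
  then show "\<forall>\<^sub>F n in sequentially. m \<le> length (walk I G n (u ## \<omega>)) \<and>
      take m (walk I G n (u ## \<omega>)) = stake m (stream_times G u \<xi>)"
    by (subst (asm) eventually_sequentially_Suc)
qed

end

section \<open>The random walk: independence, transience and the harmonic measure\<close>

locale free_product_walk = finite_free_product I G
  for I :: "'i set" and G :: "'i \<Rightarrow> ('a, 'b) monoid_scheme" +
  fixes \<mu> :: "('i \<times> 'a) pmf"
  assumes set_pmf_letters: "set_pmf \<mu> \<subseteq> letters I G"
begin

abbreviation "step \<equiv> restrict_space (measure_pmf \<mu>) L"
abbreviation "\<Omega> \<equiv> increments I G \<mu>"
abbreviation "S \<equiv> stream_space (count_space L)"

lemma sets_step: "sets step = sets (count_space L)"
  by (auto simp: sets_restrict_space)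

lemma space_step: "space step = L"
  by (simp add: space_restrict_space)

lemma prob_space_step: "prob_space step"
  using set_pmf_letters
  by (intro prob_space_restrict_space measure_pmf.emeasure_eq_1_AE) (auto simp: AE_measure_pmf_iff)

lemma sets_increments: "sets \<Omega> = sets S"
  unfolding increments_def by (rule sets_stream_space_cong[OF sets_step])

lemma space_increments: "space \<Omega> = streams L"
  by (simp add: increments_def space_stream_space space_step)

lemma space_S: "space S = streams L"
  by (simp add: space_stream_space)

sublocale increments: prob_space \<Omega>
  unfolding increments_def by (rule prob_space.prob_space_stream_space[OF prob_space_step])

lemma nn_integral_step:
  "(\<integral>\<^sup>+u. f u \<partial>step) = (\<Sum>u\<in>L. ennreal (pmf \<mu> u) * f u)"
proof -
  have "(\<integral>\<^sup>+u. f u \<partial>step) = (\<integral>\<^sup>+u. f u * indicator L u \<partial>measure_pmf \<mu>)"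
    by (subst nn_integral_restrict_space) auto
  also have "\<dots> = (\<Sum>u\<in>L. f u * indicator L u * ennreal (pmf \<mu> u))"
    by (subst nn_integral_measure_pmf_support[OF finite_letters]) auto
  finally show ?thesis by (simp add: mult.commute)
qed

lemma nn_integral_increments:
  assumes "f \<in> borel_measurable \<Omega>"
  shows "(\<integral>\<^sup>+\<omega>. f \<omega> \<partial>\<Omega>) = (\<Sum>u\<in>L. ennreal (pmf \<mu> u) * (\<integral>\<^sup>+\<omega>. f (u ## \<omega>) \<partial>\<Omega>))"
  using prob_space.nn_integral_stream_space[OF prob_space_step, of f] assms
  by (simp add: increments_def nn_integral_step)

lemma measurable_Stream_increments:
  "u \<in> L \<Longrightarrow> (##) u \<in> measurable \<Omega> \<Omega>"
  unfolding increments_def by (intro measurable_Stream) (auto simp: space_step)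

text \<open>First-step analysis as a finite sum over the alphabet.\<close>

lemma prob_increments:
  assumes A: "A \<in> sets \<Omega>"
  shows "measure \<Omega> A = (\<Sum>u\<in>L. pmf \<mu> u * measure \<Omega> {\<omega> \<in> space \<Omega>. u ## \<omega> \<in> A})"
proof -
  have *: "(\<integral>\<^sup>+\<omega>. indicator A (u ## \<omega>) \<partial>\<Omega>) = ennreal (measure \<Omega> {\<omega> \<in> space \<Omega>. u ## \<omega> \<in> A})"
    if "u \<in> L" for u
  proof -
    have "{\<omega> \<in> space \<Omega>. u ## \<omega> \<in> A} \<in> sets \<Omega>"
      using measurable_sets[OF measurable_Stream_increments[OF that] A]
      by (simp add: vimage_def Int_def conj_commute)
    then have "ennreal (measure \<Omega> {\<omega> \<in> space \<Omega>. u ## \<omega> \<in> A}) =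
        (\<integral>\<^sup>+\<omega>. indicator {\<omega> \<in> space \<Omega>. u ## \<omega> \<in> A} \<omega> \<partial>\<Omega>)"
      by (simp add: increments.emeasure_eq_measure)
    also have "\<dots> = (\<integral>\<^sup>+\<omega>. indicator A (u ## \<omega>) \<partial>\<Omega>)"
      by (intro nn_integral_cong) (auto split: split_indicator)
    finally show ?thesis by simp
  qed
  have "ennreal (measure \<Omega> A) = (\<integral>\<^sup>+\<omega>. indicator A \<omega> \<partial>\<Omega>)"
    using A by (simp add: increments.emeasure_eq_measure)
  also have "\<dots> = (\<Sum>u\<in>L. ennreal (pmf \<mu> u) * (\<integral>\<^sup>+\<omega>. indicator A (u ## \<omega>) \<partial>\<Omega>))"
    by (rule nn_integral_increments) (use A in simp)
  also have "\<dots> = ennreal (\<Sum>u\<in>L. pmf \<mu> u * measure \<Omega> {\<omega> \<in> space \<Omega>. u ## \<omega> \<in> A})"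
    by (simp add: * ennreal_mult' flip: sum_ennreal)
  finally show ?thesis by (simp add: sum_nonneg)
qed

lemma pred_stake: "Measurable.pred \<Omega> (\<lambda>\<omega>. Q (stake n \<omega>))"
  by (rule measurable_pred_stake[OF countable_letters sets_increments])

lemma pred_walk: "Measurable.pred \<Omega> (\<lambda>\<omega>. Q (walk I G n \<omega>))"
proof -
  have "Measurable.pred \<Omega> (\<lambda>\<omega>. Q (walk I G n \<omega>)) \<longleftrightarrow>
      Measurable.pred \<Omega> (\<lambda>\<omega>. Q (foldr (letter_times G) (stake n \<omega>) []))"
    by (rule measurable_cong) (simp add: space_increments walk_eq_foldr)
  then show ?thesis using pred_stake by simp
qed

lemma measurable_sdrop_increments: "sdrop n \<in> measurable \<Omega> \<Omega>"
  unfolding increments_def by measurable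

text \<open>The Markov property at a fixed time: the past is independent of the future, and the
  future is distributed like the whole sequence. The induction peels off the first increment, which
  changes \<open>Q\<close>.\<close>

lemma prob_stake_sdrop:
  assumes R: "Measurable.pred \<Omega> R"
  shows "measure \<Omega> {\<omega> \<in> space \<Omega>. Q (stake n \<omega>) \<and> R (sdrop n \<omega>)} =
    measure \<Omega> {\<omega> \<in> space \<Omega>. Q (stake n \<omega>)} * measure \<Omega> {\<omega> \<in> space \<Omega>. R \<omega>}"
proof (induction n arbitrary: Q)
  case 0
  show ?case by (cases "Q []") (simp_all add: increments.prob_space)
next
  case (Suc n)
  have m1: "{\<omega> \<in> space \<Omega>. Q (stake (Suc n) \<omega>)} \<in> sets \<Omega>"
    using pred_stake[where n = "Suc n" and Q = Q] by (simp only: pred_def)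
  have "Measurable.pred \<Omega> (\<lambda>\<omega>. Q (stake (Suc n) \<omega>) \<and> R (sdrop (Suc n) \<omega>))"
    using pred_stake[where n = "Suc n" and Q = Q]
      measurable_compose[OF measurable_sdrop_increments R, of "Suc n"]
    by (rule pred_intros_logic(3))
  then have m2: "{\<omega> \<in> space \<Omega>. Q (stake (Suc n) \<omega>) \<and> R (sdrop (Suc n) \<omega>)} \<in> sets \<Omega>"
    by (simp only: pred_def)
  have sp: "u ## \<omega> \<in> space \<Omega> \<longleftrightarrow> \<omega> \<in> space \<Omega>" if "u \<in> L" for u \<omega>
    using that by (simp add: space_increments streams_Stream)
  have "measure \<Omega> {\<omega> \<in> space \<Omega>. Q (stake (Suc n) \<omega>) \<and> R (sdrop (Suc n) \<omega>)} =
      (\<Sum>u\<in>L. pmf \<mu> u * (measure \<Omega> {\<omega> \<in> space \<Omega>. Q (u # stake n \<omega>) \<and> R (sdrop n \<omega>)}))"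
    unfolding prob_increments[OF m2] by (intro sum.cong refl) (simp add: sp)
  also have "\<dots> = (\<Sum>u\<in>L. pmf \<mu> u * measure \<Omega> {\<omega> \<in> space \<Omega>. Q (u # stake n \<omega>)}) *
      measure \<Omega> {\<omega> \<in> space \<Omega>. R \<omega>}"
    by (subst Suc[of "\<lambda>w. Q (_ # w)"]) (simp add: sum_distrib_right mult.assoc)
  also have "(\<Sum>u\<in>L. pmf \<mu> u * measure \<Omega> {\<omega> \<in> space \<Omega>. Q (u # stake n \<omega>)}) =
      measure \<Omega> {\<omega> \<in> space \<Omega>. Q (stake (Suc n) \<omega>)}"
    unfolding prob_increments[OF m1] by (intro sum.cong refl) (simp add: sp)
  finally show ?case .
qed

text \<open>
  The events \<open>the last visit to g happens at time n\<close> are disjoint and have probability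
  \<open>P(X\<^sub>n = g)\<close> times the probability of never returning to the identity.
\<close>

lemma AE_finitely_many_visits:
  assumes tr: "transient I G \<mu>"
  shows "AE \<omega> in \<Omega>. \<forall>\<^sub>F n in sequentially. walk I G n \<omega> \<noteq> g"
proof -
  define R where "R \<omega> \<longleftrightarrow> (\<forall>n. 1 \<le> n \<longrightarrow> walk I G n \<omega> \<noteq> [])" for \<omega>
  have R[measurable]: "Measurable.pred \<Omega> R"
    unfolding R_def by (intro pred_intros_countable pred_intros_logic pred_walk)
  define p where "p = measure \<Omega> {\<omega> \<in> space \<Omega>. R \<omega>}"
  have "measure \<Omega> {\<omega> \<in> space \<Omega>. \<not> R \<omega>} < 1"
    using tr by (simp add: transient_def R_def free_product_def)
  then have p: "p > 0"
    unfolding p_def by (subst (asm) increments.prob_neg) (use R in \<open>auto simp: pred_def\<close>)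
  define E where "E n = {\<omega> \<in> space \<Omega>. walk I G n \<omega> = g \<and> R (sdrop n \<omega>)}" for n
  define V where "V n = {\<omega> \<in> space \<Omega>. walk I G n \<omega> = g}" for n
  have V: "V n \<in> sets \<Omega>" for n
    using pred_walk[where Q = "\<lambda>w. w = g" and n = n] unfolding V_def pred_def .
  have "Measurable.pred \<Omega> (\<lambda>\<omega>. walk I G n \<omega> = g \<and> R (sdrop n \<omega>))" for n
    using pred_walk[where Q = "\<lambda>w. w = g" and n = n]
      measurable_compose[OF measurable_sdrop_increments R, of n]
    by (rule pred_intros_logic(3))
  then have E: "E n \<in> sets \<Omega>" for n unfolding E_def pred_def .
  have prob_E: "measure \<Omega> (E n) = measure \<Omega> (V n) * p" for n
    using prob_stake_sdrop[OF R, of "\<lambda>w. foldr (letter_times G) w [] = g" n]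
    by (simp add: E_def V_def p_def walk_eq_foldr space_increments cong: conj_cong)
  have "disjoint_family E"
    unfolding disjoint_family_on_def
  proof (intro ballI impI)
    have *: False if "m < n" "\<omega> \<in> E m" "\<omega> \<in> E n" for m n \<omega>
    proof -
      define k where "k = n - m"
      have \<omega>: "\<omega> \<in> streams L" using that by (simp add: E_def space_increments)
      have k: "walk I G k (sdrop m \<omega>) \<noteq> []" using that by (simp add: E_def R_def k_def)
      \<comment> \<open>Two visits to \<open>g\<close> at times \<open>m\<close> and
        \<open>n\<close> make the increments between them multiply to the identity, by left
        cancellation, against \<open>R\<close> at time \<open>m\<close>.\<close>
      have "foldr (letter_times G) (stake m \<omega>) (walk I G k (sdrop m \<omega>)) =
          foldr (letter_times G) (stake m \<omega>) []"
        using walk_add[OF \<omega>, of m k] walk_eq_foldr[OF \<omega>, of m] that by (simp add: E_def k_def)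
      moreover have "set (stake m \<omega>) \<subseteq> L"
        using \<omega> set_stake_subset[of m \<omega>] by (auto simp: streams_iff_sset)
      ultimately show False
        using foldr_letter_times_inj walk_reduced[OF sdrop_in_streams[OF \<omega>]] k by force
    qed
    fix m n :: nat assume "m \<noteq> n"
    then show "E m \<inter> E n = {}" using *[of m n] *[of n m] by (cases "m < n") auto
  qed
  then have "(\<Sum>n<N. measure \<Omega> (E n)) \<le> 1" for N
    using increments.finite_measure_finite_Union[of "{..<N}" E] E
      increments.prob_le_1[of "\<Union> (E ` {..<N})"]
    by (simp add: disjoint_family_on_mono[OF subset_UNIV] image_subset_iff)
  then have "summable (\<lambda>n. measure \<Omega> (E n))"
    by (intro summableI_nonneg_bounded) auto
  then have "summable (\<lambda>n. measure \<Omega> (V n) * p * (1 / p))"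
    unfolding prob_E by (rule summable_mult2)
  then have "summable (\<lambda>n. measure \<Omega> (V n))" using p by simp
  then have "AE \<omega> in \<Omega>. \<forall>\<^sub>F n in sequentially. \<omega> \<in> space \<Omega> - V n"
    using V by (intro borel_cantelli_AE1) (auto simp: increments.emeasure_eq_measure)
  then show ?thesis
    by eventually_elim (auto simp: V_def elim: eventually_mono)
qed

text \<open>The alphabet is finite, so balls of words are finite, and each of their elements is
  visited finitely often.\<close>

lemma AE_length_walk:
  assumes tr: "transient I G \<mu>"
  shows "AE \<omega> in \<Omega>. filterlim (\<lambda>n. length (walk I G n \<omega>)) at_top sequentially"
proof -
  define W where "W N = {w. set w \<subseteq> L \<and> length w \<le> N}" for N
  have W: "finite (W N)" for N
    unfolding W_def by (rule finite_lists_length_le[OF finite_letters])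
  have "AE \<omega> in \<Omega>. \<forall>g\<in>W N. \<forall>\<^sub>F n in sequentially. walk I G n \<omega> \<noteq> g" for N
    by (rule AE_finite_allI[OF W AE_finitely_many_visits[OF tr]])
  then have "AE \<omega> in \<Omega>. \<forall>N. \<forall>g\<in>W N. \<forall>\<^sub>F n in sequentially. walk I G n \<omega> \<noteq> g"
    by (simp add: AE_all_countable)
  then show ?thesis
  proof (rule AE_mp, intro AE_I2 impI)
    fix \<omega> assume \<omega>: "\<omega> \<in> space \<Omega>"
      and *: "\<forall>N. \<forall>g\<in>W N. \<forall>\<^sub>F n in sequentially. walk I G n \<omega> \<noteq> g"
    have "\<forall>\<^sub>F n in sequentially. \<forall>g\<in>W N. walk I G n \<omega> \<noteq> g" for N
      using * W by (simp add: eventually_ball_finite)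
    then have "\<forall>\<^sub>F n in sequentially. N \<le> length (walk I G n \<omega>)" for N
    proof (rule eventually_mono)
      fix n assume "\<forall>g\<in>W N. walk I G n \<omega> \<noteq> g"
      then have "walk I G n \<omega> \<notin> W N" by auto
      then show "N \<le> length (walk I G n \<omega>)"
        using walk_reduced[of \<omega> n] \<omega> by (auto simp: W_def space_increments reduced_words_def)
    qed
    then show "filterlim (\<lambda>n. length (walk I G n \<omega>)) at_top sequentially"
      by (simp add: filterlim_at_top)
  qed
qed

lemma AE_walk_converges:
  assumes tr: "transient I G \<mu>"
  shows "AE \<omega> in \<Omega>. walk_converges I G \<omega> (walk_limit I G \<omega>)"
  using AE_length_walk[OF tr] AE_space
proof eventually_elim
  case (elim \<omega>)
  then obtain \<xi> where "walk_converges I G \<omega> \<xi>"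
    using walk_converges_ex by (auto simp: space_increments)
  then show ?case using walk_limit_eq by metis
qed

lemma measurable_walk_limit: "walk_limit I G \<in> measurable \<Omega> S"
proof (rule measurable_stream_space2)
  fix n
  define \<xi>\<^sub>0 where "\<xi>\<^sub>0 = (SOME \<xi>. \<xi> \<in> infinite_reduced_words I G)"
  \<comment> \<open>Convergence expressed by countable quantifiers over events of the walk at fixed
    times.\<close>
  define lim where "lim \<omega> \<longleftrightarrow> (\<forall>m. \<exists>N. \<forall>k. N \<le> k \<longrightarrow> m \<le> length (walk I G k \<omega>))" for \<omega>
  have lim: "lim \<omega> \<longleftrightarrow> (\<exists>\<xi>. walk_converges I G \<omega> \<xi>)" if "\<omega> \<in> streams L" for \<omega>
    using walk_converges_ex_iff[OF that]
    by (simp add: lim_def filterlim_at_top eventually_sequentially)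
  have [measurable]: "Measurable.pred \<Omega> lim"
    unfolding lim_def by (intro pred_intros_countable pred_intros_logic pred_walk)
  \<comment> \<open>On converging paths, the letter at index \<open>n\<close> of the limit is
    \<open>a\<close> exactly if it is eventually \<open>a\<close> along the walk.\<close>
  define P where "P a \<omega> \<longleftrightarrow>
      (\<exists>N. \<forall>k. N \<le> k \<longrightarrow> n < length (walk I G k \<omega>) \<and> walk I G k \<omega> ! n = a)" for a \<omega>
  have [measurable]: "Measurable.pred \<Omega> (P a)" for a
    unfolding P_def by (intro pred_intros_countable pred_intros_logic pred_walk)
  have eq: "walk_limit I G \<omega> !! n = a \<longleftrightarrow> (if lim \<omega> then P a \<omega> else \<xi>\<^sub>0 !! n = a)"
    if \<omega>: "\<omega> \<in> streams L" for a \<omega>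
  proof (cases "lim \<omega>")
    case True
    then obtain \<xi> where \<xi>: "walk_converges I G \<omega> \<xi>" using lim[OF \<omega>] by blast
    have "\<exists>N. \<forall>k\<ge>N. Suc n \<le> length (walk I G k \<omega>) \<and> take (Suc n) (walk I G k \<omega>) = stake (Suc n) \<xi>"
      using \<xi> unfolding walk_converges_iff eventually_sequentially by blast
    then obtain N where N: "\<And>k. k \<ge> N \<Longrightarrow>
        Suc n \<le> length (walk I G k \<omega>) \<and> take (Suc n) (walk I G k \<omega>) = stake (Suc n) \<xi>" by blast
    then have N': "n < length (walk I G k \<omega>) \<and> walk I G k \<omega> ! n = \<xi> !! n" if "k \<ge> N" for k
      using N[OF that] nth_take[of n "Suc n" "walk I G k \<omega>"] stake_nth[of n "Suc n" \<xi>]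
      by (simp del: stake.simps nth_take stake_nth)
    have "P a \<omega> \<longleftrightarrow> \<xi> !! n = a"
    proof
      assume "P a \<omega>"
      then obtain M where "\<forall>k. M \<le> k \<longrightarrow> n < length (walk I G k \<omega>) \<and> walk I G k \<omega> ! n = a"
        by (auto simp: P_def)
      then show "\<xi> !! n = a" using N'[of "max M N"] by auto
    next
      assume "\<xi> !! n = a"
      then show "P a \<omega>" using N' unfolding P_def by blast
    qed
    then show ?thesis using True walk_limit_eq[OF \<xi>] by simp
  next
    case False
    then show ?thesis using lim[OF \<omega>] by (simp add: walk_limit_def \<xi>\<^sub>0_def)
  qed
  show "(\<lambda>\<omega>. walk_limit I G \<omega> !! n) \<in> measurable \<Omega> (count_space L)"
    unfolding measurable_count_space_eq_countable[OF countable_letters]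
  proof (intro conjI ballI)
    show "(\<lambda>\<omega>. walk_limit I G \<omega> !! n) \<in> space \<Omega> \<rightarrow> L"
      using infinite_reduced_in_streams[OF walk_limit_reduced] by (auto intro: snth_in)
    fix a assume "a \<in> L"
    have "(\<lambda>\<omega>. walk_limit I G \<omega> !! n) -` {a} \<inter> space \<Omega> =
        {\<omega> \<in> space \<Omega>. if lim \<omega> then P a \<omega> else \<xi>\<^sub>0 !! n = a}"
      unfolding space_increments using eq[of _ a] by blast
    also have "\<dots> \<in> sets \<Omega>" by measurable
    finally show "(\<lambda>\<omega>. walk_limit I G \<omega> !! n) -` {a} \<inter> space \<Omega> \<in> sets \<Omega>" .
  qed
qed

abbreviation "H \<equiv> harmonic_measure I G \<mu>"

lemma sets_harmonic: "sets H = sets S"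
  by (simp add: harmonic_measure_def)

lemma space_harmonic: "space H = streams L"
  by (simp add: harmonic_measure_def space_S)

sublocale harmonic: prob_space H
  unfolding harmonic_measure_def by (rule increments.prob_space_distr[OF measurable_walk_limit])

lemma infinite_reduced_in_sets: "infinite_reduced_words I G \<in> sets S"
proof -
  have "infinite_reduced_words I G = {\<xi> \<in> space S. \<forall>n. stake n \<xi> \<in> reduced_words I G}"
    using infinite_reduced_in_streams by (auto simp: infinite_reduced_words_def space_S)
  also have "\<dots> \<in> sets S"
    unfolding pred_def[symmetric]
    by (intro pred_intros_countable measurable_pred_stake[OF countable_letters refl])
  finally show ?thesis .
qed

lemma measure_harmonic:
  assumes "B \<in> sets S"
  shows "measure H B = measure \<Omega> {\<omega> \<in> space \<Omega>. walk_limit I G \<omega> \<in> B}"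
  unfolding harmonic_measure_def
  by (subst measure_distr[OF measurable_walk_limit assms]) (simp add: vimage_def Int_def conj_commute)

lemma AE_harmonic_reduced: "AE \<xi> in H. \<xi> \<in> infinite_reduced_words I G"
  unfolding harmonic_measure_def
proof (subst AE_distr_iff[OF measurable_walk_limit])
  have "{\<xi> \<in> space S. \<xi> \<in> infinite_reduced_words I G} = infinite_reduced_words I G"
    using infinite_reduced_in_streams by (auto simp: space_S)
  then show "{\<xi> \<in> space S. \<xi> \<in> infinite_reduced_words I G} \<in> sets S"
    using infinite_reduced_in_sets by simp
qed (simp add: walk_limit_reduced)

lemma measurable_stream_times:
  assumes u: "u \<in> L" shows "stream_times G u \<in> measurable S S"
proof -
  \<comment> \<open>Outside the branch where head and \<open>u\<close> merge, the product need not
    be a letter; the fallback value \<open>u\<close> makes \<open>f\<close> a total map of the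
    alphabet to itself. In the merging branch \<open>f\<close> is the product.\<close>
  define f where "f v = (let v' = (fst u, snd u \<otimes>\<^bsub>G (fst u)\<^esub> snd v) in if v' \<in> L then v' else u)" for v :: "'i \<times> 'a"
  have f: "f v \<in> L" for v using u by (simp add: f_def Let_def)
  have [measurable]: "f \<in> measurable (count_space L) (count_space L)" using f by simp
  have [measurable]: "Measurable.pred (count_space L) Q" for Q by simp
  have [measurable]: "(\<lambda>\<xi>. u) \<in> measurable S (count_space L)" using u by simp
  define h where "h \<xi> = (if fst u \<noteq> fst (shd \<xi>) then u ## \<xi>
      else if snd u \<otimes>\<^bsub>G (fst u)\<^esub> snd (shd \<xi>) = \<one>\<^bsub>G (fst u)\<^esub> then stl \<xi>
      else f (shd \<xi>) ## stl \<xi>)" for \<xi>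
  have [measurable]: "Measurable.pred S (\<lambda>\<xi>. Q (shd \<xi>))" for Q
    by (rule measurable_compose[OF measurable_shd]) simp
  have "h \<in> measurable S S"
    unfolding h_def by measurable
  moreover have "stream_times G u \<xi> = h \<xi>" if "\<xi> \<in> space S" for \<xi>
  proof -
    obtain i g j k where e: "u = (i, g)" "shd \<xi> = (j, k)" by (metis surj_pair)
    have "(j, k) \<in> L" using that e streams_shd[of \<xi> L] by (simp add: space_S)
    interpret group "G i" using group_factor u e by (auto simp: letters_iff)
    show ?thesis
      using \<open>(j, k) \<in> L\<close> u e m_closed[of g k] by (cases "i = j") (auto simp: stream_times_def h_def f_def letters_iff)
  qed
  ultimately show ?thesis by (subst measurable_cong)
qed

lemma harmonic_stationary:
  assumes tr: "transient I G \<mu>" and B: "B \<in> sets S"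
  shows "measure H B = (\<Sum>u\<in>L. pmf \<mu> u * measure H {\<xi> \<in> space H. stream_times G u \<xi> \<in> B})"
proof -
  have A: "{\<omega> \<in> space \<Omega>. walk_limit I G \<omega> \<in> B'} \<in> sets \<Omega>" if "B' \<in> sets S" for B'
    using measurable_sets[OF measurable_walk_limit that] by (simp add: vimage_def Int_def conj_commute)
  have B': "{\<xi> \<in> space H. stream_times G u \<xi> \<in> B} \<in> sets S" if "u \<in> L" for u
    using measurable_sets[OF measurable_stream_times[OF that] B]
    by (simp add: vimage_def Int_def conj_commute space_harmonic space_S)
  have "measure \<Omega> {\<omega> \<in> space \<Omega>. u ## \<omega> \<in> {\<omega> \<in> space \<Omega>. walk_limit I G \<omega> \<in> B}} =
      measure H {\<xi> \<in> space H. stream_times G u \<xi> \<in> B}" if u: "u \<in> L" for u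
  proof -
    have "measure \<Omega> {\<omega> \<in> space \<Omega>. u ## \<omega> \<in> {\<omega> \<in> space \<Omega>. walk_limit I G \<omega> \<in> B}} =
        measure \<Omega> {\<omega> \<in> space \<Omega>. walk_limit I G \<omega> \<in> {\<xi> \<in> space H. stream_times G u \<xi> \<in> B}}"
    proof (rule increments.finite_measure_eq_AE)
      show "{\<omega> \<in> space \<Omega>. u ## \<omega> \<in> {\<omega> \<in> space \<Omega>. walk_limit I G \<omega> \<in> B}} \<in> sets \<Omega>"
        using measurable_sets[OF measurable_Stream_increments[OF u] A[OF B]]
        by (simp add: vimage_def Int_def conj_commute)
      show "{\<omega> \<in> space \<Omega>. walk_limit I G \<omega> \<in> {\<xi> \<in> space H. stream_times G u \<xi> \<in> B}} \<in> sets \<Omega>"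
        by (rule A[OF B'[OF u]])
      show "AE \<omega> in \<Omega>. \<omega> \<in> {\<omega> \<in> space \<Omega>. u ## \<omega> \<in> {\<omega> \<in> space \<Omega>. walk_limit I G \<omega> \<in> B}} \<longleftrightarrow>
          \<omega> \<in> {\<omega> \<in> space \<Omega>. walk_limit I G \<omega> \<in> {\<xi> \<in> space H. stream_times G u \<xi> \<in> B}}"
        using AE_walk_converges[OF tr] AE_space
      proof eventually_elim
        case (elim \<omega>)
        have "walk_limit I G (u ## \<omega>) = stream_times G u (walk_limit I G \<omega>)"
          using elim by (intro walk_limit_eq walk_converges_Stream[OF u]) (auto simp: space_increments)
        then show ?case
          using elim u infinite_reduced_in_streams[OF walk_limit_reduced]
          by (simp add: space_increments space_harmonic streams_Stream)
      qed
    qed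
    then show ?thesis using measure_harmonic[OF B'[OF u]] by simp
  qed
  then show ?thesis
    using measure_harmonic[OF B] prob_increments[OF A[OF B]] by (simp cong: sum.cong)
qed

end

section \<open>Markov measures\<close>

text \<open>
  A Markov chain on \<^term>\<open>A\<close> is driven by independent random maps, the map of a step sending
  the current state to the next one. The state \<^term>\<open>None\<close> precedes the first letter, so that
  \<^term>\<open>K None\<close> is the initial distribution. Values outside \<^term>\<open>A\<close>, which have probability
  zero, are replaced by \<^term>\<open>c\<close>.
\<close>

primcorec markov_path :: "'c set \<Rightarrow> 'c \<Rightarrow> 'c option \<Rightarrow> ('c option \<Rightarrow> 'c) stream \<Rightarrow> 'c stream" where
  "markov_path A c s fs =
     (let v = if shd fs s \<in> A then shd fs s else c in v ## markov_path A c (Some v) (stl fs))"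

definition markov_maps :: "'c set \<Rightarrow> 'c \<Rightarrow> ('c option \<Rightarrow> 'c pmf) \<Rightarrow> ('c option \<Rightarrow> 'c) pmf" where
  "markov_maps A c K = Pi_pmf (insert None (Some ` A)) c K"

definition markov_measure ::
    "'c set \<Rightarrow> 'c \<Rightarrow> ('c option \<Rightarrow> 'c pmf) \<Rightarrow> 'c option \<Rightarrow> 'c stream measure" where
  "markov_measure A c K s =
     distr (stream_space (measure_pmf (markov_maps A c K))) (stream_space (count_space A))
       (markov_path A c s)"

lemma sets_markov_measure: "sets (markov_measure A c K s) = sets (stream_space (count_space A))"
  by (simp add: markov_measure_def)

lemma space_markov_measure: "space (markov_measure A c K s) = streams A"
  by (simp add: markov_measure_def space_stream_space)

locale markov_kernel =
  fixes A :: "'c set" and c :: 'c and K :: "'c option \<Rightarrow> 'c pmf"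
  assumes finite_A: "finite A" and c_in: "c \<in> A"
    and K_in: "\<And>s. s \<in> insert None (Some ` A) \<Longrightarrow> set_pmf (K s) \<subseteq> A"
begin

abbreviation "maps \<equiv> stream_space (measure_pmf (markov_maps A c K))"
abbreviation "\<nu> \<equiv> markov_measure A c K"

lemma measurable_markov_path:
  "markov_path A c s \<in> measurable maps (stream_space (count_space A))"
proof (rule measurable_stream_space2)
  fix n
  have nxt: "(\<lambda>fs. if shd fs s \<in> A then shd fs s else c) \<in> measurable maps (count_space A)" for s
    using c_in by (intro measurable_compose[OF measurable_shd, of "\<lambda>f. if f s \<in> A then f s else c"]) auto
  show "(\<lambda>fs. markov_path A c s fs !! n) \<in> measurable maps (count_space A)"
  proof (induction n arbitrary: s)
    case 0
    show ?case using nxt by (simp add: Let_def)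
  next
    case (Suc n)
    have "(\<lambda>fs. markov_path A c (Some v) (stl fs) !! n) \<in> measurable maps (count_space A)" for v
      by (rule measurable_compose[OF measurable_stl Suc])
    from measurable_compose_countable'[OF this nxt countable_finite[OF finite_A]]
    show ?case by (simp add: Let_def)
  qed
qed

lemma prob_space_markov_measure: "prob_space (\<nu> s)"
  unfolding markov_measure_def
  by (intro prob_space.prob_space_distr[OF _ measurable_markov_path]
      prob_space.prob_space_stream_space measure_pmf.prob_space_axioms)

text \<open>The Markov property at time one: the first map sends \<open>s\<close> to a letter of law
  \<open>K s\<close>, and the remaining maps drive a fresh chain from there.\<close>

lemma measure_markov_measure:
  assumes s: "s \<in> insert None (Some ` A)" and B: "B \<in> sets (stream_space (count_space A))"
  shows "measure (\<nu> s) B = (\<Sum>v\<in>A. pmf (K s) v * measure (\<nu> (Some v)) {\<xi> \<in> streams A. v ## \<xi> \<in> B})"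
proof -
  interpret M: prob_space "\<nu> t" for t by (rule prob_space_markov_measure)
  let ?nxt = "\<lambda>f. if f s \<in> A then f s else c"
  define g where "g v = emeasure (\<nu> (Some v)) {\<xi> \<in> streams A. v ## \<xi> \<in> B}" for v
  \<comment> \<open>Replacing values outside \<open>A\<close> by \<open>c\<close> does not change
    the law, because \<open>K s\<close> is supported in \<open>A\<close>.\<close>
  have law: "map_pmf ?nxt (markov_maps A c K) = K s"
  proof -
    have "map_pmf ?nxt (markov_maps A c K) =
        map_pmf (\<lambda>v. if v \<in> A then v else c) (map_pmf (\<lambda>f. f s) (markov_maps A c K))"
      by (simp add: pmf.map_comp comp_def)
    also have "map_pmf (\<lambda>f. f s) (markov_maps A c K) = K s"
      unfolding markov_maps_def using s finite_A by (subst Pi_pmf_component) auto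
    also have "map_pmf (\<lambda>v. if v \<in> A then v else c) (K s) = K s"
      using K_in[OF s] by (intro map_pmf_idI) auto
    finally show ?thesis .
  qed
  have B': "{\<xi> \<in> streams A. v ## \<xi> \<in> B} \<in> sets (stream_space (count_space A))" if "v \<in> A" for v
  proof -
    have "(##) v \<in> measurable (stream_space (count_space A)) (stream_space (count_space A))"
      using that by (intro measurable_Stream) auto
    from measurable_sets[OF this B] show ?thesis
      by (simp add: vimage_def Int_def conj_commute space_stream_space)
  qed
  have pre: "markov_path A c s -` B \<inter> space maps \<in> sets maps" for s
    by (rule measurable_sets[OF measurable_markov_path B])
  have "emeasure (\<nu> s) B = emeasure maps (markov_path A c s -` B \<inter> space maps)"
    unfolding markov_measure_def by (rule emeasure_distr[OF measurable_markov_path B])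
  also have "\<dots> = (\<integral>\<^sup>+f. emeasure maps {fs \<in> space maps. f ## fs \<in> markov_path A c s -` B \<inter> space maps}
      \<partial>measure_pmf (markov_maps A c K))"
    by (rule prob_space.emeasure_stream_space[OF measure_pmf.prob_space_axioms pre])
  also have "\<dots> = (\<integral>\<^sup>+f. g (?nxt f) \<partial>measure_pmf (markov_maps A c K))"
  proof (intro nn_integral_cong)
    fix f
    let ?v = "?nxt f"
    have v: "?v \<in> A" using c_in by auto
    have "markov_path A c s (f ## fs) = ?v ## markov_path A c (Some ?v) fs" for fs
      by (subst markov_path.code) (simp add: Let_def)
    then have "{fs \<in> space maps. f ## fs \<in> markov_path A c s -` B \<inter> space maps} =
        markov_path A c (Some ?v) -` {\<xi> \<in> streams A. ?v ## \<xi> \<in> B} \<inter> space maps"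
      using measurable_space[OF measurable_markov_path]
      by (auto simp: space_stream_space)
    then show "emeasure maps {fs \<in> space maps. f ## fs \<in> markov_path A c s -` B \<inter> space maps} = g ?v"
      unfolding g_def markov_measure_def
      using emeasure_distr[OF measurable_markov_path B'[OF v], of "Some ?v"] by simp
  qed
  also have "\<dots> = (\<integral>\<^sup>+v. g v \<partial>measure_pmf (K s))"
    by (simp flip: law)
  also have "\<dots> = (\<Sum>v\<in>A. g v * ennreal (pmf (K s) v))"
    using K_in[OF s] by (intro nn_integral_measure_pmf_support finite_A) auto
  also have "\<dots> = ennreal (\<Sum>v\<in>A. pmf (K s) v * measure (\<nu> (Some v)) {\<xi> \<in> streams A. v ## \<xi> \<in> B})"
    by (simp add: g_def M.emeasure_eq_measure ennreal_mult' mult.commute flip: sum_ennreal)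
  finally show ?thesis
    by (simp add: M.emeasure_eq_measure sum_nonneg)
qed

text \<open>The tail event \<open>B\<close> is carried along so that one formula serves plain
  cylinders, with \<open>B\<close> the whole space, and the intersection of cylinders with a
  shift-invariant set in the proof of ergodicity.\<close>

lemma measure_markov_measure_Cons:
  assumes s: "s \<in> insert None (Some ` A)" and v: "v \<in> A"
    and B: "B \<in> sets (stream_space (count_space A))" and w: "w \<in> lists A"
  shows "measure (\<nu> s) {\<xi> \<in> sstart A (v # w). stl \<xi> \<in> B} =
    pmf (K s) v * measure (\<nu> (Some v)) (sstart A w \<inter> B)"
proof -
  have "stl -` B \<inter> space (stream_space (count_space A)) \<in> sets (stream_space (count_space A))"
    by (rule measurable_sets[OF measurable_stl B])
  then have "sstart A (v # w) \<inter> (stl -` B \<inter> space (stream_space (count_space A)))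
      \<in> sets (stream_space (count_space A))"
    using v w finite_A by (intro sets.Int[OF sstart_in_sets] countable_finite) simp_all
  moreover have "sstart A (v # w) \<inter> (stl -` B \<inter> space (stream_space (count_space A))) =
      {\<xi> \<in> sstart A (v # w). stl \<xi> \<in> B}"
    using sstart_in_streams[of "v # w" A] v w by (auto simp: space_stream_space)
  ultimately have "{\<xi> \<in> sstart A (v # w). stl \<xi> \<in> B} \<in> sets (stream_space (count_space A))"
    by simp
  from measure_markov_measure[OF s this]
  have "measure (\<nu> s) {\<xi> \<in> sstart A (v # w). stl \<xi> \<in> B} = (\<Sum>x\<in>A. pmf (K s) x *
      measure (\<nu> (Some x)) {\<xi> \<in> streams A. x ## \<xi> \<in> {\<xi> \<in> sstart A (v # w). stl \<xi> \<in> B}})" .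
  also have "\<dots> = (\<Sum>x\<in>A. if x = v then pmf (K s) v * measure (\<nu> (Some v)) (sstart A w \<inter> B) else 0)"
  proof (intro sum.cong refl)
    fix x
    have "{\<xi> \<in> streams A. x ## \<xi> \<in> {\<xi> \<in> sstart A (v # w). stl \<xi> \<in> B}} =
        (if x = v then sstart A w \<inter> B else {})"
      using sstart_in_streams[of w A] w by auto
    then show "pmf (K s) x *
        measure (\<nu> (Some x)) {\<xi> \<in> streams A. x ## \<xi> \<in> {\<xi> \<in> sstart A (v # w). stl \<xi> \<in> B}} =
        (if x = v then pmf (K s) v * measure (\<nu> (Some v)) (sstart A w \<inter> B) else 0)"
      by simp
  qed
  finally show ?thesis using v finite_A by simp
qed

end

text \<open>Cylinders and the empty set form an intersection-stable generator.\<close>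

lemma stream_measure_eqI:
  assumes S: "countable S" and "finite_measure M" "finite_measure N"
    and sets: "sets M = sets (stream_space (count_space S))" "sets N = sets (stream_space (count_space S))"
    and eq: "\<And>w. w \<in> lists S \<Longrightarrow> measure M (sstart S w) = measure N (sstart S w)"
  shows "M = N"
proof (rule measure_eqI_generator_eq[OF Int_stable_sstart])
  interpret M: finite_measure M by fact
  interpret N: finite_measure N by fact
  show sub: "sstart S ` lists S \<union> {{}} \<subseteq> Pow (streams S)"
    using sstart_in_streams by fast
  show "sets M = sigma_sets (streams S) (sstart S ` lists S \<union> {{}})"
    "sets N = sigma_sets (streams S) (sstart S ` lists S \<union> {{}})"
    using sub by (simp_all add: sets sets_stream_space_sstart[OF S] sets_measure_of)
  show "range (\<lambda>_::nat. streams S) \<subseteq> sstart S ` lists S \<union> {{}}"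
    by (auto intro!: image_eqI[of _ _ "[]"])
  show "(\<Union>i::nat. streams S) = streams S" by simp
  show "emeasure M (streams S) \<noteq> \<infinity>" by simp
  fix X assume "X \<in> sstart S ` lists S \<union> {{}}"
  then show "emeasure M X = emeasure N X"
    using eq by (auto simp: M.emeasure_eq_measure N.emeasure_eq_measure)
qed

section \<open>Cylinders under the action of a letter\<close>

context finite_free_product
begin

text \<open>A first letter \<open>a\<close> arises in three ways: \<open>u\<close> is prepended,
  \<open>u\<close> merges with the head, or \<open>u\<close> cancels the head and uncovers
  \<open>a\<close>. These are the three terms of the traffic equations.\<close>

lemma stream_times_in_cylinder_iff:
  assumes u: "u \<in> L" and a: "a \<in> L" and \<xi>: "\<xi> \<in> infinite_reduced_words I G"
  shows "stream_times G u \<xi> \<in> sstart L (a # w) \<longleftrightarrow>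
    u = a \<and> \<xi> \<in> sstart L w \<and> fst (shd \<xi>) \<noteq> fst a \<or>
    (\<exists>v\<in>L. [u] \<otimes>\<^bsub>free_product I G\<^esub> [v] = [a] \<and> \<xi> \<in> sstart L (v # w)) \<or>
    fst u \<noteq> fst a \<and> \<xi> \<in> sstart L (letter_inv G u # a # w)"
proof -
  obtain i g where ug: "u = (i, g)" by (metis surj_pair)
  obtain j k t where \<xi>': "\<xi> = (j, k) ## t" by (metis surj_pair stream.collapse)
  interpret group "G i" using group_factor u ug by (auto simp: letters_iff)
  have g: "i \<in> I" "g \<in> carrier (G i)" "g \<noteq> \<one>\<^bsub>G i\<^esub>" using u ug by (auto simp: letters_iff)
  have k: "(j, k) \<in> L" "k \<in> carrier (G j)" "fst (shd t) \<noteq> j"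
    using \<xi> \<xi>' by (auto simp: infinite_reduced_Stream letters_iff)
  have prod: "[(i, g)] \<otimes>\<^bsub>free_product I G\<^esub> [v] = [a] \<longleftrightarrow>
      fst v = i \<and> g \<otimes>\<^bsub>G i\<^esub> snd v \<noteq> \<one>\<^bsub>G i\<^esub> \<and> a = (i, g \<otimes>\<^bsub>G i\<^esub> snd v)" for v
    by (cases v) (auto simp: free_product_def)
  show ?thesis
  proof (cases "j = i")
    case False
    then show ?thesis using ug \<xi>' k
      by (auto simp: prod stream_times_def letter_inv_def)
  next
    case True
    have inv: "inv\<^bsub>G i\<^esub> g = k \<longleftrightarrow> g \<otimes>\<^bsub>G i\<^esub> k = \<one>\<^bsub>G i\<^esub>"
      using g k True inv_comm inv_equality r_inv by metis
    show ?thesis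
      using True ug \<xi>' k inv by (auto simp: prod stream_times_def letter_inv_def)
  qed
qed

lemma measure_stream_times_cylinder:
  assumes N: "prob_space N" "sets N = sets (stream_space (count_space L))"
    and red: "AE \<xi> in N. \<xi> \<in> infinite_reduced_words I G"
    and u: "u \<in> L" and a: "a \<in> L" and w: "w \<in> lists L"
    and m: "stream_times G u \<in> measurable N N"
  shows "measure N {\<xi> \<in> space N. stream_times G u \<xi> \<in> sstart L (a # w)} =
    (if u = a then measure N {\<xi> \<in> sstart L w. fst (shd \<xi>) \<noteq> fst a} else 0) +
    (\<Sum>v | v \<in> L \<and> [u] \<otimes>\<^bsub>free_product I G\<^esub> [v] = [a]. measure N (sstart L (v # w))) +
    (if fst u \<noteq> fst a then measure N (sstart L (letter_inv G u # a # w)) else 0)"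
proof -
  interpret prob_space N by fact
  let ?V = "{v \<in> L. [u] \<otimes>\<^bsub>free_product I G\<^esub> [v] = [a]}"
  define A1 where "A1 = (if u = a then {\<xi> \<in> sstart L w. fst (shd \<xi>) \<noteq> fst a} else {})"
  define A2 where "A2 = (\<Union>v\<in>?V. sstart L (v # w))"
  define A3 where "A3 = (if fst u \<noteq> fst a then sstart L (letter_inv G u # a # w) else {})"
  have cyl: "sstart L w \<in> sets N" if "w \<in> lists L" for w
    unfolding N(2) using that by (rule sstart_in_sets[OF countable_letters])
  have spN: "space N = streams L"
    using sets_eq_imp_space_eq[OF N(2)] by (simp add: space_stream_space)
  have fst_prod: "fst v = fst u \<and> fst a = fst u" if "v \<in> ?V" for v
    using that by (cases u; cases v) (auto simp: free_product_def split: if_splits)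
  have iu: "letter_inv G u \<in> L" by (rule letter_inv_in[OF group_factor u])
  have "{\<xi> \<in> sstart L w. fst (shd \<xi>) \<noteq> fst a} =
      sstart L w \<inter> {\<xi> \<in> space N. fst (shd \<xi>) \<noteq> fst a}"
    using sstart_in_streams[of w L] w by (auto simp: spN)
  moreover have "{\<xi> \<in> space N. fst (shd \<xi>) \<noteq> fst a} \<in> sets N"
    using measurable_pred_stake[OF countable_letters N(2), of "\<lambda>w. fst (hd w) \<noteq> fst a" 1]
    by (simp add: pred_def)
  ultimately have A1: "A1 \<in> sets N" using cyl[OF w] by (simp add: A1_def)
  have fV: "finite ?V" using finite_letters by simp
  have cV: "sstart L (v # w) \<in> sets N" if "v \<in> ?V" for v using that w by (intro cyl) auto
  have A2: "A2 \<in> sets N" unfolding A2_def using fV cV by (intro sets.finite_UN) auto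
  have A3: "A3 \<in> sets N" unfolding A3_def using cyl[of "letter_inv G u # a # w"] iu a w by simp
  have "measure N {\<xi> \<in> space N. stream_times G u \<xi> \<in> sstart L (a # w)} = measure N (A1 \<union> A2 \<union> A3)"
  proof (rule finite_measure_eq_AE)
    show "AE \<xi> in N. \<xi> \<in> {\<xi> \<in> space N. stream_times G u \<xi> \<in> sstart L (a # w)} \<longleftrightarrow> \<xi> \<in> A1 \<union> A2 \<union> A3"
      using red AE_space
    proof eventually_elim
      case (elim \<xi>)
      then show ?case
        using stream_times_in_cylinder_iff[OF u a elim(1), of w]
        unfolding A1_def A2_def A3_def by (auto simp del: in_sstart)
    qed
    show "{\<xi> \<in> space N. stream_times G u \<xi> \<in> sstart L (a # w)} \<in> sets N"
      using measurable_sets[OF m cyl[of "a # w"]] a w by (simp add: vimage_def Int_def conj_commute)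
  qed (use A1 A2 A3 in auto)
  also have "\<dots> = measure N A1 + measure N A2 + measure N A3"
  proof -
    \<comment> \<open>In \<open>A1\<close> the head lies outside the factor of \<open>a\<close>, in
      \<open>A2\<close> inside it. Both need \<open>u\<close> in the factor of \<open>a\<close>,
      whereas \<open>A3\<close> needs it in another one.\<close>
    have "A1 \<inter> A2 = {}" using fst_prod by (auto simp: A1_def A2_def)
    moreover have "?V = {}" if "fst u \<noteq> fst a"
    proof (rule equals0I)
      fix v assume "v \<in> ?V"
      from fst_prod[OF this] that show False by simp
    qed
    then have "A1 \<union> A2 = {}" if "fst u \<noteq> fst a"
      using that unfolding A1_def A2_def by force
    then have "(A1 \<union> A2) \<inter> A3 = {}" by (auto simp: A3_def)
    ultimately show ?thesis using A1 A2 A3 by (simp add: finite_measure_Union)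
  qed
  also have "measure N A2 = (\<Sum>v\<in>?V. measure N (sstart L (v # w)))"
    unfolding A2_def
    by (rule finite_measure_finite_Union[OF fV]) (use cV in \<open>auto simp: disjoint_family_on_def\<close>)
  finally show ?thesis by (simp add: A1_def A3_def)
qed

end

section \<open>The traffic equations\<close>

context finite_free_product
begin

abbreviation "k \<equiv> real (card I)"

lemma k_ge: "k \<ge> 2"
  using card_index by simp

lemma finite_letters_of: "i \<in> I \<Longrightarrow> finite (letters_of G i)"
  using finite_subset[OF letters_of_subset finite_letters] .

lemma fst_in_index: "u \<in> L \<Longrightarrow> fst u \<in> I"
  by (cases u) (auto simp: letters_iff)

lemma sum_letters: "sum f L = (\<Sum>i\<in>I. sum f (letters_of G i))"
  unfolding letters_def using finite_index finite_letters_of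
  by (intro sum.UNION_disjoint) (auto simp: letters_of_def)

lemma sum_letters_diff:
  fixes f :: "'i \<times> 'a \<Rightarrow> real"
  assumes "i \<in> I" shows "sum f (L - letters_of G i) = sum f L - sum f (letters_of G i)"
  by (rule sum_diff[OF finite_letters letters_of_subset[OF assms]])

lemma letter_inv_letter_inv: "u \<in> L \<Longrightarrow> letter_inv G (letter_inv G u) = u"
  using group_factor
  by (cases u) (auto simp: letter_inv_def letters_iff intro!: group.inv_inv)

lemma letter_inv_mem:
  assumes "u \<in> letters_of G i" "i \<in> I" shows "letter_inv G u \<in> letters_of G i"
proof -
  have "u \<in> L" using assms letters_of_subset by blast
  then show ?thesis
    using letter_inv_in[OF group_factor] assms by (auto simp: mem_letters_of_iff letter_inv_def)
qed

lemma sum_letter_inv: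
  assumes "i \<in> I"
  shows "(\<Sum>u\<in>letters_of G i. f (letter_inv G u)) = sum f (letters_of G i)"
  by (rule sum.reindex_bij_witness[of _ "letter_inv G" "letter_inv G"])
     (use assms letter_inv_mem letter_inv_letter_inv letters_of_subset in \<open>auto simp: subset_iff\<close>)

lemma sum_letter_inv_diff:
  assumes "i \<in> I"
  shows "(\<Sum>u\<in>L - letters_of G i. f (letter_inv G u)) = sum f (L - letters_of G i)"
  by (rule sum.reindex_bij_witness[of _ "letter_inv G" "letter_inv G"])
     (use letter_inv_in[OF group_factor] letter_inv_letter_inv in
       \<open>auto simp: mem_letters_of_iff letter_inv_def\<close>)

abbreviation "factorisations a \<equiv>
  {(u, v). u \<in> L \<and> v \<in> L \<and> [u] \<otimes>\<^bsub>free_product I G\<^esub> [v] = [a]}"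

lemma letter_product_iff:
  assumes u: "u \<in> L" and v: "v \<in> L" and a: "a \<in> L"
  shows "[u] \<otimes>\<^bsub>free_product I G\<^esub> [v] = [a] \<longleftrightarrow>
    fst u = fst a \<and> fst v = fst a \<and> v \<noteq> letter_inv G u \<and>
    (fst u, snd u \<otimes>\<^bsub>G (fst u)\<^esub> snd v) = a"
proof -
  obtain i g j h where e: "u = (i, g)" "v = (j, h)" by (metis surj_pair)
  interpret group "G i" using group_factor u e by (auto simp: letters_iff)
  have "i = j \<Longrightarrow> g \<otimes>\<^bsub>G i\<^esub> h = \<one>\<^bsub>G i\<^esub> \<longleftrightarrow> h = inv\<^bsub>G i\<^esub> g"
    using u v e inv_comm inv_equality r_inv by (metis letters_iff)
  then show ?thesis using e by (auto simp: free_product_def letter_inv_def)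
qed

text \<open>Pairs of letters of one factor whose product is again a letter are all pairs except the
  mutually inverse ones; summing over \<open>a\<close> groups them by their product.\<close>

lemma sum_factorisations:
  fixes p r :: "'i \<times> 'a \<Rightarrow> real"
  assumes i: "i \<in> I"
  shows "(\<Sum>a\<in>letters_of G i. \<Sum>(u, v)\<in>factorisations a. p u * r v) =
    sum p (letters_of G i) * sum r (letters_of G i) -
    (\<Sum>u\<in>letters_of G i. p (letter_inv G u) * r u)"
proof -
  let ?S = "letters_of G i"
  define T where "T = {(u, v). u \<in> ?S \<and> v \<in> ?S \<and> v \<noteq> letter_inv G u}"
  define g where "g = (\<lambda>(u :: 'i \<times> 'a, v :: 'i \<times> 'a). (fst u, snd u \<otimes>\<^bsub>G (fst u)\<^esub> snd v))"
  have sub: "?S \<subseteq> L" by (rule letters_of_subset[OF i])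
  have fin: "finite ?S" by (rule finite_letters_of[OF i])
  have finT: "finite T" using finite_subset[of T "?S \<times> ?S"] fin by (auto simp: T_def)
  interpret group "G i" using group_factor i by blast
  have fact: "factorisations a = {x \<in> T. g x = a}" if "a \<in> ?S" for a
  proof (rule Set.set_eqI)
    fix x :: "('i \<times> 'a) \<times> 'i \<times> 'a"
    obtain u v where x: "x = (u, v)" by (metis surj_pair)
    have a: "a \<in> L" "fst a = i" using that sub by (auto simp: letters_of_def)
    show "x \<in> factorisations a \<longleftrightarrow> x \<in> {x \<in> T. g x = a}"
    proof (cases "u \<in> L \<and> v \<in> L")
      case True
      then show ?thesis
        using letter_product_iff[of u v a] mem_letters_of_iff[of u i] mem_letters_of_iff[of v i] a
        unfolding x T_def g_def by simp
    next
      case False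
      then show ?thesis using sub unfolding x T_def by auto
    qed
  qed
  have im: "g ` T \<subseteq> ?S"
  proof
    fix x assume "x \<in> g ` T"
    then obtain u v where uv: "u \<in> ?S" "v \<in> ?S" "v \<noteq> letter_inv G u" "x = g (u, v)"
      by (auto simp: T_def)
    have "snd u \<otimes>\<^bsub>G i\<^esub> snd v \<noteq> \<one>\<^bsub>G i\<^esub>"
    proof
      assume *: "snd u \<otimes>\<^bsub>G i\<^esub> snd v = \<one>\<^bsub>G i\<^esub>"
      have "snd u \<in> carrier (G i)" "snd v \<in> carrier (G i)"
        using uv by (auto simp: letters_of_def)
      from inv_equality[OF inv_comm[OF * this] this] uv show False
        by (auto simp: letters_of_def letter_inv_def)
    qed
    then show "x \<in> ?S" using uv by (auto simp: g_def letters_of_def)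
  qed
  have "(\<Sum>a\<in>?S. \<Sum>(u, v)\<in>factorisations a. p u * r v) =
      (\<Sum>a\<in>?S. \<Sum>(u, v)\<in>{x \<in> T. g x = a}. p u * r v)"
    by (intro sum.cong refl) (simp only: fact)
  also have "\<dots> = (\<Sum>(u, v)\<in>T. p u * r v)"
    by (rule sum.group[OF finT fin im])
  also have "T = ?S \<times> ?S - (\<lambda>u. (letter_inv G u, u)) ` ?S"
    using sub letter_inv_letter_inv letter_inv_mem[OF _ i]
    by (auto simp: T_def image_iff subset_iff)
  also have "(\<Sum>(u, v)\<in>?S \<times> ?S - (\<lambda>u. (letter_inv G u, u)) ` ?S. p u * r v) =
      (\<Sum>(u, v)\<in>?S \<times> ?S. p u * r v) - (\<Sum>(u, v)\<in>(\<lambda>u. (letter_inv G u, u)) ` ?S. p u * r v)"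
    using fin letter_inv_mem[OF _ i] by (intro sum_diff) auto
  also have "(\<Sum>(u, v)\<in>?S \<times> ?S. p u * r v) = sum p ?S * sum r ?S"
    by (simp add: sum_product sum.cartesian_product)
  also have "(\<Sum>(u, v)\<in>(\<lambda>u. (letter_inv G u, u)) ` ?S. p u * r v) =
      (\<Sum>u\<in>?S. p (letter_inv G u) * r u)"
    by (subst sum.reindex) (auto simp: inj_on_def)
  finally show ?thesis .
qed

end

section \<open>Factor masses, and the equations as stationarity on letters\<close>

context free_product_walk
begin

lemma sum_step: "(\<Sum>u\<in>L. pmf \<mu> u) = 1"
  using sum_pmf_eq_1[OF finite_letters set_pmf_letters] .

text \<open>
  With \<open>m\<^sub>i\<close> the mass of the factor \<open>i\<close> under \<open>\<mu>\<close>, \<open>q\<^sub>i = \<Sum>u. \<mu>(u\<^sup>-\<^sup>1) r(u)\<close> and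
  \<open>e\<^sub>i = m\<^sub>i - k/(k-1) q\<^sub>i\<close>, the sum of the equations over the factor \<open>i\<close> reads
  \<open>R\<^sub>i E = e\<^sub>i (R\<^sub>i + (k-1)/k)\<close>, where \<open>E = \<Sum>i. e\<^sub>i\<close>. If \<open>E \<noteq> 0\<close>, strict concavity of
  \<open>x/(x + (k-1)/k)\<close> forces all \<open>R\<^sub>i\<close> to be equal; if \<open>E = 0\<close>, every factor has
  mass at least \<open>(k-1)/k\<close>.
\<close>

lemma traffic_factor_mass:
  assumes r: "r \<in> open_simplex L" and ste: "stationary_traffic_equations I G \<mu> r"
    and supp: "\<And>i. i \<in> I \<Longrightarrow> \<exists>u\<in>letters_of G i. pmf \<mu> u > 0" and i: "i \<in> I"
  shows "sum r (letters_of G i) = 1 / k"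
proof -
  define R m q where "R i = sum r (letters_of G i)"
    and "m i = (\<Sum>u\<in>letters_of G i. pmf \<mu> u)"
    and "q i = (\<Sum>u\<in>letters_of G i. pmf \<mu> (letter_inv G u) * r u)" for i
  define Q where "Q = (\<Sum>i\<in>I. q i)"
  define c where "c = (k - 1) / k"
  define e where "e i = m i - q i / c" for i
  define E where "E = (\<Sum>i\<in>I. e i)"
  have c: "c > 0" "1 / c = k / (k - 1)" "c + 1 / k = 1" "1 / k \<le> c"
    using k_ge by (simp_all add: c_def field_simps)
  have rpos: "r u > 0" if "u \<in> L" for u using r that by (simp add: open_simplex_def)
  have R1: "(\<Sum>i\<in>I. R i) = 1" using r by (simp add: open_simplex_def sum_letters R_def)
  have m1: "(\<Sum>i\<in>I. m i) = 1" using sum_step by (simp add: sum_letters m_def)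
  have Rpos: "R i > 0" if "i \<in> I" for i
    unfolding R_def using that letters_of_nonempty finite_letters_of
    by (intro sum_pos rpos subsetD[OF letters_of_subset[OF that]])
  have key: "R i * E = e i * (R i + c)" if i: "i \<in> I" for i
  proof -
    have "R i = (\<Sum>a\<in>letters_of G i. pmf \<mu> a * c + (\<Sum>(u, v)\<in>factorisations a. pmf \<mu> u * r v)
        + r a * (1 / c) * (Q - q i))"
      unfolding R_def
    proof (intro sum.cong refl)
      fix a assume a: "a \<in> letters_of G i"
      then have a': "a \<in> L" "fst a = i" using letters_of_subset[OF i] by (auto simp: letters_of_def)
      have "(\<Sum>u\<in>L - letters_of G i. pmf \<mu> (letter_inv G u) * r u) = Q - q i"
        unfolding sum_letters_diff[OF i] Q_def q_def by (simp add: sum_letters)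
      with bspec[OF ste[unfolded stationary_traffic_equations_def] a'(1)] a'(2)
      show "r a = pmf \<mu> a * c + (\<Sum>(u, v)\<in>factorisations a. pmf \<mu> u * r v)
        + r a * (1 / c) * (Q - q i)"
        by (simp add: c c_def)
    qed
    also have "\<dots> = m i * c + (m i * R i - q i) + R i * (1 / c) * (Q - q i)"
      unfolding sum.distrib sum_factorisations[OF i]
      by (simp add: m_def R_def q_def sum_distrib_right sum_divide_distrib)
    finally have *: "R i = m i * c + (m i * R i - q i) + R i * (1 / c) * (Q - q i)" .
    have E: "E = 1 - Q / c"
      unfolding E_def e_def by (simp add: sum_subtractf m1 Q_def sum_divide_distrib)
    have "R i * E = R i - R i * (1 / c) * Q" unfolding E by (simp add: algebra_simps)
    also have "\<dots> = m i * c + m i * R i - q i - R i * (1 / c) * q i"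
      using * by (simp add: algebra_simps diff_divide_distrib)
    also have "\<dots> = e i * (R i + c)" using c by (simp add: e_def field_simps)
    finally show ?thesis .
  qed
  show ?thesis
  proof (cases "E = 0")
    case False
    define d where "d i = R i - 1 / k" for i
    have Rc: "R i + c > 0" if "i \<in> I" for i using Rpos[OF that] c by simp
    have "e i = E * (R i / (R i + c))" if "i \<in> I" for i
      using key[OF that] Rc[OF that] by (simp add: field_simps)
    then have "E = E * (\<Sum>i\<in>I. R i / (R i + c))"
      unfolding sum_distrib_left by (subst E_def) (intro sum.cong refl, blast)
    then have f1: "(\<Sum>i\<in>I. R i / (R i + c)) = 1" using False by simp
    \<comment> \<open>The gap between x/(x + c) and its tangent at x = 1/k, where
      \<open>c + 1 / k = 1\<close> makes the value 1/k and the slope \<open>c\<close>. The tangent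
      values sum to 1, as do the function values, so every gap vanishes.\<close>
    have "c * (d i)\<^sup>2 / (R i + c) = 1 / k + c * (R i - 1 / k) - R i / (R i + c)" if "i \<in> I" for i
    proof -
      have kc: "1 / k = 1 - c" using c by simp
      show ?thesis
        unfolding d_def kc using Rc[OF that] by (simp add: field_simps power2_eq_square)
    qed
    then have "(\<Sum>i\<in>I. c * (d i)\<^sup>2 / (R i + c)) =
        (\<Sum>i\<in>I. 1 / k + c * (R i - 1 / k) - R i / (R i + c))" by (intro sum.cong) auto
    also have "\<dots> = 0"
      using k_ge
      by (simp add: sum.distrib sum_subtractf f1 R1 flip: sum_distrib_left)
    finally have "\<forall>i\<in>I. c * (d i)\<^sup>2 / (R i + c) = 0"
      using Rc c by (subst (asm) sum_nonneg_eq_0_iff[OF finite_index]) (auto intro!: divide_nonneg_pos)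
    then have "d i = 0" using i Rc[OF i] c by auto
    then show ?thesis by (simp add: d_def R_def)
  next
    case True
    \<comment> \<open>With \<open>E = 0\<close> every \<open>e i\<close> vanishes, that is,
      \<open>q i = c * m i\<close>. If \<open>R i < c\<close>, every letter of the factor has
      \<open>r\<close> below \<open>c\<close>, and a letter charged by \<open>\<mu>\<close> makes
      \<open>q i\<close> strictly smaller than \<open>c * m i\<close>.\<close>
    have "c \<le> R i" if i: "i \<in> I" for i
    proof (rule ccontr)
      assume "\<not> c \<le> R i"
      have rc: "r u < c" if "u \<in> letters_of G i" for u
      proof -
        have "r u \<le> R i"
          unfolding R_def using that letters_of_subset[OF i]
          by (intro member_le_sum finite_letters_of[OF i]) (auto intro: less_imp_le rpos)
        then show ?thesis using \<open>\<not> c \<le> R i\<close> by simp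
      qed
      obtain v where v: "v \<in> letters_of G i" "pmf \<mu> v > 0" using supp[OF i] by blast
      have vv: "letter_inv G (letter_inv G v) = v"
        using v letters_of_subset[OF i] by (intro letter_inv_letter_inv) auto
      have v': "letter_inv G v \<in> letters_of G i" by (rule letter_inv_mem[OF v(1) i])
      have "q i < (\<Sum>u\<in>letters_of G i. pmf \<mu> (letter_inv G u) * c)"
        unfolding q_def
      proof (intro sum_strict_mono_ex1 finite_letters_of[OF i] ballI)
        show "\<exists>u\<in>letters_of G i. pmf \<mu> (letter_inv G u) * r u < pmf \<mu> (letter_inv G u) * c"
          by (rule bexI[OF _ v']) (simp add: vv v(2) rc[OF v'])
      qed (simp add: mult_left_mono less_imp_le[OF rc])
      also have "\<dots> = m i * c"
        unfolding m_def by (simp flip: sum_distrib_right add: sum_letter_inv[OF i, of "pmf \<mu>"])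
      finally have "e i > 0" using c by (simp add: e_def field_simps)
      moreover have "e i = 0" using key[OF i] True Rpos[OF i] c by simp
      ultimately show False by simp
    qed
    \<comment> \<open>There are at least two factors, so \<open>c\<close> is at least the average
      mass \<open>1 / k\<close>; masses that are all at least their average equal it.\<close>
    then have "1 / k \<le> R i" if "i \<in> I" for i using that c by force
    moreover have "(\<Sum>i\<in>I. R i - 1 / k) = 0" using k_ge by (simp add: sum_subtractf R1)
    ultimately have "\<forall>i\<in>I. R i - 1 / k = 0"
      by (subst (asm) sum_nonneg_eq_0_iff[OF finite_index]) auto
    then show ?thesis using i by (simp add: R_def)
  qed
qed

text \<open>One step of the action, for any law \<open>N\<close> on reduced words. With
  \<open>w\<close> empty this becomes the right-hand side of the equation at \<open>a\<close>. It is
  applied to the harmonic measure in one direction and to the Markov measure in the other.\<close>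

lemma stationary_sum_cylinder:
  assumes N: "prob_space N" "sets N = sets S"
    and red: "AE \<xi> in N. \<xi> \<in> infinite_reduced_words I G"
    and a: "a \<in> L" and w: "w \<in> lists L"
  shows "(\<Sum>u\<in>L. pmf \<mu> u * measure N {\<xi> \<in> space N. stream_times G u \<xi> \<in> sstart L (a # w)}) =
    pmf \<mu> a * measure N {\<xi> \<in> sstart L w. fst (shd \<xi>) \<noteq> fst a} +
    (\<Sum>(u, v)\<in>factorisations a. pmf \<mu> u * measure N (sstart L (v # w))) +
    (\<Sum>u\<in>L - letters_of G (fst a). pmf \<mu> (letter_inv G u) * measure N (sstart L (u # a # w)))"
proof -
  have m: "stream_times G u \<in> measurable N N" if "u \<in> L" for u
    using measurable_stream_times[OF that] by (simp add: measurable_cong_sets[OF N(2) N(2)])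
  let ?V = "\<lambda>u. {v. v \<in> L \<and> [u] \<otimes>\<^bsub>free_product I G\<^esub> [v] = [a]}"
  have "(\<Sum>u\<in>L. pmf \<mu> u * measure N {\<xi> \<in> space N. stream_times G u \<xi> \<in> sstart L (a # w)}) =
    (\<Sum>u\<in>L. (if u = a then pmf \<mu> a * measure N {\<xi> \<in> sstart L w. fst (shd \<xi>) \<noteq> fst a} else 0) +
      (\<Sum>v\<in>?V u. pmf \<mu> u * measure N (sstart L (v # w))) +
      (if fst u \<noteq> fst a then pmf \<mu> u * measure N (sstart L (letter_inv G u # a # w)) else 0))"
    by (intro sum.cong refl)
       (simp add: measure_stream_times_cylinder[OF N red _ a w m] algebra_simps sum_distrib_left
         del: in_sstart)
  also have "\<dots> = pmf \<mu> a * measure N {\<xi> \<in> sstart L w. fst (shd \<xi>) \<noteq> fst a} +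
    (\<Sum>u\<in>L. \<Sum>v\<in>?V u. pmf \<mu> u * measure N (sstart L (v # w))) +
    (\<Sum>u\<in>L. if fst u \<noteq> fst a then pmf \<mu> u * measure N (sstart L (letter_inv G u # a # w)) else 0)"
    using a finite_letters by (simp add: sum.distrib)
  also have "(\<Sum>u\<in>L. \<Sum>v\<in>?V u. pmf \<mu> u * measure N (sstart L (v # w))) =
    (\<Sum>(u, v)\<in>Sigma L ?V. pmf \<mu> u * measure N (sstart L (v # w)))"
    using finite_letters by (intro sum.Sigma) auto
  also have "Sigma L ?V = factorisations a" by auto
  also have "(\<Sum>u\<in>L. if fst u \<noteq> fst a then pmf \<mu> u * measure N (sstart L (letter_inv G u # a # w)) else 0) =
    (\<Sum>u\<in>L - letters_of G (fst a). pmf \<mu> u * measure N (sstart L (letter_inv G u # a # w)))"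
    using finite_letters by (intro sum.mono_neutral_cong_right) (auto simp: mem_letters_of_iff)
  \<comment> \<open>Substituting the inverse letter names the cancelled head instead of the
    increment, as the equations do.\<close>
  also have "\<dots> = (\<Sum>u\<in>L - letters_of G (fst a).
      pmf \<mu> (letter_inv G u) * measure N (sstart L (letter_inv G (letter_inv G u) # a # w)))"
    by (rule sum_letter_inv_diff[OF fst_in_index[OF a], symmetric])
  also have "\<dots> = (\<Sum>u\<in>L - letters_of G (fst a).
      pmf \<mu> (letter_inv G u) * measure N (sstart L (u # a # w)))"
    by (intro sum.cong refl) (simp add: letter_inv_letter_inv)
  finally show ?thesis .
qed

lemma measure_first_letter:
  assumes N: "prob_space N" "sets N = sets S"
    and B: "B \<in> sets S" and J: "J \<subseteq> L"
  shows "measure N {\<xi> \<in> space N. shd \<xi> \<in> J \<and> \<xi> \<in> B} = (\<Sum>v\<in>J. measure N {\<xi> \<in> B. shd \<xi> = v})"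
proof -
  interpret prob_space N by fact
  have sp: "B \<subseteq> space N" using sets.sets_into_space[OF B] sets_eq_imp_space_eq[OF N(2)] by simp
  have "{\<xi> \<in> B. shd \<xi> = v} = B \<inter> {\<xi> \<in> space N. hd (stake 1 \<xi>) = v}" for v using sp by auto
  moreover have "B \<inter> {\<xi> \<in> space N. hd (stake 1 \<xi>) = v} \<in> sets N" for v
    using B measurable_pred_stake[OF countable_letters N(2), of "\<lambda>w. hd w = v" 1]
    unfolding N(2)[symmetric] pred_def by (rule sets.Int)
  ultimately have "{\<xi> \<in> B. shd \<xi> = v} \<in> sets N" for v by simp
  then have "measure N (\<Union>v\<in>J. {\<xi> \<in> B. shd \<xi> = v}) = (\<Sum>v\<in>J. measure N {\<xi> \<in> B. shd \<xi> = v})"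
    using finite_subset[OF J finite_letters]
    by (intro finite_measure_finite_Union) (auto simp: disjoint_family_on_def)
  moreover have "(\<Union>v\<in>J. {\<xi> \<in> B. shd \<xi> = v}) = {\<xi> \<in> space N. shd \<xi> \<in> J \<and> \<xi> \<in> B}"
    using sp by auto
  ultimately show ?thesis by simp
qed

lemma traffic_of_harmonic:
  assumes tr: "transient I G \<mu>" and r: "r \<in> open_simplex L"
    and mm: "markovian_multiplicative I G r H" and stat: "shift_stationary H"
  shows "stationary_traffic_equations I G \<mu> r"
proof -
  define R where "R i = sum r (letters_of G i)" for i
  have rpos: "r u > 0" if "u \<in> L" for u using r that by (simp add: open_simplex_def)
  have r1: "sum r L = 1" using r by (simp add: open_simplex_def)
  have R1: "(\<Sum>i\<in>I. R i) = 1" using r1 by (simp add: sum_letters R_def)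
  have Rpos: "R i > 0" if "i \<in> I" for i
    unfolding R_def using that letters_of_nonempty finite_letters_of
    by (intro sum_pos rpos subsetD[OF letters_of_subset[OF that]])
  have co: "sum r (L - letters_of G i) = 1 - R i" if "i \<in> I" for i
    using sum_letters_diff[OF that] r1 by (simp add: R_def)
  \<comment> \<open>A second factor carries positive mass; this keeps the denominators
    \<open>1 - R i\<close> nonzero.\<close>
  have R_lt: "R i < 1" if i: "i \<in> I" for i
  proof -
    have "I \<noteq> {i}" using card_index by auto
    then obtain j where j: "j \<in> I" "j \<noteq> i" using i by blast
    have "R i + R j = sum R {i, j}" using j by simp
    also have "\<dots> \<le> (\<Sum>i\<in>I. R i)"
      using i j finite_index Rpos by (intro sum_mono2) (auto intro: less_imp_le)
    finally show ?thesis using Rpos[OF j(1)] R1 by simp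
  qed
  have cyl1: "measure H (sstart L [a]) = r a" if "a \<in> L" for a
    using mm that unfolding markovian_multiplicative_def by (auto simp: reduced_Cons)
  have cyl2: "measure H (sstart L [b, a]) = (if fst b \<noteq> fst a then r b / (1 - R (fst b)) * r a else 0)"
    if "b \<in> L" "a \<in> L" for a b
  proof (cases "fst b = fst a")
    case False
    then have "[b, a] \<in> reduced_words I G" using that by (simp add: reduced_Cons)
    then show ?thesis
      using mm False that co[OF fst_in_index] unfolding markovian_multiplicative_def by auto
  next
    case True
    \<comment> \<open>The Markovian formula speaks of reduced words only; here the cylinder is null
      because the limit word is reduced.\<close>
    have "AE \<xi> in H. \<xi> \<notin> sstart L [b, a]"
      using AE_harmonic_reduced
      by eventually_elim (use True in \<open>auto dest: infinite_reduced_iff[THEN iffD1]\<close>)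
    then have "measure H (sstart L [b, a]) = measure H {}"
      using that sstart_in_sets[OF countable_letters, of "[b, a]"]
      by (intro harmonic.finite_measure_eq_AE) (auto simp: sets_harmonic)
    then show ?thesis using True by simp
  qed
  \<comment> \<open>Shift invariance on the cylinder of one letter \<open>a\<close> of the factor
    \<open>i\<close>, split by the letter in front of \<open>a\<close>; the positive factor
    \<open>r a\<close> cancels.\<close>
  have t: "(\<Sum>j\<in>I - {i}. R j / (1 - R j)) = 1" if i: "i \<in> I" for i
  proof -
    obtain a where a: "a \<in> letters_of G i" using letters_of_nonempty[OF i] by blast
    then have a': "a \<in> L" "fst a = i" using letters_of_subset[OF i] by (auto simp: letters_of_def)
    have c: "sstart L [a] \<in> sets S" using a' by (intro sstart_in_sets countable_letters) auto
    have stl: "stl \<in> measurable H H"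
      by (simp add: measurable_cong_sets[OF sets_harmonic sets_harmonic] measurable_stl)
    have B: "{\<xi> \<in> space H. stl \<xi> \<in> sstart L [a]} \<in> sets S"
      using measurable_sets[OF stl, of "sstart L [a]"] c
      by (simp add: sets_harmonic vimage_def Int_def conj_commute)
    have "r a = measure (distr H H stl) (sstart L [a])"
      using stat cyl1[OF a'(1)] by (simp add: shift_stationary_def)
    also have "\<dots> = measure H {\<xi> \<in> space H. stl \<xi> \<in> sstart L [a]}"
      using c by (subst measure_distr[OF stl]) (auto simp: sets_harmonic vimage_def Int_def conj_commute)
    also have "\<dots> = measure H {\<xi> \<in> space H. shd \<xi> \<in> L \<and> \<xi> \<in> {\<xi> \<in> space H. stl \<xi> \<in> sstart L [a]}}"
      by (intro arg_cong[of _ _ "measure H"]) (auto simp: space_harmonic streams_shd)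
    also have "\<dots> = (\<Sum>b\<in>L. measure H {\<xi> \<in> {\<xi> \<in> space H. stl \<xi> \<in> sstart L [a]}. shd \<xi> = b})"
      by (rule measure_first_letter[OF harmonic.prob_space_axioms sets_harmonic B order_refl])
    also have "\<dots> = (\<Sum>b\<in>L. measure H (sstart L [b, a]))"
    proof (intro sum.cong refl arg_cong[of _ _ "measure H"])
      fix b assume "b \<in> L"
      then show "{\<xi> \<in> {\<xi> \<in> space H. stl \<xi> \<in> sstart L [a]}. shd \<xi> = b} = sstart L [b, a]"
        using sstart_in_streams[of "[b, a]" L] a'(1) by (auto simp: space_harmonic)
    qed
    also have "\<dots> = (\<Sum>b\<in>L. if fst b \<noteq> i then r b / (1 - R (fst b)) * r a else 0)"
      using a' by (intro sum.cong refl) (simp add: cyl2)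
    also have "\<dots> = (\<Sum>b\<in>L. if fst b \<noteq> i then r b / (1 - R (fst b)) else 0) * r a"
      unfolding sum_distrib_right by (intro sum.cong refl) simp
    finally have "(\<Sum>b\<in>L. if fst b \<noteq> i then r b / (1 - R (fst b)) else 0) = 1"
      using rpos[OF a'(1)] by simp
    moreover have "(\<Sum>b\<in>L. if fst b \<noteq> i then r b / (1 - R (fst b)) else 0) =
        (\<Sum>j\<in>I. if j \<noteq> i then R j / (1 - R j) else 0)"
      unfolding sum_letters
    proof (intro sum.cong refl)
      fix j
      have "(\<Sum>b\<in>letters_of G j. if fst b \<noteq> i then r b / (1 - R (fst b)) else 0) =
          (\<Sum>b\<in>letters_of G j. if j \<noteq> i then r b / (1 - R j) else 0)"
        by (intro sum.cong refl) (auto simp: letters_of_def)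
      then show "(\<Sum>b\<in>letters_of G j. if fst b \<noteq> i then r b / (1 - R (fst b)) else 0) =
          (if j \<noteq> i then R j / (1 - R j) else 0)"
        by (simp add: R_def sum_divide_distrib)
    qed
    moreover have "\<dots> = (\<Sum>j\<in>I - {i}. R j / (1 - R j))"
      using finite_index by (intro sum.mono_neutral_cong_right) auto
    ultimately show ?thesis by simp
  qed
  have R: "R i = 1 / k" if i: "i \<in> I" for i
  proof -
    \<comment> \<open>By \<open>t\<close>, every term of \<open>T\<close> equals
      \<open>T - 1\<close>, so \<open>T = k * (T - 1)\<close>. The common odds
      \<open>1 / (k - 1)\<close> belong to the mass \<open>1 / k\<close>.\<close>
    define T where "T = (\<Sum>j\<in>I. R j / (1 - R j))"
    have tj: "R j / (1 - R j) = T - 1" if "j \<in> I" for j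
      using t[OF that] sum.remove[OF finite_index that, of "\<lambda>j. R j / (1 - R j)"]
      by (simp add: T_def)
    have "T = k * (T - 1)" using tj by (subst T_def) simp
    then have T: "T - 1 = 1 / (k - 1)" using k_ge by (simp add: field_simps)
    have "R i * (k - 1) = 1 - R i"
      using tj[OF i] R_lt[OF i] k_ge unfolding T by (simp add: field_simps)
    then show ?thesis using k_ge by (simp add: field_simps)
  qed
  show ?thesis
    unfolding stationary_traffic_equations_def
  proof (intro ballI)
    fix a assume a: "a \<in> L"
    note ia = fst_in_index[OF a]
    have "streams L \<in> sets S" using sets.top[of S] by (simp add: space_S)
    then have "measure H {\<xi> \<in> space H. shd \<xi> \<in> L - letters_of G (fst a) \<and> \<xi> \<in> streams L} =
        (\<Sum>v\<in>L - letters_of G (fst a). measure H {\<xi> \<in> streams L. shd \<xi> = v})"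
      by (intro measure_first_letter harmonic.prob_space_axioms sets_harmonic) auto
    also have "\<dots> = (\<Sum>v\<in>L - letters_of G (fst a). r v)"
    proof (intro sum.cong refl)
      fix v assume v: "v \<in> L - letters_of G (fst a)"
      have "{\<xi> \<in> streams L. shd \<xi> = v} = sstart L [v]"
        using v sstart_in_streams[of "[v]" L] by (auto simp: streams_stl)
      then show "measure H {\<xi> \<in> streams L. shd \<xi> = v} = r v" using cyl1 v by simp
    qed
    also have "\<dots> = (k - 1) / k" using co[OF ia] R[OF ia] k_ge by (simp add: field_simps)
    also have "{\<xi> \<in> space H. shd \<xi> \<in> L - letters_of G (fst a) \<and> \<xi> \<in> streams L} =
        {\<xi> \<in> sstart L []. fst (shd \<xi>) \<noteq> fst a}"
      by (auto simp: space_harmonic streams_shd mem_letters_of_iff)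
    finally have 1: "measure H {\<xi> \<in> sstart L []. fst (shd \<xi>) \<noteq> fst a} = (k - 1) / k" .
    have 2: "(\<Sum>(u, v)\<in>factorisations a. pmf \<mu> u * measure H (sstart L [v])) =
        (\<Sum>(u, v)\<in>factorisations a. pmf \<mu> u * r v)"
      by (intro sum.cong refl) (auto simp: cyl1)
    have 3: "(\<Sum>u\<in>L - letters_of G (fst a). pmf \<mu> (letter_inv G u) * measure H (sstart L [u, a])) =
        r a * (k / (k - 1)) * (\<Sum>u\<in>L - letters_of G (fst a). pmf \<mu> (letter_inv G u) * r u)"
      unfolding sum_distrib_left
    proof (intro sum.cong refl)
      fix u assume u: "u \<in> L - letters_of G (fst a)"
      then have "fst u \<noteq> fst a" by (auto simp: mem_letters_of_iff)
      moreover have "1 - R (fst u) = (k - 1) / k"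
        using u R[OF fst_in_index, of u] k_ge by (simp add: field_simps)
      ultimately have "measure H (sstart L [u, a]) = r u * (k / (k - 1)) * r a"
        using u a by (simp add: cyl2)
      then show "pmf \<mu> (letter_inv G u) * measure H (sstart L [u, a]) =
          r a * (k / (k - 1)) * (pmf \<mu> (letter_inv G u) * r u)" by simp
    qed
    have "r a = (\<Sum>u\<in>L. pmf \<mu> u * measure H {\<xi> \<in> space H. stream_times G u \<xi> \<in> sstart L [a]})"
      using harmonic_stationary[OF tr sstart_in_sets[OF countable_letters, of "[a]"]] cyl1 a by simp
    also have "\<dots> = pmf \<mu> a * ((k - 1) / k) + (\<Sum>(u, v)\<in>factorisations a. pmf \<mu> u * r v) +
        r a * (k / (k - 1)) * (\<Sum>u\<in>L - letters_of G (fst a). pmf \<mu> (letter_inv G u) * r u)"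
      unfolding 2[symmetric] 3[symmetric] 1[symmetric]
      by (rule stationary_sum_cylinder[OF harmonic.prob_space_axioms sets_harmonic AE_harmonic_reduced a])
         simp
    finally show "r a = pmf \<mu> a * ((k - 1) / k) + (\<Sum>(u, v)\<in>factorisations a. pmf \<mu> u * r v) +
        r a * (k / (k - 1)) * (\<Sum>u\<in>L - letters_of G (fst a). pmf \<mu> (letter_inv G u) * r u)" .
  qed
qed

end

text \<open>A stream that is not reduced lies in the cylinder of some finite non-reduced prefix, and
  there are countably many of these.\<close>

lemma AE_reduced_of_cylinders:
  assumes S: "countable (letters I G)" and "prob_space N"
    and sets: "sets N = sets (stream_space (count_space (letters I G)))"
    and null: "\<And>w. w \<in> lists (letters I G) \<Longrightarrow> w \<notin> reduced_words I G \<Longrightarrow>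
      measure N (sstart (letters I G) w) = 0"
  shows "AE \<xi> in N. \<xi> \<in> infinite_reduced_words I G"
proof -
  interpret prob_space N by fact
  let ?W = "lists (letters I G) - reduced_words I G"
  have "AE \<xi> in N. \<xi> \<notin> sstart (letters I G) w" if "w \<in> ?W" for w
    using that null sstart_in_sets[OF S]
    by (intro AE_not_in null_setsI) (auto simp: emeasure_eq_measure sets)
  then have "AE \<xi> in N. \<forall>w\<in>?W. \<xi> \<notin> sstart (letters I G) w"
    using countable_subset[OF _ countable_lists[OF S], of ?W] by (subst AE_ball_countable) auto
  with AE_space show ?thesis
  proof eventually_elim
    case (elim \<xi>)
    then have \<xi>: "\<xi> \<in> streams (letters I G)"
      using sets_eq_imp_space_eq[OF sets] by (simp add: space_stream_space)
    have "stake n \<xi> \<in> reduced_words I G" for n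
    proof (rule ccontr)
      assume "stake n \<xi> \<notin> reduced_words I G"
      moreover have "stake n \<xi> \<in> lists (letters I G)"
        using \<xi> set_stake_subset[of n \<xi>] by (auto simp: streams_iff_sset)
      moreover have "\<xi> \<in> sstart (letters I G) (stake n \<xi>)"
        by (simp add: in_sstart_iff_stake[OF \<xi>])
      ultimately show False using elim by blast
    qed
    then show ?case by (simp add: infinite_reduced_words_def)
  qed
qed

context free_product_walk
begin

text \<open>As a function of \<open>B\<close> the right-hand side is itself a measure, the
  \<open>\<mu>\<close>-mixture \<open>M\<close> of the images of \<open>N\<close> under the letters,
  so agreement on cylinders is enough.\<close>

lemma stationary_of_cylinders:
  assumes N: "prob_space N" "sets N = sets S"
    and cyl: "\<And>w. w \<in> lists L \<Longrightarrow> measure N (sstart L w) =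
      (\<Sum>u\<in>L. pmf \<mu> u * measure N {\<xi> \<in> space N. stream_times G u \<xi> \<in> sstart L w})"
    and B: "B \<in> sets S"
  shows "measure N B = (\<Sum>u\<in>L. pmf \<mu> u * measure N {\<xi> \<in> space N. stream_times G u \<xi> \<in> B})"
proof -
  interpret prob_space N by fact
  have m: "stream_times G u \<in> measurable N S" if "u \<in> L" for u
    using measurable_stream_times[OF that] by (simp add: measurable_cong_sets[OF N(2) refl])
  define f where "f u = distr N S (stream_times G u)" for u
  have f: "f \<in> measurable step (subprob_algebra S)"
  proof -
    have "f u \<in> space (subprob_algebra S)" if "u \<in> L" for u
      using prob_space_distr[OF m[OF that]]
      by (simp add: f_def space_subprob_algebra prob_space_imp_subprob_space)
    then show ?thesis by (simp add: measurable_cong_sets[OF sets_step refl])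
  qed
  have ne: "space step \<noteq> {}" using prob_space.not_empty[OF prob_space_step] .
  define M where "M = step \<bind> f"
  have sub: "subprob_space M"
    unfolding M_def
    by (rule subprob_space_bind[OF prob_space_imp_subprob_space[OF prob_space_step] f])
  have setsM: "sets M = sets S" unfolding M_def by (rule sets_bind[OF _ ne]) (auto simp: f_def)
  interpret M: subprob_space M by fact
  have M: "measure M B = (\<Sum>u\<in>L. pmf \<mu> u * measure N {\<xi> \<in> space N. stream_times G u \<xi> \<in> B})"
    if B: "B \<in> sets S" for B
  proof -
    have "emeasure M B = (\<integral>\<^sup>+u. emeasure (f u) B \<partial>step)"
      unfolding M_def by (rule emeasure_bind[OF ne f B])
    also have "\<dots> = (\<Sum>u\<in>L. ennreal (pmf \<mu> u) * emeasure (f u) B)" by (rule nn_integral_step)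
    also have "\<dots> = (\<Sum>u\<in>L. ennreal (pmf \<mu> u * measure N {\<xi> \<in> space N. stream_times G u \<xi> \<in> B}))"
      using emeasure_distr[OF m B]
      by (intro sum.cong refl)
         (simp add: f_def emeasure_eq_measure ennreal_mult' vimage_def Int_def conj_commute)
    also have "\<dots> = ennreal (\<Sum>u\<in>L. pmf \<mu> u * measure N {\<xi> \<in> space N. stream_times G u \<xi> \<in> B})"
      by (simp add: sum_ennreal)
    finally show ?thesis by (simp add: M.emeasure_eq_measure sum_nonneg)
  qed
  have "N = M"
    using M cyl sstart_in_sets[OF countable_letters]
    by (intro stream_measure_eqI[OF countable_letters] N setsM finite_measure_axioms M.finite_measure_axioms) auto
  then show ?thesis using M[OF B] by simp
qed

end

section \<open>The Markov measure for equal factor masses: shift invariance and ergodicity\<close>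

locale equal_mass_walk = free_product_walk I G \<mu>
  for I :: "'i set" and G :: "'i \<Rightarrow> ('a, 'b) monoid_scheme" and \<mu> :: "('i \<times> 'a) pmf" +
  fixes r :: "'i \<times> 'a \<Rightarrow> real"
  assumes r: "r \<in> open_simplex (letters I G)"
    and factor_mass: "\<And>i. i \<in> I \<Longrightarrow> sum r (letters_of G i) = 1 / real (card I)"
begin

text \<open>The inverse of \<open>1 - 1 / k\<close>, the mass of all letters outside a given factor,
  and thus the normalisation of every transition.\<close>

definition \<kappa> :: real where
  "\<kappa> = k / (k - 1)"

lemma r_pos: "u \<in> L \<Longrightarrow> r u > 0" and r_sum: "sum r L = 1"
  using r by (auto simp: open_simplex_def)

lemma r_nonneg: "u \<in> L \<Longrightarrow> r u \<ge> 0"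
  using r_pos less_imp_le by metis

lemma \<kappa>_pos: "\<kappa> > 0"
  using k_ge by (simp add: \<kappa>_def)

lemma sum_r_diff: "i \<in> I \<Longrightarrow> sum r (L - letters_of G i) = 1 / \<kappa>"
  using sum_letters_diff[of i r] factor_mass[of i] r_sum k_ge by (simp add: \<kappa>_def field_simps)

lemma sum_r_other:
  assumes "a \<in> L" shows "(\<Sum>v\<in>L. if fst v \<noteq> fst a then r v else 0) = 1 / \<kappa>"
proof -
  have "(\<Sum>v\<in>L. if fst v \<noteq> fst a then r v else 0) = sum r (L - letters_of G (fst a))"
    using finite_letters by (intro sum.mono_neutral_cong_right) (auto simp: mem_letters_of_iff)
  then show ?thesis using sum_r_diff[OF fst_in_index[OF assms]] by simp
qed

definition letter_pmf :: "('i \<times> 'a) pmf" where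
  "letter_pmf = embed_pmf (\<lambda>v. if v \<in> L then r v else 0)"

definition letter_kernel :: "('i \<times> 'a) option \<Rightarrow> ('i \<times> 'a) pmf" where
  "letter_kernel s =
     (case s of None \<Rightarrow> letter_pmf | Some u \<Rightarrow> cond_pmf letter_pmf {v. fst v \<noteq> fst u})"

lemma pmf_letter_pmf: "pmf letter_pmf v = (if v \<in> L then r v else 0)"
  unfolding letter_pmf_def
proof (rule pmf_embed_pmf)
  show "0 \<le> (if v \<in> L then r v else 0)" for v by (simp add: r_nonneg)
  have "(\<integral>\<^sup>+v. ennreal (if v \<in> L then r v else 0) \<partial>count_space UNIV) = (\<Sum>v\<in>L. ennreal (r v))"
    using finite_letters
    by (subst nn_integral_count_space'[of L]) auto
  also have "\<dots> = 1" using r_sum by (subst sum_ennreal) (simp_all add: r_nonneg)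
  finally show "(\<integral>\<^sup>+v. ennreal (if v \<in> L then r v else 0) \<partial>count_space UNIV) = 1" .
qed

lemma set_letter_pmf: "set_pmf letter_pmf = L"
  using r_pos by (force simp: set_pmf_eq pmf_letter_pmf)

lemma other_letter:
  assumes a: "a \<in> L" shows "\<exists>v\<in>L. fst v \<noteq> fst a"
proof (rule ccontr)
  assume "\<not> (\<exists>v\<in>L. fst v \<noteq> fst a)"
  then have "(\<Sum>v\<in>L. if fst v \<noteq> fst a then r v else 0) = 0" by (intro sum.neutral) auto
  then show False using sum_r_other[OF a] \<kappa>_pos by simp
qed

lemma pmf_letter_kernel_None: "pmf (letter_kernel None) v = (if v \<in> L then r v else 0)"
  by (simp add: letter_kernel_def pmf_letter_pmf)

lemma
  assumes a: "a \<in> L"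
  shows pmf_letter_kernel_Some:
      "v \<in> L \<Longrightarrow> pmf (letter_kernel (Some a)) v = (if fst v \<noteq> fst a then \<kappa> * r v else 0)"
    and set_letter_kernel_Some: "set_pmf (letter_kernel (Some a)) \<subseteq> L"
proof -
  have ne: "set_pmf letter_pmf \<inter> {v. fst v \<noteq> fst a} \<noteq> {}"
    using other_letter[OF a] by (auto simp: set_letter_pmf)
  have "measure letter_pmf {v. fst v \<noteq> fst a} = measure letter_pmf (L - letters_of G (fst a))"
    by (intro measure_pmf.finite_measure_eq_AE)
       (auto simp: AE_measure_pmf_iff set_letter_pmf mem_letters_of_iff)
  also have "\<dots> = (\<Sum>v\<in>L - letters_of G (fst a). pmf letter_pmf v)"
    using finite_letters by (intro measure_measure_pmf_finite) auto
  also have "\<dots> = 1 / \<kappa>"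
    using sum_r_diff[OF fst_in_index[OF a]] by (simp add: pmf_letter_pmf)
  finally show "v \<in> L \<Longrightarrow> pmf (letter_kernel (Some a)) v = (if fst v \<noteq> fst a then \<kappa> * r v else 0)"
    using pmf_cond[OF ne, of v] by (simp add: letter_kernel_def pmf_letter_pmf)
  show "set_pmf (letter_kernel (Some a)) \<subseteq> L"
    using set_cond_pmf[OF ne] by (auto simp: letter_kernel_def set_letter_pmf)
qed

definition base_letter :: "'i \<times> 'a" where
  "base_letter = (SOME u. u \<in> L)"

sublocale chain: markov_kernel L base_letter letter_kernel
proof
  show "base_letter \<in> L"
    unfolding base_letter_def using r_sum by (metis sum.empty zero_neq_one some_in_eq)
  fix s :: "('i \<times> 'a) option" assume "s \<in> insert None (Some ` L)"
  then show "set_pmf (letter_kernel s) \<subseteq> L"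
    using set_letter_kernel_Some by (cases s) (auto simp: letter_kernel_def[of None] set_letter_pmf)
qed (rule finite_letters)

abbreviation "\<nu> \<equiv> markov_measure L base_letter letter_kernel"
abbreviation "\<nu>\<^sub>0 \<equiv> \<nu> None"

lemma sets_\<nu>: "sets (\<nu> s) = sets S"
  by (rule sets_markov_measure)

lemma space_\<nu>: "space (\<nu> s) = streams L"
  by (rule space_markov_measure)

sublocale \<nu>: prob_space "\<nu> s" for s
  by (rule chain.prob_space_markov_measure)

lemma measure_\<nu>_streams: "measure (\<nu> s) (streams L) = 1"
  using \<nu>.prob_space[of s] unfolding space_\<nu> .

lemma measure_\<nu>\<^sub>0:
  assumes "B \<in> sets S"
  shows "measure \<nu>\<^sub>0 B = (\<Sum>v\<in>L. r v * measure (\<nu> (Some v)) {\<xi> \<in> streams L. v ## \<xi> \<in> B})"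
  using chain.measure_markov_measure[OF _ assms, of None]
  by (simp add: pmf_letter_kernel_None cong: sum.cong)

lemma first_letter_in_sets: "B \<in> sets S \<Longrightarrow> {\<xi> \<in> B. fst (shd \<xi>) \<noteq> i} \<in> sets S"
proof -
  assume B: "B \<in> sets S"
  then have "{\<xi> \<in> B. fst (shd \<xi>) \<noteq> i} = B \<inter> {\<xi> \<in> space S. fst (hd (stake 1 \<xi>)) \<noteq> i}"
    using sets.sets_into_space[OF B] by auto
  then show ?thesis
    using B measurable_pred_stake[OF countable_letters refl, of "\<lambda>w. fst (hd w) \<noteq> i" 1]
    by (simp add: pred_def sets.Int)
qed

text \<open>Since the normalisation is the same for every letter, the chain after \<open>a\<close>
  is \<open>\<nu>\<^sub>0\<close> conditioned on leaving the factor of \<open>a\<close>; in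
  particular it depends on \<open>a\<close> only through that factor.\<close>

lemma measure_\<nu>_Some:
  assumes a: "a \<in> L" and B: "B \<in> sets S"
  shows "measure (\<nu> (Some a)) B = \<kappa> * measure \<nu>\<^sub>0 {\<xi> \<in> B. fst (shd \<xi>) \<noteq> fst a}"
proof -
  have "measure (\<nu> (Some a)) B =
      (\<Sum>v\<in>L. \<kappa> * (r v * measure (\<nu> (Some v)) {\<xi> \<in> streams L. v ## \<xi> \<in> {\<xi> \<in> B. fst (shd \<xi>) \<noteq> fst a}}))"
    using chain.measure_markov_measure[OF _ B, of "Some a"] a
    by (auto simp: pmf_letter_kernel_Some intro!: sum.cong)
  then show ?thesis
    using measure_\<nu>\<^sub>0[OF first_letter_in_sets[OF B]] by (simp add: sum_distrib_left)
qed

lemma cylinder_in_sets: "w \<in> lists L \<Longrightarrow> sstart L w \<in> sets S"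
  by (rule sstart_in_sets[OF countable_letters])

lemma measure_\<nu>\<^sub>0_Cons:
  assumes "a \<in> L" "w \<in> lists L"
  shows "measure \<nu>\<^sub>0 (sstart L (a # w)) = r a * measure (\<nu> (Some a)) (sstart L w)"
proof -
  have "{\<xi> \<in> sstart L (a # w). stl \<xi> \<in> streams L} = sstart L (a # w)"
    using assms sstart_in_streams[of "a # w" L] by (auto simp: streams_stl)
  moreover have "sstart L w \<inter> streams L = sstart L w"
    using assms sstart_in_streams[of w L] by auto
  moreover have "streams L \<in> sets S" using sets.top[of S] by (simp add: space_S)
  ultimately show ?thesis
    using chain.measure_markov_measure_Cons[of None a "streams L" w] assms
    by (simp add: pmf_letter_kernel_None)
qed

lemma measure_\<nu>_Some_Cons:
  assumes "a \<in> L" "b \<in> L" "w \<in> lists L"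
  shows "measure (\<nu> (Some a)) (sstart L (b # w)) =
    (if fst b \<noteq> fst a then \<kappa> * measure \<nu>\<^sub>0 (sstart L (b # w)) else 0)"
proof -
  have "{\<xi> \<in> sstart L (b # w). fst (shd \<xi>) \<noteq> fst a} =
      (if fst b \<noteq> fst a then sstart L (b # w) else {})" by auto
  then show ?thesis
    using measure_\<nu>_Some[OF assms(1) cylinder_in_sets, of "b # w"] assms(2,3) by simp
qed

lemma measure_\<nu>\<^sub>0_not_reduced:
  "w \<in> lists L \<Longrightarrow> w \<notin> reduced_words I G \<Longrightarrow> measure \<nu>\<^sub>0 (sstart L w) = 0"
proof (induction w)
  case (Cons a w)
  show ?case
  proof (cases w)
    case Nil
    then show ?thesis using Cons by (simp add: reduced_Cons)
  next
    case (Cons b w')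
    have "fst b = fst a \<or> w \<notin> reduced_words I G"
      using Cons.prems Cons by (auto simp: reduced_Cons)
    then show ?thesis
      using Cons.prems Cons.IH Cons by (auto simp: measure_\<nu>\<^sub>0_Cons measure_\<nu>_Some_Cons simp del: in_sstart)
  qed
qed simp

lemma AE_\<nu>\<^sub>0_reduced: "AE \<xi> in \<nu>\<^sub>0. \<xi> \<in> infinite_reduced_words I G"
  by (rule AE_reduced_of_cylinders[OF countable_letters \<nu>.prob_space_axioms sets_\<nu> measure_\<nu>\<^sub>0_not_reduced])

lemma markovian_multiplicative_\<nu>\<^sub>0: "markovian_multiplicative I G r \<nu>\<^sub>0"
  unfolding markovian_multiplicative_def
proof (intro conjI ballI impI)
  fix u assume "u \<in> reduced_words I G" "u \<noteq> []"
  then show "measure \<nu>\<^sub>0 (sstart L u) =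
      (\<Prod>j<length u - 1. r (u ! j) / sum r (L - letters_of G (fst (u ! j)))) * r (last u)"
  proof (induction u)
    case (Cons a w)
    have a: "a \<in> L" and w: "w \<in> lists L" "w \<in> reduced_words I G"
      using Cons.prems by (simp_all add: reduced_Cons) (auto simp: reduced_words_def)
    show ?case
    proof (cases w)
      case Nil
      then show ?thesis using a by (simp add: measure_\<nu>\<^sub>0_Cons measure_\<nu>_streams)
    next
      case (Cons b w')
      have "measure \<nu>\<^sub>0 (sstart L (a # w)) = r a * \<kappa> * measure \<nu>\<^sub>0 (sstart L w)"
        using a w Cons Cons.prems(1)
        by (auto simp: measure_\<nu>\<^sub>0_Cons[OF a] measure_\<nu>_Some_Cons reduced_Cons simp del: in_sstart)
      also have "r a * \<kappa> = r a / sum r (L - letters_of G (fst a))"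
        using sum_r_diff[OF fst_in_index[OF a]] by simp
      finally show ?thesis
        using Cons.IH[OF w(2)] Cons by (simp add: prod.lessThan_Suc_shift del: prod.lessThan_Suc)
    qed
  qed simp
qed (use sets_\<nu> \<nu>.prob_space_axioms AE_\<nu>\<^sub>0_reduced in auto)

text \<open>The letters that may precede \<open>b\<close> are those of the other factors. Their
  total mass \<open>1 / \<kappa>\<close> is independent of \<open>b\<close> and compensates the
  factor \<open>\<kappa>\<close> of the transition.\<close>

lemma shift_stationary_\<nu>\<^sub>0: "shift_stationary \<nu>\<^sub>0"
  unfolding shift_stationary_def
proof (rule stream_measure_eqI[OF countable_letters])
  have stl: "stl \<in> measurable \<nu>\<^sub>0 \<nu>\<^sub>0"
    by (simp add: measurable_cong_sets[OF sets_\<nu> sets_\<nu>] measurable_stl)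
  show "finite_measure (distr \<nu>\<^sub>0 \<nu>\<^sub>0 stl)"
    using \<nu>.prob_space_distr[OF stl] by (simp add: prob_space_def)
  fix w assume w: "w \<in> lists L"
  have c: "sstart L w \<in> sets \<nu>\<^sub>0" using cylinder_in_sets[OF w] by (simp add: sets_\<nu>)
  have "measure (distr \<nu>\<^sub>0 \<nu>\<^sub>0 stl) (sstart L w) = measure \<nu>\<^sub>0 {\<xi> \<in> streams L. stl \<xi> \<in> sstart L w}"
    by (subst measure_distr[OF stl c]) (simp add: space_\<nu> vimage_def Int_def conj_commute)
  also have "\<dots> = (\<Sum>v\<in>L. r v * measure (\<nu> (Some v)) {\<xi> \<in> streams L. v ## \<xi> \<in> {\<xi> \<in> streams L. stl \<xi> \<in> sstart L w}})"
    using measurable_sets[OF stl c]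
    by (intro measure_\<nu>\<^sub>0) (simp add: sets_\<nu> space_\<nu> vimage_def Int_def conj_commute)
  also have "\<dots> = (\<Sum>v\<in>L. r v * measure (\<nu> (Some v)) (sstart L w))"
    using sstart_in_streams[OF w]
    by (intro sum.cong refl arg_cong2[where f = "(*)"] arg_cong2[where f = measure])
       (auto simp: streams_Stream)
  also have "\<dots> = measure \<nu>\<^sub>0 (sstart L w)"
  proof (cases w)
    case Nil
    then show ?thesis using r_sum by (simp add: measure_\<nu>_streams)
  next
    case (Cons b w')
    then have bw: "b \<in> L" "w' \<in> lists L" using w by auto
    have "(\<Sum>v\<in>L. r v * measure (\<nu> (Some v)) (sstart L w)) =
        (\<Sum>v\<in>L. (if fst v \<noteq> fst b then r v else 0) * (\<kappa> * measure \<nu>\<^sub>0 (sstart L w)))"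
      unfolding Cons using bw by (intro sum.cong refl) (auto simp: measure_\<nu>_Some_Cons)
    also have "\<dots> = (1 / \<kappa>) * (\<kappa> * measure \<nu>\<^sub>0 (sstart L w))"
      by (simp only: sum_r_other[OF bw(1)] flip: sum_distrib_right)
    finally show ?thesis using \<kappa>_pos by simp
  qed
  finally show "measure (distr \<nu>\<^sub>0 \<nu>\<^sub>0 stl) (sstart L w) = measure \<nu>\<^sub>0 (sstart L w)" .
qed (auto simp: sets_\<nu> \<nu>.finite_measure_axioms)

text \<open>
  For an invariant set \<open>A\<close> the function \<open>a \<mapsto> \<nu>\<^sub>a(A)\<close> is harmonic for the chain on letters,
  hence constant, so \<open>A\<close> is independent of all cylinders and therefore of itself.
\<close>

lemma shift_ergodic_\<nu>\<^sub>0: "shift_ergodic \<nu>\<^sub>0"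
  unfolding shift_ergodic_def
proof (intro ballI impI)
  fix A assume A: "A \<in> sets \<nu>\<^sub>0" and inv: "stl -` A \<inter> space \<nu>\<^sub>0 = A"
  have A': "A \<in> sets S" using A by (simp add: sets_\<nu>)
  have sub: "A \<subseteq> streams L" using sets.sets_into_space[OF A'] by (simp add: space_S)
  have inv': "\<xi> \<in> A \<longleftrightarrow> stl \<xi> \<in> A" if "\<xi> \<in> streams L" for \<xi>
    using that inv by (auto simp: space_\<nu>)
  have shift: "{\<xi> \<in> streams L. v ## \<xi> \<in> A} = A" if "v \<in> L" for v
    using that sub inv'[of "v ## _"] by (auto simp: streams_Stream)
  define h where "h u = measure (\<nu> (Some u)) A" for u
  define T where "T = (\<Sum>v\<in>L. r v * h v)"
  have \<nu>\<^sub>0: "measure \<nu>\<^sub>0 A = T"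
    unfolding T_def h_def using measure_\<nu>\<^sub>0[OF A'] shift by (simp cong: sum.cong)
  have h: "h u = \<kappa> * (T - (\<Sum>v\<in>letters_of G (fst u). r v * h v))" if u: "u \<in> L" for u
  proof -
    have "h u = (\<Sum>v\<in>L. pmf (letter_kernel (Some u)) v * h v)"
      unfolding h_def using chain.measure_markov_measure[OF _ A', of "Some u"] u shift
      by (simp cong: sum.cong)
    also have "\<dots> = (\<Sum>v\<in>L. if fst v \<noteq> fst u then \<kappa> * (r v * h v) else 0)"
      by (intro sum.cong refl) (simp add: pmf_letter_kernel_Some[OF u])
    also have "\<dots> = (\<Sum>v\<in>L - letters_of G (fst u). \<kappa> * (r v * h v))"
      using finite_letters by (intro sum.mono_neutral_cong_right) (auto simp: mem_letters_of_iff)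
    also have "\<dots> = \<kappa> * (T - (\<Sum>v\<in>letters_of G (fst u). r v * h v))"
      unfolding T_def sum_letters_diff[OF fst_in_index[OF u], symmetric] by (simp add: sum_distrib_left)
    finally show ?thesis .
  qed
  have hT: "h u = T" if u: "u \<in> L" for u
  proof -
    \<comment> \<open>By \<open>h\<close> the value depends on the factor only, so it leaves the
      sum, and equal masses turn harmonicity into a linear equation whose only solution is
      \<open>T\<close>.\<close>
    have "(\<Sum>v\<in>letters_of G (fst u). r v * h v) = (\<Sum>v\<in>letters_of G (fst u). r v * h u)"
    proof (intro sum.cong refl)
      fix v assume "v \<in> letters_of G (fst u)"
      then have "v \<in> L" "fst v = fst u"
        using letters_of_subset[OF fst_in_index[OF u]] by (auto simp: letters_of_def)
      then show "r v * h v = r v * h u" using h u by simp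
    qed
    also have "\<dots> = h u / k"
      using factor_mass[OF fst_in_index[OF u]] by (simp flip: sum_distrib_right)
    finally have "h u = \<kappa> * (T - h u / k)" using h[OF u] by simp
    then have "h u * (k - 1) = k * T - h u" using k_ge by (simp add: \<kappa>_def field_simps)
    then have "k * h u = k * T" by (simp add: algebra_simps)
    then show ?thesis using k_ge by simp
  qed
  have ind: "measure (\<nu> s) (A \<inter> sstart L w) = T * measure (\<nu> s) (sstart L w)"
    if "w \<in> lists L" "s \<in> insert None (Some ` L)" for w s
    using that
  proof (induction w arbitrary: s rule: list.induct)
    case Nil
    then have "measure (\<nu> s) A = T" using hT \<nu>\<^sub>0 by (auto simp: h_def)
    then show ?case
      using sub by (simp add: measure_\<nu>_streams Int_absorb2)
  next
    case (Cons v w)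
    have v: "v \<in> L" "w \<in> lists L" using Cons.prems by auto
    have cs: "sstart L (v # w) \<subseteq> streams L" using sstart_in_streams[of "v # w" L] v by auto
    have "A \<inter> sstart L (v # w) = {\<xi> \<in> sstart L (v # w). stl \<xi> \<in> A}"
      using inv' cs by blast
    then have "measure (\<nu> s) (A \<inter> sstart L (v # w)) =
        pmf (letter_kernel s) v * measure (\<nu> (Some v)) (sstart L w \<inter> A)"
      using chain.measure_markov_measure_Cons[OF Cons.prems(2) v(1) A' v(2)] by simp
    also have "\<dots> = T * (pmf (letter_kernel s) v * measure (\<nu> (Some v)) (sstart L w \<inter> streams L))"
      using Cons.IH[of "Some v"] v sstart_in_streams[OF v(2)]
      by (simp add: Int_commute Int_absorb1)
    also have "pmf (letter_kernel s) v * measure (\<nu> (Some v)) (sstart L w \<inter> streams L) =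
        measure (\<nu> s) {\<xi> \<in> sstart L (v # w). stl \<xi> \<in> streams L}"
      using sets.top[of S]
      by (intro chain.measure_markov_measure_Cons[symmetric] Cons.prems v) (simp add: space_S)
    also have "{\<xi> \<in> sstart L (v # w). stl \<xi> \<in> streams L} = sstart L (v # w)"
      using cs by (auto simp: streams_stl)
    finally show ?case .
  qed
  show "measure \<nu>\<^sub>0 A = 0 \<or> measure \<nu>\<^sub>0 A = 1"
  proof (cases "T = 0")
    case False
    have eA: "emeasure \<nu>\<^sub>0 A \<noteq> 0" using False \<nu>\<^sub>0 measure_nonneg[of "\<nu>\<^sub>0" A]
      by (simp add: \<nu>.emeasure_eq_measure ennreal_eq_0_iff)
    \<comment> \<open>Conditioning on \<open>A\<close> changes no cylinder mass, hence not the
      measure; evaluated at \<open>A\<close> itself this gives mass 1.\<close>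
    have "uniform_measure \<nu>\<^sub>0 A = \<nu>\<^sub>0"
    proof (rule stream_measure_eqI[OF countable_letters])
      show "finite_measure (uniform_measure \<nu>\<^sub>0 A)"
        using prob_space_uniform_measure[OF eA] by (simp add: prob_space_def)
      fix w assume w: "w \<in> lists L"
      show "measure (uniform_measure \<nu>\<^sub>0 A) (sstart L w) = measure \<nu>\<^sub>0 (sstart L w)"
        using ind[OF w, of None] False cylinder_in_sets[OF w] eA
        by (subst measure_uniform_measure) (auto simp: sets_\<nu> \<nu>\<^sub>0)
    qed (auto simp: sets_\<nu> \<nu>.finite_measure_axioms)
    then have "measure \<nu>\<^sub>0 A = measure \<nu>\<^sub>0 (A \<inter> A) / measure \<nu>\<^sub>0 A"
      using measure_uniform_measure[OF eA _ A] by simp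
    then show ?thesis using False \<nu>\<^sub>0 by simp
  qed (simp add: \<nu>\<^sub>0)
qed

end

section \<open>Identification of the harmonic measure\<close>

context equal_mass_walk
begin

text \<open>All three terms on the cylinder of \<open>a # w'\<close> contain the mass
  \<open>y\<close> of \<open>w'\<close> after a letter of the factor of \<open>a\<close>: merging
  stays in that factor, prepending conditions on leaving it, and cancelling uncovers
  \<open>a\<close> itself. What remains is the equation at \<open>a\<close>.\<close>

lemma stationary_\<nu>\<^sub>0:
  assumes ste: "stationary_traffic_equations I G \<mu> r" and B: "B \<in> sets S"
  shows "measure \<nu>\<^sub>0 B = (\<Sum>u\<in>L. pmf \<mu> u * measure \<nu>\<^sub>0 {\<xi> \<in> space \<nu>\<^sub>0. stream_times G u \<xi> \<in> B})"
proof (rule stationary_of_cylinders[OF \<nu>.prob_space_axioms sets_\<nu> _ B])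
  fix w assume w: "w \<in> lists L"
  show "measure \<nu>\<^sub>0 (sstart L w) =
    (\<Sum>u\<in>L. pmf \<mu> u * measure \<nu>\<^sub>0 {\<xi> \<in> space \<nu>\<^sub>0. stream_times G u \<xi> \<in> sstart L w})"
  proof (cases w)
    case Nil
    have "{\<xi> \<in> space \<nu>\<^sub>0. stream_times G u \<xi> \<in> streams L} = space \<nu>\<^sub>0" if "u \<in> L" for u
      using measurable_space[OF measurable_stream_times[OF that]] by (auto simp: space_\<nu> space_S)
    then show ?thesis
      using Nil sum_step \<nu>.prob_space[of None] by (simp add: space_\<nu>)
  next
    case (Cons a w')
    have a: "a \<in> L" and w': "w' \<in> lists L" using w Cons by auto
    define y where "y = measure (\<nu> (Some a)) (sstart L w')"
    have y: "measure (\<nu> (Some v)) (sstart L w') = y" if "v \<in> L" "fst v = fst a" for v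
      using measure_\<nu>_Some[OF _ cylinder_in_sets[OF w']] that a by (simp add: y_def)
    have 1: "measure \<nu>\<^sub>0 {\<xi> \<in> sstart L w'. fst (shd \<xi>) \<noteq> fst a} = (k - 1) / k * y"
      using measure_\<nu>_Some[OF a cylinder_in_sets[OF w']] k_ge by (simp add: y_def \<kappa>_def)
    have 2: "(\<Sum>(u, v)\<in>factorisations a. pmf \<mu> u * measure \<nu>\<^sub>0 (sstart L (v # w'))) =
        (\<Sum>(u, v)\<in>factorisations a. pmf \<mu> u * r v) * y"
      unfolding sum_distrib_right
    proof (intro sum.cong refl)
      fix x assume "x \<in> factorisations a"
      then obtain u v where x: "x = (u, v)" "u \<in> L" "v \<in> L" "[u] \<otimes>\<^bsub>free_product I G\<^esub> [v] = [a]"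
        by blast
      then have "fst v = fst a" using letter_product_iff[OF x(2,3) a] by simp
      then show "(case x of (u, v) \<Rightarrow> pmf \<mu> u * measure \<nu>\<^sub>0 (sstart L (v # w'))) =
          (case x of (u, v) \<Rightarrow> pmf \<mu> u * r v) * y"
        using x y w' by (simp add: measure_\<nu>\<^sub>0_Cons)
    qed
    have 3: "(\<Sum>u\<in>L - letters_of G (fst a). pmf \<mu> (letter_inv G u) * measure \<nu>\<^sub>0 (sstart L (u # a # w'))) =
        r a * \<kappa> * (\<Sum>u\<in>L - letters_of G (fst a). pmf \<mu> (letter_inv G u) * r u) * y"
      unfolding sum_distrib_left sum_distrib_right
    proof (intro sum.cong refl)
      fix u assume u: "u \<in> L - letters_of G (fst a)"
      then have "fst a \<noteq> fst u" by (auto simp: mem_letters_of_iff)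
      then have "measure \<nu>\<^sub>0 (sstart L (u # a # w')) = r u * (\<kappa> * (r a * y))"
        using u a w' by (simp add: measure_\<nu>\<^sub>0_Cons measure_\<nu>_Some_Cons y_def)
      then show "pmf \<mu> (letter_inv G u) * measure \<nu>\<^sub>0 (sstart L (u # a # w')) =
          r a * \<kappa> * (pmf \<mu> (letter_inv G u) * r u) * y"
        by simp
    qed
    have "measure \<nu>\<^sub>0 (sstart L w) = r a * y" unfolding Cons y_def by (rule measure_\<nu>\<^sub>0_Cons[OF a w'])
    also have "r a = pmf \<mu> a * ((k - 1) / k) + (\<Sum>(u, v)\<in>factorisations a. pmf \<mu> u * r v) +
        r a * \<kappa> * (\<Sum>u\<in>L - letters_of G (fst a). pmf \<mu> (letter_inv G u) * r u)"
      using ste a unfolding stationary_traffic_equations_def \<kappa>_def by blast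
    also have "\<dots> * y = pmf \<mu> a * ((k - 1) / k * y) + (\<Sum>(u, v)\<in>factorisations a. pmf \<mu> u * r v) * y +
        r a * \<kappa> * (\<Sum>u\<in>L - letters_of G (fst a). pmf \<mu> (letter_inv G u) * r u) * y"
      by (simp only: distrib_right mult.assoc)
    also have "\<dots> = (\<Sum>u\<in>L. pmf \<mu> u * measure \<nu>\<^sub>0 {\<xi> \<in> space \<nu>\<^sub>0. stream_times G u \<xi> \<in> sstart L (a # w')})"
      unfolding 1[symmetric] 2[symmetric] 3[symmetric]
      by (rule stationary_sum_cylinder[OF \<nu>.prob_space_axioms sets_\<nu> AE_\<nu>\<^sub>0_reduced a w', symmetric])
    finally show ?thesis unfolding Cons .
  qed
qed

definition act_prob :: "('i \<times> 'a) list \<Rightarrow> ('i \<times> 'a) list \<Rightarrow> real" where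
  "act_prob w g = measure \<nu>\<^sub>0 {\<xi> \<in> space \<nu>\<^sub>0. foldr (stream_times G) g \<xi> \<in> sstart L w}"

lemma measurable_foldr_stream_times:
  "set g \<subseteq> L \<Longrightarrow> foldr (stream_times G) g \<in> measurable S S"
proof (induction g)
  case (Cons u g)
  then show ?case
    using measurable_comp[of "foldr (stream_times G) g" S S "stream_times G u" S]
      measurable_stream_times[of u] by (simp add: comp_def)
qed (simp add: id_def)

lemma act_event_in_sets:
  assumes "set g \<subseteq> L" "w \<in> lists L"
  shows "{\<xi> \<in> space \<nu>\<^sub>0. foldr (stream_times G) g \<xi> \<in> sstart L w} \<in> sets S"
  using measurable_sets[OF measurable_foldr_stream_times[OF assms(1)] cylinder_in_sets[OF assms(2)]]
  by (simp add: vimage_def Int_def conj_commute space_\<nu> space_S)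

lemma act_prob_bounds: "0 \<le> act_prob w g" "act_prob w g \<le> 1"
  by (simp_all add: act_prob_def)

text \<open>Stationarity of \<open>\<nu>\<^sub>0\<close> applied to the preimage under
  \<open>g\<close> of the cylinder; the action law holds on reduced words, hence almost
  everywhere.\<close>

lemma act_prob_harmonic:
  assumes ste: "stationary_traffic_equations I G \<mu> r"
    and g: "set g \<subseteq> L" and w: "w \<in> lists L"
  shows "act_prob w g = (\<Sum>u\<in>L. pmf \<mu> u * act_prob w (foldr (letter_times G) g [u]))"
proof -
  let ?B = "{\<xi> \<in> space \<nu>\<^sub>0. foldr (stream_times G) g \<xi> \<in> sstart L w}"
  have "measure \<nu>\<^sub>0 {\<xi> \<in> space \<nu>\<^sub>0. stream_times G u \<xi> \<in> ?B} =
      act_prob w (foldr (letter_times G) g [u])" if u: "u \<in> L" for u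
    unfolding act_prob_def
  proof (rule \<nu>.finite_measure_eq_AE)
    show "AE \<xi> in \<nu>\<^sub>0. \<xi> \<in> {\<xi> \<in> space \<nu>\<^sub>0. stream_times G u \<xi> \<in> ?B} \<longleftrightarrow>
        \<xi> \<in> {\<xi> \<in> space \<nu>\<^sub>0. foldr (stream_times G) (foldr (letter_times G) g [u]) \<xi> \<in> sstart L w}"
      using AE_\<nu>\<^sub>0_reduced
    proof eventually_elim
      case (elim \<xi>)
      have "stream_times G u \<xi> \<in> streams L"
        by (intro infinite_reduced_in_streams[where I = I and G = G] stream_times_reduced[OF group_factor u elim])
      then show ?case
        using foldr_stream_times_snoc[OF group_factor u g elim] by (simp add: space_\<nu>)
    qed
    show "{\<xi> \<in> space \<nu>\<^sub>0. stream_times G u \<xi> \<in> ?B} \<in> sets \<nu>\<^sub>0"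
      using measurable_sets[OF measurable_stream_times[OF u] act_event_in_sets[OF g w]]
      by (simp add: vimage_def Int_def conj_commute space_\<nu> space_S sets_\<nu>)
    have "foldr (letter_times G) g [u] \<in> reduced_words I G"
      by (rule foldr_reduced[OF group_factor g]) (simp add: u reduced_Cons)
    then show "{\<xi> \<in> space \<nu>\<^sub>0. foldr (stream_times G) (foldr (letter_times G) g [u]) \<xi> \<in> sstart L w} \<in> sets \<nu>\<^sub>0"
      using act_event_in_sets[OF _ w, of "foldr (letter_times G) g [u]"]
      by (simp add: sets_\<nu> reduced_words_def)
  qed
  then show ?thesis
    using stationary_\<nu>\<^sub>0[OF ste act_event_in_sets[OF g w]] by (simp add: act_prob_def cong: sum.cong)
qed

text \<open>The martingale property in expectation. The induction peels off the first increment and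
  absorbs it into the starting point, so \<open>g\<close> has to vary.\<close>

lemma nn_integral_act_prob_walk:
  assumes ste: "stationary_traffic_equations I G \<mu> r"
    and g: "g \<in> reduced_words I G" and w: "w \<in> lists L"
  shows "(\<integral>\<^sup>+\<omega>. ennreal (act_prob w (foldr (letter_times G) g (walk I G n \<omega>))) \<partial>\<Omega>) =
    ennreal (act_prob w g)"
  using g
proof (induction n arbitrary: g)
  case 0
  then show ?case
    using increments.emeasure_space_1 by (simp add: free_product_def foldr_reduced_Nil)
next
  case (Suc n)
  have gs: "set g \<subseteq> L" using Suc.prems by (simp add: reduced_words_def)
  have m: "(\<lambda>\<omega>. ennreal (act_prob w (foldr (letter_times G) g (walk I G (Suc n) \<omega>)))) \<in> borel_measurable \<Omega>"
  proof (rule measurableI)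
    fix A :: "ennreal set"
    show "(\<lambda>\<omega>. ennreal (act_prob w (foldr (letter_times G) g (walk I G (Suc n) \<omega>)))) -` A \<inter> space \<Omega> \<in> sets \<Omega>"
      using pred_walk[where n = "Suc n"
          and Q = "\<lambda>v. ennreal (act_prob w (foldr (letter_times G) g v)) \<in> A"]
      unfolding pred_def by (simp only: vimage_def Int_def mem_Collect_eq conj_commute)
  qed simp
  have "(\<integral>\<^sup>+\<omega>. ennreal (act_prob w (foldr (letter_times G) g (walk I G (Suc n) \<omega>))) \<partial>\<Omega>) =
      (\<Sum>u\<in>L. ennreal (pmf \<mu> u) *
        (\<integral>\<^sup>+\<omega>. ennreal (act_prob w (foldr (letter_times G) g (walk I G (Suc n) (u ## \<omega>)))) \<partial>\<Omega>))"
    by (rule nn_integral_increments[OF m])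
  also have "\<dots> = (\<Sum>u\<in>L. ennreal (pmf \<mu> u) * ennreal (act_prob w (foldr (letter_times G) g [u])))"
  proof (intro sum.cong refl arg_cong2[where f = "(*)"])
    fix u assume u: "u \<in> L"
    then have u1: "[u] \<in> reduced_words I G" by (simp add: reduced_Cons)
    have gu: "foldr (letter_times G) g [u] \<in> reduced_words I G"
      by (rule foldr_reduced[OF group_factor gs u1])
    have "(\<integral>\<^sup>+\<omega>. ennreal (act_prob w (foldr (letter_times G) g (walk I G (Suc n) (u ## \<omega>)))) \<partial>\<Omega>) =
        (\<integral>\<^sup>+\<omega>. ennreal (act_prob w (foldr (letter_times G) (foldr (letter_times G) g [u]) (walk I G n \<omega>))) \<partial>\<Omega>)"
    proof (intro nn_integral_cong)
      fix \<omega> assume "\<omega> \<in> space \<Omega>"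
      then have \<omega>: "\<omega> \<in> streams L" by (simp add: space_increments)
      show "ennreal (act_prob w (foldr (letter_times G) g (walk I G (Suc n) (u ## \<omega>)))) =
          ennreal (act_prob w (foldr (letter_times G) (foldr (letter_times G) g [u]) (walk I G n \<omega>)))"
        unfolding walk_Stream[OF u \<omega>]
        using foldr_assoc[OF group_factor gs u1 walk_reduced[OF \<omega>, of n]] by simp
    qed
    also have "\<dots> = ennreal (act_prob w (foldr (letter_times G) g [u]))" by (rule Suc.IH[OF gu])
    finally show "(\<integral>\<^sup>+\<omega>. ennreal (act_prob w (foldr (letter_times G) g (walk I G (Suc n) (u ## \<omega>)))) \<partial>\<Omega>) =
        ennreal (act_prob w (foldr (letter_times G) g [u]))" .
  qed
  also have "\<dots> = ennreal (\<Sum>u\<in>L. pmf \<mu> u * act_prob w (foldr (letter_times G) g [u]))"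
    by (simp add: ennreal_mult' act_prob_bounds flip: sum_ennreal)
  also have "\<dots> = ennreal (act_prob w g)" by (simp only: act_prob_harmonic[OF ste gs w])
  finally show ?case .
qed

text \<open>Letters are consumed in pairs because a single transition probability
  \<open>\<kappa> * r u\<close> equals 1 when there are two factors and \<open>u\<close> is the only
  letter of its own.\<close>

lemma measure_\<nu>\<^sub>0_decay:
  assumes \<rho>: "\<rho> \<ge> 0" "\<And>u v. u \<in> L \<Longrightarrow> v \<in> L \<Longrightarrow> fst u \<noteq> fst v \<Longrightarrow> (\<kappa> * r u) * (\<kappa> * r v) \<le> \<rho>"
    and "w \<in> lists L"
  shows "measure \<nu>\<^sub>0 (sstart L w) \<le> \<rho> ^ (length w div 2)"
  using assms(3)
proof (induction w rule: induct_list012)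
  case (3 a b w)
  have ab: "a \<in> L" "b \<in> L" "w \<in> lists L" using 3 by auto
  have IH: "measure \<nu>\<^sub>0 (sstart L w) \<le> \<rho> ^ (length w div 2)" using 3 ab by simp
  have \<rho>n: "0 \<le> \<rho> ^ n" for n using \<rho>(1) by simp
  show ?case
  proof (cases "fst b = fst a")
    case True
    then show ?thesis
      using ab \<rho>n[of "Suc (length w div 2)"] by (simp add: measure_\<nu>\<^sub>0_Cons measure_\<nu>_Some_Cons)
  next
    case False
    have "measure (\<nu> (Some b)) (sstart L w) \<le> \<kappa> * measure \<nu>\<^sub>0 (sstart L w)"
      unfolding measure_\<nu>_Some[OF ab(2) cylinder_in_sets[OF ab(3)]]
      using \<kappa>_pos cylinder_in_sets[OF ab(3)]
      by (intro mult_left_mono \<nu>.finite_measure_mono) (auto simp: sets_\<nu>)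
    then have le: "measure (\<nu> (Some b)) (sstart L w) \<le> \<kappa> * \<rho> ^ (length w div 2)"
      using IH \<kappa>_pos by (meson less_imp_le mult_left_mono order_trans)
    have "measure \<nu>\<^sub>0 (sstart L (a # b # w)) =
        (\<kappa> * r a * r b) * measure (\<nu> (Some b)) (sstart L w)"
      using ab False by (simp add: measure_\<nu>\<^sub>0_Cons measure_\<nu>_Some_Cons)
    also have "\<dots> \<le> (\<kappa> * r a * r b) * (\<kappa> * \<rho> ^ (length w div 2))"
      using le \<kappa>_pos r_nonneg ab by (intro mult_left_mono mult_nonneg_nonneg) auto
    also have "\<dots> = (\<kappa> * r a) * (\<kappa> * r b) * \<rho> ^ (length w div 2)" by simp
    also have "\<dots> \<le> \<rho> * \<rho> ^ (length w div 2)"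
      using \<rho>(2)[OF ab(1,2)] False \<rho>n by (intro mult_right_mono) auto
    finally show ?thesis by simp
  qed
qed simp_all

text \<open>Split \<open>g\<close> after \<open>length w\<close> letters. The first part is damaged
  only if the whole remainder \<open>h\<close> cancels, so the error is at most the mass of the
  cylinder of the inverse of \<open>h\<close>.\<close>

lemma act_prob_approx:
  assumes \<rho>: "\<rho> \<ge> 0" "\<And>u v. u \<in> L \<Longrightarrow> v \<in> L \<Longrightarrow> fst u \<noteq> fst v \<Longrightarrow> (\<kappa> * r u) * (\<kappa> * r v) \<le> \<rho>"
    and g: "g \<in> reduced_words I G" "length w < length g" and w: "w \<in> lists L"
  shows "\<bar>act_prob w g - (if take (length w) g = w then 1 else 0)\<bar> \<le> \<rho> ^ ((length g - length w) div 2)"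
proof -
  define m where "m = length w"
  define h where "h = drop m g"
  have gh: "g = take m g @ h" "h \<noteq> []" "length (take m g) = m" "length h = length g - length w"
    using g(2) by (auto simp: h_def m_def)
  have gs: "set g \<subseteq> L" using g by (simp add: reduced_words_def)
  then have hs: "set h \<subseteq> L" by (auto simp: h_def dest: in_set_dropD)
  define h' where "h' = rev (map (letter_inv G) h)"
  have h': "h' \<in> lists L" "length h' = length h"
    using letter_inv_in[OF group_factor subsetD[OF hs]]
    by (simp_all add: h'_def in_lists_conv_set del: split_paired_All)
  have bad: "measure \<nu>\<^sub>0 (sstart L h') \<le> \<rho> ^ ((length g - length w) div 2)"
    using measure_\<nu>\<^sub>0_decay[OF \<rho> h'(1)] h'(2) gh(4) by simp
  let ?A = "{\<xi> \<in> space \<nu>\<^sub>0. foldr (stream_times G) g \<xi> \<in> sstart L w}"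
  have A: "?A \<in> sets \<nu>\<^sub>0" using act_event_in_sets[OF gs w] by (simp add: sets_\<nu>)
  have H': "sstart L h' \<in> sets \<nu>\<^sub>0" using cylinder_in_sets[OF h'(1)] by (simp add: sets_\<nu>)
  have good: "AE \<xi> in \<nu>\<^sub>0. \<xi> \<notin> sstart L h' \<longrightarrow> (\<xi> \<in> ?A \<longleftrightarrow> take m g = w)"
    using AE_\<nu>\<^sub>0_reduced AE_space
  proof eventually_elim
    case (elim \<xi>)
    have st: "foldr (stream_times G) g \<xi> \<in> streams L"
      by (intro infinite_reduced_in_streams[where I = I and G = G]
          foldr_stream_times_reduced[OF group_factor gs elim(1)])
    show ?case
    proof
      assume "\<xi> \<notin> sstart L h'"
      then have "stake (length h) \<xi> \<noteq> rev (map (letter_inv G) h)"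
        using in_sstart_iff_stake[OF infinite_reduced_in_streams[OF elim(1)], of h'] h'(2)
        by (simp add: h'_def)
      from stake_foldr_stream_times[OF group_factor _ gh(2) elim(1) this, of "take m g"]
      have "stake m (foldr (stream_times G) g \<xi>) = take m g"
        using g gh by simp
      then show "\<xi> \<in> ?A \<longleftrightarrow> take m g = w"
        using in_sstart_iff_stake[OF st, of w] elim(2) by (simp add: m_def)
    qed
  qed
  show ?thesis
  proof (cases "take m g = w")
    case True
    have "measure \<nu>\<^sub>0 (space \<nu>\<^sub>0 - ?A) \<le> measure \<nu>\<^sub>0 (sstart L h')"
      using good AE_space by (intro \<nu>.finite_measure_mono_AE[OF _ H']) (auto simp: True elim!: AE_mp)
    also have "measure \<nu>\<^sub>0 (space \<nu>\<^sub>0 - ?A) = 1 - act_prob w g"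
      using \<nu>.prob_compl[OF A] by (simp add: act_prob_def)
    finally show ?thesis using bad True act_prob_bounds[of w g] by (simp add: m_def)
  next
    case False
    have "act_prob w g \<le> measure \<nu>\<^sub>0 (sstart L h')"
      unfolding act_prob_def
      using good AE_space by (intro \<nu>.finite_measure_mono_AE[OF _ H']) (auto simp: False elim!: AE_mp)
    then show ?thesis using bad False act_prob_bounds[of w g] by (simp add: m_def)
  qed
qed

text \<open>The error in \<open>act_prob_approx\<close> vanishes along almost every path because the
  length of the walk tends to infinity. The expectations of \<open>F n\<close> do not depend on
  \<open>n\<close>, and \<open>F n\<close> is bounded by 1, so they equal the expectation of the
  limit.\<close>

lemma harmonic_eq_\<nu>\<^sub>0_nondegenerate:
  assumes tr: "transient I G \<mu>" and ste: "stationary_traffic_equations I G \<mu> r"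
    and \<rho>: "0 \<le> \<rho>" "\<rho> < 1"
      "\<And>u v. u \<in> L \<Longrightarrow> v \<in> L \<Longrightarrow> fst u \<noteq> fst v \<Longrightarrow> (\<kappa> * r u) * (\<kappa> * r v) \<le> \<rho>"
  shows "H = \<nu>\<^sub>0"
proof (rule stream_measure_eqI[OF countable_letters])
  fix w assume w: "w \<in> lists L"
  define m where "m = length w"
  define F where "F n \<omega> = act_prob w (walk I G n \<omega>)" for n \<omega>
  define f :: "('i \<times> 'a) stream \<Rightarrow> real" where
    "f \<omega> = (if walk_limit I G \<omega> \<in> sstart L w then 1 else 0)" for \<omega>
  have evt: "{\<omega> \<in> space \<Omega>. walk_limit I G \<omega> \<in> sstart L w} \<in> sets \<Omega>"
    using measurable_sets[OF measurable_walk_limit cylinder_in_sets[OF w]]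
    by (simp add: vimage_def Int_def conj_commute)
  have mF: "F n \<in> borel_measurable \<Omega>" for n
  proof (rule measurableI)
    fix A :: "real set"
    show "F n -` A \<inter> space \<Omega> \<in> sets \<Omega>"
      using pred_walk[where n = n and Q = "\<lambda>v. act_prob w v \<in> A"]
      unfolding pred_def F_def by (simp only: vimage_def Int_def mem_Collect_eq conj_commute)
  qed simp
  have intF: "(\<integral>\<omega>. F n \<omega> \<partial>\<Omega>) = measure \<nu>\<^sub>0 (sstart L w)" for n
  proof -
    have "(\<integral>\<^sup>+\<omega>. ennreal (F n \<omega>) \<partial>\<Omega>) = ennreal (act_prob w [])"
      using nn_integral_act_prob_walk[OF ste _ w, of "[]" n] by (simp add: F_def)
    then have "(\<integral>\<omega>. F n \<omega> \<partial>\<Omega>) = act_prob w []"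
      using mF[of n] by (subst integral_eq_nn_integral) (simp_all add: F_def act_prob_bounds)
    also have "act_prob w [] = measure \<nu>\<^sub>0 (sstart L w)"
      unfolding act_prob_def using sstart_in_streams[OF w]
      by (intro arg_cong[of _ _ "measure \<nu>\<^sub>0"]) (auto simp: space_\<nu>)
    finally show ?thesis .
  qed
  have lim: "AE \<omega> in \<Omega>. (\<lambda>n. F n \<omega>) \<longlonglongrightarrow> f \<omega>"
    using AE_walk_converges[OF tr] AE_length_walk[OF tr] AE_space
  proof eventually_elim
    case (elim \<omega>)
    let ?X = "\<lambda>n. walk I G n \<omega>"
    have \<omega>: "\<omega> \<in> streams L" using elim by (simp add: space_increments)
    have "\<forall>\<^sub>F n in sequentially. m \<le> length (?X n) \<and> take m (?X n) = stake m (walk_limit I G \<omega>)"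
      using elim(1) unfolding walk_converges_iff by blast
    moreover have "\<forall>\<^sub>F n in sequentially. m < length (?X n)"
      using elim(2)[unfolded filterlim_at_top, rule_format, of "Suc m"] by (simp add: Suc_le_eq)
    ultimately have bound: "\<forall>\<^sub>F n in sequentially.
        norm (F n \<omega> - f \<omega>) \<le> \<rho> ^ ((length (?X n) - m) div 2)"
    proof eventually_elim
      case (elim n)
      have "walk_limit I G \<omega> \<in> sstart L w \<longleftrightarrow> take m (?X n) = w"
        using elim in_sstart_iff_stake[OF infinite_reduced_in_streams[OF walk_limit_reduced]]
        by (simp add: m_def)
      then show ?case
        using act_prob_approx[OF \<rho>(1,3) walk_reduced[OF \<omega>] _ w, of n] elim
        by (simp add: F_def f_def m_def)
    qed
    have "filterlim (\<lambda>n. (length (?X n) - m) div 2) at_top sequentially"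
      unfolding filterlim_at_top
    proof
      fix N
      have "\<forall>\<^sub>F n in sequentially. m + 2 * N \<le> length (?X n)"
        using elim(2) by (simp add: filterlim_at_top)
      then show "\<forall>\<^sub>F n in sequentially. N \<le> (length (?X n) - m) div 2"
        by eventually_elim simp
    qed
    then have "(\<lambda>n. \<rho> ^ ((length (?X n) - m) div 2)) \<longlonglongrightarrow> 0"
      using LIMSEQ_realpow_zero[OF \<rho>(1,2)] by (rule filterlim_compose[rotated])
    then have "(\<lambda>n. F n \<omega> - f \<omega>) \<longlonglongrightarrow> 0" by (rule Lim_null_comparison[OF bound])
    then show ?case by (simp add: LIM_zero_iff)
  qed
  have mf: "f \<in> borel_measurable \<Omega>"
    unfolding f_def using evt by (intro measurable_If) (auto simp: pred_def)
  have "(\<lambda>n. \<integral>\<omega>. F n \<omega> \<partial>\<Omega>) \<longlonglongrightarrow> (\<integral>\<omega>. f \<omega> \<partial>\<Omega>)"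
    using lim act_prob_bounds
    by (intro integral_dominated_convergence[where w = "\<lambda>_. 1"] mf mF) (auto simp: F_def)
  then have "measure \<nu>\<^sub>0 (sstart L w) = (\<integral>\<omega>. f \<omega> \<partial>\<Omega>)"
    unfolding intF by (simp add: LIMSEQ_const_iff)
  also have "\<dots> = (\<integral>\<omega>. indicator {\<omega> \<in> space \<Omega>. walk_limit I G \<omega> \<in> sstart L w} \<omega> \<partial>\<Omega>)"
    by (intro Bochner_Integration.integral_cong refl) (simp add: f_def indicator_def)
  also have "\<dots> = measure H (sstart L w)"
    using evt measure_harmonic[OF cylinder_in_sets[OF w]] by simp
  finally show "measure H (sstart L w) = measure \<nu>\<^sub>0 (sstart L w)" by simp
qed (auto simp: sets_harmonic sets_\<nu> harmonic.finite_measure_axioms \<nu>.finite_measure_axioms)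

text \<open>
  The remaining case is the infinite dihedral group, where cylinders do not shrink: every
  infinite word is determined by its first letter.
\<close>

lemma reduced_two_letters:
  assumes L: "L = {u, v}"
    and "w \<in> reduced_words I G" "w' \<in> reduced_words I G" "length w = length w'"
    and "w \<noteq> [] \<Longrightarrow> hd w = hd w'"
  shows "w = w'"
  using assms(4,2,3,5)
proof (induction w w' rule: list_induct2)
  case (Cons x xs y ys)
  have "hd xs = hd ys" if ne: "xs \<noteq> []"
  proof -
    have "ys \<noteq> []" using ne Cons.hyps by auto
    then have *: "xs \<in> reduced_words I G" "ys \<in> reduced_words I G"
      "fst x \<noteq> fst (hd xs)" "fst x \<noteq> fst (hd ys)" "x \<in> L" "x = y"
      using Cons.prems ne by (simp_all add: reduced_Cons)
    have "hd xs \<in> set xs" "hd ys \<in> set ys" using ne \<open>ys \<noteq> []\<close> by simp_all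
    moreover have "set xs \<subseteq> L" "set ys \<subseteq> L" using * by (simp_all add: reduced_words_def)
    ultimately have "hd xs \<in> L" "hd ys \<in> L" by blast+
    with * have "hd xs \<in> L" "hd ys \<in> L" "fst x \<noteq> fst (hd xs)" "fst x \<noteq> fst (hd ys)" "x \<in> L"
      by simp_all
    then show ?thesis unfolding L by auto
  qed
  then show ?case using Cons by (simp add: reduced_Cons)
qed simp

text \<open>A nonempty cylinder is either null, if its word is not reduced, or almost surely the
  cylinder of its first letter.\<close>

lemma stream_measure_eqI_two_letters:
  assumes L: "L = {u, v}"
    and M: "prob_space M" "sets M = sets S" "AE \<xi> in M. \<xi> \<in> infinite_reduced_words I G"
    and N: "prob_space N" "sets N = sets S" "AE \<xi> in N. \<xi> \<in> infinite_reduced_words I G"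
    and eq: "\<And>a. a \<in> L \<Longrightarrow> measure M (sstart L [a]) = measure N (sstart L [a])"
  shows "M = N"
proof -
  have cyl: "measure P (sstart L (a # w)) =
      (if a # w \<in> reduced_words I G then measure P (sstart L [a]) else 0)"
    if P: "prob_space P" "sets P = sets S" "AE \<xi> in P. \<xi> \<in> infinite_reduced_words I G"
      and w: "a # w \<in> lists L" for P a w
  proof -
    interpret prob_space P by fact
    have "AE \<xi> in P. \<xi> \<in> sstart L (a # w) \<longleftrightarrow>
        \<xi> \<in> (if a # w \<in> reduced_words I G then sstart L [a] else {})"
      using P(3)
    proof eventually_elim
      case (elim \<xi>)
      note str = in_sstart_iff_stake[OF infinite_reduced_in_streams[OF elim]]
      have "stake (length (a # w)) \<xi> \<in> reduced_words I G"
        using elim unfolding infinite_reduced_words_def by blast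
      moreover have "stake (length (a # w)) \<xi> = a # w"
        if "shd \<xi> = a" "a # w \<in> reduced_words I G"
        using calculation that by (intro reduced_two_letters[OF L]) auto
      ultimately show ?case
        using str[of "a # w"] str[of "[a]"] by (auto simp del: in_sstart)
    qed
    then have "measure P (sstart L (a # w)) =
        measure P (if a # w \<in> reduced_words I G then sstart L [a] else {})"
      using w cylinder_in_sets[of "a # w"] cylinder_in_sets[of "[a]"] P(2)
      by (intro finite_measure_eq_AE) auto
    then show ?thesis by simp
  qed
  have nil: "measure P (sstart L []) = 1" if "prob_space P" "sets P = sets S" for P
    using prob_space.prob_space[OF that(1)] sets_eq_imp_space_eq[OF that(2)] by (simp add: space_S)
  show ?thesis
  proof (rule stream_measure_eqI[OF countable_letters])
    fix w assume "w \<in> lists L"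
    then show "measure M (sstart L w) = measure N (sstart L w)"
      using cyl[OF M] cyl[OF N] nil[OF M(1,2)] nil[OF N(1,2)] eq
      by (cases w) (auto simp del: in_sstart sstart.simps)
  qed (use M N in \<open>auto simp: prob_space_def\<close>)
qed

lemma harmonic_eq_\<nu>\<^sub>0_degenerate:
  assumes tr: "transient I G \<mu>"
    and uv: "u \<in> L" "v \<in> L" "fst u \<noteq> fst v" "(\<kappa> * r u) * (\<kappa> * r v) \<ge> 1"
  shows "H = \<nu>\<^sub>0"
proof -
  have le: "r x \<le> 1 / k" if "x \<in> L" for x
  proof -
    have "r x \<le> sum r (letters_of G (fst x))"
      using that letters_of_subset[OF fst_in_index[OF that]]
      by (intro member_le_sum finite_letters_of fst_in_index) (auto simp: mem_letters_of_iff intro: r_nonneg)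
    then show ?thesis using factor_mass[OF fst_in_index[OF that]] by simp
  qed
  have le1: "\<kappa> * r x \<le> 1 / (k - 1)" if "x \<in> L" for x
    using mult_left_mono[OF le[OF that], of \<kappa>] k_ge by (simp add: \<kappa>_def)
  have le1': "\<kappa> * r x \<le> 1" if "x \<in> L" for x
    using k_ge by (intro order_trans[OF le1[OF that]]) simp
  have eq1: "\<kappa> * r x = 1" if "x = u \<or> x = v" for x
  proof (rule antisym)
    have p: "0 < \<kappa> * r u" "0 < \<kappa> * r v" using \<kappa>_pos r_pos uv by auto
    have "(\<kappa> * r u) * (\<kappa> * r v) \<le> \<kappa> * r u"
      using p by (intro mult_left_le le1' uv less_imp_le)
    moreover have "(\<kappa> * r u) * (\<kappa> * r v) \<le> \<kappa> * r v"
      using p by (intro mult_left_le_one_le le1' uv less_imp_le)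
    ultimately show "1 \<le> \<kappa> * r x" using uv(4) that by auto
  qed (use le1'[OF uv(1)] le1'[OF uv(2)] that in auto)
  \<comment> \<open>The value \<open>\<kappa> * r u = 1\<close> meets the bound
    \<open>1 / (k - 1)\<close>, so there are two factors; \<open>u\<close> and \<open>v\<close> then
    have mass 1/2 each and leave nothing for a third letter.\<close>
  have k2: "k = 2"
    using le1[OF uv(1)] eq1[of u] k_ge by (simp add: field_simps)
  have half: "r u = 1 / 2" "r v = 1 / 2" using eq1[of u] eq1[of v] unfolding \<kappa>_def k2 by auto
  have Luv: "L = {u, v}"
  proof (rule ccontr)
    assume "L \<noteq> {u, v}"
    then obtain x where x: "x \<in> L" "x \<noteq> u" "x \<noteq> v" using uv by blast
    have "sum r {u, v, x} \<le> sum r L"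
      using uv x by (intro sum_mono2 finite_letters) (auto intro: r_nonneg)
    moreover have "u \<noteq> v" using uv(3) by auto
    ultimately show False using half r_pos[OF x(1)] r_sum x by simp
  qed
  have ne: "u \<noteq> v" using uv(3) by auto
  have fact: "factorisations u = {}"
  proof (rule equals0I)
    fix p assume "p \<in> factorisations u"
    then obtain x y where xy: "x \<in> L" "y \<in> L" "[x] \<otimes>\<^bsub>free_product I G\<^esub> [y] = [u]" by blast
    then have *: "fst x = fst u" "fst y = fst u" "(fst x, snd x \<otimes>\<^bsub>G (fst x)\<^esub> snd y) = u"
      using letter_product_iff[OF xy(1,2) uv(1)] by auto
    then have "x = u" "y = u" using xy uv(3) unfolding Luv by auto
    then have "snd u \<otimes>\<^bsub>G (fst u)\<^esub> snd u = snd u" using *(3) by (metis snd_conv)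
    moreover have "snd u \<in> carrier (G (fst u))" "snd u \<noteq> \<one>\<^bsub>G (fst u)\<^esub>" "fst u \<in> I"
      using uv(1) letters_iff[of "fst u" "snd u"] by auto
    ultimately show False using group_factor group.l_cancel_one by metis
  qed
  have inv: "letter_inv G v = v"
    using letter_inv_in[OF group_factor uv(2)] uv(3) unfolding Luv by (auto simp: letter_inv_def)
  have other: "L - letters_of G (fst u) = {v}"
    using uv ne by (auto simp: Luv mem_letters_of_iff)
  have v1: "measure H {\<xi> \<in> sstart L []. fst (shd \<xi>) \<noteq> fst u} = measure H (sstart L [v])"
  proof -
    have "{\<xi> \<in> sstart L []. fst (shd \<xi>) \<noteq> fst u} = sstart L [v]"
      using uv(3) sstart_in_streams[of "[v]" L] uv(2) streams_shd[of _ L] unfolding Luv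
      by (auto simp: streams_stl dest: streams_shd)
    then show ?thesis by simp
  qed
  have v2: "measure H (sstart L [v, u]) = measure H (sstart L [v])"
  proof (rule harmonic.finite_measure_eq_AE)
    show "AE \<xi> in H. \<xi> \<in> sstart L [v, u] \<longleftrightarrow> \<xi> \<in> sstart L [v]"
      using AE_harmonic_reduced
    proof eventually_elim
      case (elim \<xi>)
      have r1: "shd \<xi> \<in> L" "stl \<xi> \<in> infinite_reduced_words I G" "fst (shd \<xi>) \<noteq> fst (shd (stl \<xi>))"
        using infinite_reduced_iff[of \<xi> I G] elim by auto
      have "shd (stl \<xi>) \<in> L" using infinite_reduced_iff[of "stl \<xi>" I G] r1(2) by simp
      then have "shd \<xi> = v \<Longrightarrow> shd (stl \<xi>) = u" using r1(3) unfolding Luv by auto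
      then show ?case using infinite_reduced_in_streams[OF r1(2)] by (auto simp: streams_stl)
    qed
  qed (use cylinder_in_sets[of "[v]"] cylinder_in_sets[of "[v, u]"] uv in \<open>auto simp: sets_harmonic\<close>)
  \<comment> \<open>Both increments send exactly the words starting with \<open>v\<close> to words
    starting with \<open>u\<close>: \<open>u\<close> is prepended, and the involution
    \<open>v\<close> cancels. The weights sum to 1, so the two first letters are equally
    likely.\<close>
  have "measure H (sstart L [u]) = pmf \<mu> u * measure H (sstart L [v]) + pmf \<mu> v * measure H (sstart L [v])"
    using harmonic_stationary[OF tr cylinder_in_sets[of "[u]"]]
      stationary_sum_cylinder[OF harmonic.prob_space_axioms sets_harmonic AE_harmonic_reduced uv(1), of "[]"] uv(1)
    unfolding v1 fact other by (simp add: inv v2 del: sstart.simps)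
  also have "\<dots> = (pmf \<mu> u + pmf \<mu> v) * measure H (sstart L [v])" by (simp add: distrib_right)
  also have "pmf \<mu> u + pmf \<mu> v = 1" using sum_step ne unfolding Luv by simp
  finally have huv: "measure H (sstart L [u]) = measure H (sstart L [v])" by simp
  have "measure H {\<xi> \<in> space H. shd \<xi> \<in> L \<and> \<xi> \<in> streams L} = (\<Sum>x\<in>L. measure H {\<xi> \<in> streams L. shd \<xi> = x})"
    using sets.top[of S]
    by (intro measure_first_letter harmonic.prob_space_axioms sets_harmonic) (auto simp: space_S)
  also have "{\<xi> \<in> space H. shd \<xi> \<in> L \<and> \<xi> \<in> streams L} = space H"
    by (auto simp: space_harmonic streams_shd)
  also have "(\<Sum>x\<in>L. measure H {\<xi> \<in> streams L. shd \<xi> = x}) = (\<Sum>x\<in>L. measure H (sstart L [x]))"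
  proof (intro sum.cong refl arg_cong[of _ _ "measure H"])
    fix x assume "x \<in> L"
    then show "{\<xi> \<in> streams L. shd \<xi> = x} = sstart L [x]"
      using sstart_in_streams[of "[x]" L] by (auto simp: streams_stl)
  qed
  also have "(\<Sum>x\<in>L. measure H (sstart L [x])) = measure H (sstart L [u]) + measure H (sstart L [v])"
    using ne by (subst (1) Luv) simp
  finally have h: "measure H (sstart L [u]) = 1 / 2" "measure H (sstart L [v]) = 1 / 2"
    using huv harmonic.prob_space by auto
  have n: "measure \<nu>\<^sub>0 (sstart L [x]) = r x" if "x \<in> L" for x
    using measure_\<nu>\<^sub>0_Cons[OF that, of "[]"] by (simp add: measure_\<nu>_streams)
  show ?thesis
  proof (rule stream_measure_eqI_two_letters[OF Luv harmonic.prob_space_axioms sets_harmonic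
        AE_harmonic_reduced \<nu>.prob_space_axioms sets_\<nu> AE_\<nu>\<^sub>0_reduced])
    fix a assume a: "a \<in> L"
    then have "a = u \<or> a = v" using Luv by blast
    then show "measure H (sstart L [a]) = measure \<nu>\<^sub>0 (sstart L [a])"
      using h half n[OF a] by auto
  qed
qed

lemma harmonic_eq_\<nu>\<^sub>0:
  assumes tr: "transient I G \<mu>" and ste: "stationary_traffic_equations I G \<mu> r"
  shows "H = \<nu>\<^sub>0"
proof (cases "\<exists>u\<in>L. \<exists>v\<in>L. fst u \<noteq> fst v \<and> (\<kappa> * r u) * (\<kappa> * r v) \<ge> 1")
  case True
  then show ?thesis using harmonic_eq_\<nu>\<^sub>0_degenerate[OF tr] by blast
next
  case False
  \<comment> \<open>The products over two consecutive letters are finitely many numbers below 1, so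
    their maximum is a uniform rate; the inserted 0 keeps it nonnegative and the set
    nonempty.\<close>
  define V where "V = insert 0 ((\<lambda>(u, v). (\<kappa> * r u) * (\<kappa> * r v)) ` {(u, v). u \<in> L \<and> v \<in> L \<and> fst u \<noteq> fst v})"
  have "finite {(u, v). u \<in> L \<and> v \<in> L \<and> fst u \<noteq> fst v}"
    by (rule finite_subset[of _ "L \<times> L"]) (auto simp: finite_letters)
  then have V: "finite V" "V \<noteq> {}" by (auto simp: V_def)
  show ?thesis
  proof (rule harmonic_eq_\<nu>\<^sub>0_nondegenerate[OF tr ste])
    show "0 \<le> Max V" using V by (intro Max_ge) (auto simp: V_def)
    have "x < 1" if x: "x \<in> V" for x
    proof (cases "x = 0")
      case False
      then obtain u v where "x = (\<kappa> * r u) * (\<kappa> * r v)" "u \<in> L" "v \<in> L" "fst u \<noteq> fst v"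
        using x by (auto simp: V_def)
      then show ?thesis
        using \<open>\<not> (\<exists>u\<in>L. \<exists>v\<in>L. fst u \<noteq> fst v \<and> (\<kappa> * r u) * (\<kappa> * r v) \<ge> 1)\<close> not_le by blast
    qed simp
    then show "Max V < 1" using V by simp
    show "(\<kappa> * r u) * (\<kappa> * r v) \<le> Max V" if "u \<in> L" "v \<in> L" "fst u \<noteq> fst v" for u v
      using V that by (intro Max_ge) (auto simp: V_def)
  qed
qed

end

section \<open>The factors charged by the increments, and the equivalence\<close>

lemma fst_letter_times:
  "fst ` set (letter_times G u w) \<subseteq> insert (fst u) (fst ` set w)"
  by (cases u; cases w) (auto split: if_splits)

lemma fst_foldr_letter_times:
  "fst ` set (foldr (letter_times G) g w) \<subseteq> fst ` set g \<union> fst ` set w"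
proof (induction g)
  case (Cons x g)
  have "fst ` set (letter_times G x (foldr (letter_times G) g w)) \<subseteq>
      insert (fst x) (fst ` set (foldr (letter_times G) g w))"
    by (rule fst_letter_times)
  also have "\<dots> \<subseteq> insert (fst x) (fst ` set g \<union> fst ` set w)"
    using Cons by blast
  finally show ?case by simp
qed simp

text \<open>Multiplication never introduces a new factor, so a walk that reaches every one-letter
  word has increments charging every factor.\<close>

lemma convolution_power_support:
  assumes "x \<in> set_pmf (group_convolution_power (free_product I G) (map_pmf (\<lambda>u. [u]) \<mu>) n)"
  shows "fst ` set x \<subseteq> fst ` set_pmf \<mu>"
  using assms
proof (induction n arbitrary: x)
  case (Suc n)
  then obtain y u where y: "y \<in> set_pmf (group_convolution_power (free_product I G) (map_pmf (\<lambda>u. [u]) \<mu>) n)"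
    and u: "u \<in> set_pmf \<mu>" and x: "x = foldr (letter_times G) y [u]"
    by (auto simp: group_convolution_def free_product_def)
  then show ?case using fst_foldr_letter_times[of G y "[u]"] Suc.IH[OF y] by auto
qed (simp add: free_product_def)

theorem lemma3p4:
  fixes I :: "'i set" and G :: "'i \<Rightarrow> ('a, 'b) monoid_scheme" and \<mu> :: "('i \<times> 'a) pmf"
  assumes "finite I" and "card I \<ge> 2"
    and "\<And>i. i \<in> I \<Longrightarrow> group (G i)"
    and "\<And>i. i \<in> I \<Longrightarrow> finite (carrier (G i))"
    and "\<And>i. i \<in> I \<Longrightarrow> carrier (G i) \<noteq> {\<one>\<^bsub>G i\<^esub>}"
    and "set_pmf \<mu> \<subseteq> letters I G"
    and "(\<Union>n\<in>{1..}. set_pmf (group_convolution_power (free_product I G) (map_pmf (\<lambda>u. [u]) \<mu>) n))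
           = carrier (free_product I G)"
    and "transient I G \<mu>"
  shows "(\<forall>r \<in> open_simplex (letters I G).
            (markovian_multiplicative I G r (harmonic_measure I G \<mu>) \<and>
             shift_stationary (harmonic_measure I G \<mu>) \<and>
             shift_ergodic (harmonic_measure I G \<mu>))
            \<longleftrightarrow> stationary_traffic_equations I G \<mu> r) \<and>
         (((\<exists>r \<in> open_simplex (letters I G).
              markovian_multiplicative I G r (harmonic_measure I G \<mu>)) \<and>
           shift_stationary (harmonic_measure I G \<mu>) \<and>
           shift_ergodic (harmonic_measure I G \<mu>))
          \<longleftrightarrow> (\<exists>r \<in> open_simplex (letters I G). stationary_traffic_equations I G \<mu> r))"
proof -
  interpret free_product_walk I G \<mu>
    using assms by unfold_locales auto
  have supp: "\<exists>u\<in>letters_of G i. pmf \<mu> u > 0" if i: "i \<in> I" for i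
  proof -
    obtain u where u: "u \<in> letters_of G i" using letters_of_nonempty[OF i] by blast
    then have "[u] \<in> carrier (free_product I G)"
      using letters_of_subset[OF i] by (auto simp: free_product_def reduced_Cons)
    then obtain n where "[u] \<in> set_pmf (group_convolution_power (free_product I G) (map_pmf (\<lambda>u. [u]) \<mu>) n)"
      using assms(7) by blast
    from convolution_power_support[OF this] obtain v where v: "v \<in> set_pmf \<mu>" "fst v = fst u"
      by auto
    then have "v \<in> letters_of G i"
      using u set_pmf_letters mem_letters_of_iff[of v i] by (auto simp: letters_of_def)
    then show ?thesis using pmf_positive[OF v(1)] by blast
  qed
  have "markovian_multiplicative I G r H \<and> shift_stationary H \<and> shift_ergodic H \<longleftrightarrow>
      stationary_traffic_equations I G \<mu> r" if r: "r \<in> open_simplex L" for r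
  proof
    assume ste: "stationary_traffic_equations I G \<mu> r"
    interpret equal_mass_walk I G \<mu> r
      using r traffic_factor_mass[OF r ste supp] by unfold_locales
    show "markovian_multiplicative I G r H \<and> shift_stationary H \<and> shift_ergodic H"
      unfolding harmonic_eq_\<nu>\<^sub>0[OF assms(8) ste]
      using markovian_multiplicative_\<nu>\<^sub>0 shift_stationary_\<nu>\<^sub>0 shift_ergodic_\<nu>\<^sub>0 by blast
  qed (use traffic_of_harmonic[OF assms(8) r] in blast)
  then show ?thesis by blast
qed

end
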